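(* Let $V\subset\mathbb{C}^n$ be an irreducible algebraic variety of dimension $m>0$ and degree $d$, in general position with respect to the coordinates $(x,y)$ of $\mathbb{C}^n$, where $x\in\mathbb{C}^{n-m}$ and $y\in\mathbb{C}^m$. Let $\pi\colon V\to\mathbb{C}^m$ be the projection $(x,y)\mapsto y$, with ramification locus $\Delta\subset\mathbb{C}^m$. Let $\ell\subset\mathbb{C}^m$ be a general line, parameterized by $t\in\mathbb{C}$, and let $C:=V\cap(\mathbb{C}^{n-m}\times\ell)$, a curve with projection $\pi\colon C\to\ell$. Then the sum in $\mathbb{C}^{n-m}$ of (the $x$-coordinates of) the points in the fiber of $C$ over $t\in\ell\smallsetminus\Delta$ is an affine function of $t$; that is, there are constant vectors $c_0,c_1\in\mathbb{C}^{n-m}$ such that this sum equals $c_0t+c_1$ for all $t\in\ell\smallsetminus\Delta$.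
   Context: All varieties are over $\mathbb{C}$, and $V$ is Zariski closed. "In general position with respect to the coordinates" means that the coordinates $(x,y)$ are obtained from given ones by a general affine linear change of coordinates (one in a suitable nonempty Zariski-open set depending on $V$); in particular $\pi\colon V\to\mathbb{C}^m$ is a branched cover whose fiber consists of $d=\deg V$ distinct points outside a proper closed subset $\Delta\subset\mathbb{C}^m$, the ramification locus. "General line" means a line in a suitable nonempty Zariski-open set of lines in $\mathbb{C}^m$ (in particular not contained in $\Delta$); its parameterization by $t$ is affine linear, and we identify $t$ with the corresponding point of $\ell$. Points of $C$ over $t$ have the form $(x,t)$ with $x\in\mathbb{C}^{n-m}$, and the sum is taken of the vectors $x$. *)

theory Defs
  imports "Jordan_Normal_Form.Matrix" "HOL-Library.Extended_Nat"
begin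

text \<open>
  Complex affine \<open>N\<close>-space is \<^term>\<open>carrier_vec N :: complex vec set\<close>.  Zariski topologies are needed
  on several spaces with coordinates (affine spaces, affine-linear maps, parameterized lines).  They
  are all described by a carrier \<open>S\<close> and a set \<open>X\<close> of coordinate functions on it; the closed sets are
  the common zero sets in \<open>S\<close> of polynomial expressions in the coordinates.  If \<open>S\<close> is only part of
  the affine space with coordinates \<open>X\<close>, this is the subspace topology.
\<close>

inductive_set poly_funs :: "('a \<Rightarrow> complex) set \<Rightarrow> ('a \<Rightarrow> complex) set"
  for X :: "('a \<Rightarrow> complex) set" where
  coord: "f \<in> X \<Longrightarrow> f \<in> poly_funs X"
| const: "(\<lambda>_. c) \<in> poly_funs X"
| add: "f \<in> poly_funs X \<Longrightarrow> g \<in> poly_funs X \<Longrightarrow> (\<lambda>p. f p + g p) \<in> poly_funs X"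
| mult: "f \<in> poly_funs X \<Longrightarrow> g \<in> poly_funs X \<Longrightarrow> (\<lambda>p. f p * g p) \<in> poly_funs X"

definition zariski_closed :: "'a set \<Rightarrow> ('a \<Rightarrow> complex) set \<Rightarrow> 'a set \<Rightarrow> bool" where
  "zariski_closed S X Z \<longleftrightarrow> (\<exists>F \<subseteq> poly_funs X. Z = {p \<in> S. \<forall>f\<in>F. f p = 0})"

definition zariski_open :: "'a set \<Rightarrow> ('a \<Rightarrow> complex) set \<Rightarrow> 'a set \<Rightarrow> bool" where
  "zariski_open S X U \<longleftrightarrow> U \<subseteq> S \<and> zariski_closed S X (S - U)"

definition vec_coords :: "nat \<Rightarrow> (complex vec \<Rightarrow> complex) set" where
  "vec_coords N = {\<lambda>v. v $ i | i. i < N}"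

definition irreducible_variety :: "nat \<Rightarrow> complex vec set \<Rightarrow> bool" where
  "irreducible_variety n V \<longleftrightarrow>
     zariski_closed (carrier_vec n) (vec_coords n) V \<and> V \<noteq> {} \<and>
     (\<forall>Z1 Z2. zariski_closed (carrier_vec n) (vec_coords n) Z1 \<longrightarrow>
              zariski_closed (carrier_vec n) (vec_coords n) Z2 \<longrightarrow>
              V = Z1 \<union> Z2 \<longrightarrow> V = Z1 \<or> V = Z2)"

definition variety_dim :: "nat \<Rightarrow> complex vec set \<Rightarrow> enat" where
  "variety_dim n V =
     Sup {enat k | k. \<exists>Z :: nat \<Rightarrow> complex vec set.
            (\<forall>i\<le>k. irreducible_variety n (Z i) \<and> Z i \<subseteq> V) \<and> (\<forall>i<k. Z i \<subset> Z (Suc i))}"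

text \<open>The pair \<open>(A, b)\<close> stands for the affine-linear map \<open>z \<mapsto> A z + b\<close> from \<open>c\<close>-space to \<open>r\<close>-space.\<close>

definition affine_maps :: "nat \<Rightarrow> nat \<Rightarrow> (complex mat \<times> complex vec) set" where
  "affine_maps r c = carrier_mat r c \<times> carrier_vec r"

definition affine_coords :: "nat \<Rightarrow> nat \<Rightarrow> (complex mat \<times> complex vec \<Rightarrow> complex) set" where
  "affine_coords r c =
     {\<lambda>(A, b). A $$ (i, j) | i j. i < r \<and> j < c} \<union> {\<lambda>(A, b). b $ i | i. i < r}"

definition affine_apply :: "complex mat \<times> complex vec \<Rightarrow> complex vec \<Rightarrow> complex vec" where
  "affine_apply g z = fst g *\<^sub>v z + snd g"

definition affine_group :: "nat \<Rightarrow> (complex mat \<times> complex vec) set" where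
  "affine_group n = {(A, b) \<in> affine_maps n n. invertible_mat A}"

text \<open>
  An \<open>m\<close>-dimensional \<open>V\<close> has degree \<open>d\<close> if a general affine-linear subspace of codimension \<open>m\<close>
  meets it in exactly \<open>d\<close> points.  Such subspaces are the zero sets of the affine-linear maps from
  \<open>n\<close>-space to \<open>m\<close>-space; the maps whose linear part has smaller rank do not matter, as they form a
  proper closed subset for \<open>m \<le> n\<close>.
\<close>

definition has_degree :: "nat \<Rightarrow> nat \<Rightarrow> complex vec set \<Rightarrow> nat \<Rightarrow> bool" where
  "has_degree n m V d \<longleftrightarrow>
     (\<exists>U. zariski_open (affine_maps m n) (affine_coords m n) U \<and> U \<noteq> {} \<and>
        (\<forall>h\<in>U. finite {z \<in> V. affine_apply h z = 0\<^sub>v m} \<and>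
               card {z \<in> V. affine_apply h z = 0\<^sub>v m} = d))"

text \<open>
  A point of \<open>n\<close>-space is \<open>z = (x, y)\<close> with \<open>x = vec_first z (n - m)\<close> and \<open>y = vec_last z m\<close>; the
  projection sends \<open>z\<close> to \<open>y\<close>.
\<close>

definition fiber :: "nat \<Rightarrow> complex vec set \<Rightarrow> complex vec \<Rightarrow> complex vec set" where
  "fiber m V y = {z \<in> V. vec_last z m = y}"

definition ramification_locus :: "nat \<Rightarrow> complex vec set \<Rightarrow> nat \<Rightarrow> complex vec set" where
  "ramification_locus m V d =
     {y \<in> carrier_vec m. \<not> (finite (fiber m V y) \<and> card (fiber m V y) = d)}"

definition line_params :: "nat \<Rightarrow> (complex vec \<times> complex vec) set" where
  "line_params m = {(a, b). a \<in> carrier_vec m \<and> b \<in> carrier_vec m \<and> b \<noteq> 0\<^sub>v m}"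

definition line_coords :: "nat \<Rightarrow> (complex vec \<times> complex vec \<Rightarrow> complex) set" where
  "line_coords m = {\<lambda>(a, b). a $ i | i. i < m} \<union> {\<lambda>(a, b). b $ i | i. i < m}"

definition line_point :: "complex vec \<Rightarrow> complex vec \<Rightarrow> complex \<Rightarrow> complex vec" where
  "line_point a b t = a + t \<cdot>\<^sub>v b"

definition affine_line :: "complex vec \<Rightarrow> complex vec \<Rightarrow> complex vec set" where
  "affine_line a b = range (line_point a b)"

text \<open>
  The lines in \<open>m\<close>-space carry the quotient topology from their parameterizations \<open>(a, b)\<close>.
\<close>

definition zariski_open_lines :: "nat \<Rightarrow> complex vec set set \<Rightarrow> bool" where
  "zariski_open_lines m W \<longleftrightarrow>
     W \<subseteq> {affine_line a b | a b. (a, b) \<in> line_params m} \<and>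
     zariski_open (line_params m) (line_coords m)
       {(a, b) \<in> line_params m. affine_line a b \<in> W}"

definition section_over :: "nat \<Rightarrow> nat \<Rightarrow> complex vec set \<Rightarrow> complex vec set \<Rightarrow> complex vec set" where
  "section_over n m V L = V \<inter> {x @\<^sub>v y | x y. x \<in> carrier_vec (n - m) \<and> y \<in> L}"

definition fiber_sum :: "nat \<Rightarrow> nat \<Rightarrow> complex vec set \<Rightarrow> complex vec \<Rightarrow> complex vec" where
  "fiber_sum n m C y = finsum_vec TYPE(complex) (n - m) (\<lambda>z. vec_first z (n - m)) (fiber m C y)"

end

theory Submission
  imports Defs "Subresultants.Subresultant_Gcd" "HOL-Computational_Algebra.Field_as_Ring"
    "HOL-Computational_Algebra.Fundamental_Theorem_Algebra" "HOL-Library.FuncSet"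
begin

text \<open>
  For general coordinates every coordinate of \<open>V\<close> satisfies a monic equation over the polynomials in
  \<open>y\<close> whose coefficients have at most the degree of a homogeneous relation.  Existence follows by counting
  monomials: \<open>m + 1\<close> generic affine forms satisfy a relation with coefficients polynomial in the forms,
  and a change of basis makes its leading form monic.  Hence \<open>V\<close> is finite over \<open>y\<close>-space and
  \<open>norm x\<close> grows at most linearly in \<open>norm y\<close>.

  For a linear form \<open>l\<close> in \<open>x\<close> let \<open>P\<close> be a polynomial over the polynomials in \<open>y\<close> of least
  degree that annihilates \<open>l\<close> on \<open>V\<close>.  Its roots are bounded by \<open>C (1 + norm y)\<close>, so after division by the
  leading coefficient the coefficients are rational functions of polynomial growth, that is, polynomials.
  By lying over, the roots of the monic \<open>P\<close> at \<open>y\<close> are exactly the values of \<open>l\<close> on the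
  fibre, and by separability \<open>P\<close> has degree at most \<open>d\<close>, with equality if \<open>l\<close> separates a fibre
  of \<open>d\<close> points.  So \<open>\<Delta>\<close> is cut out by discriminants, and off \<open>\<Delta>\<close> the sum of \<open>l\<close> over the fibre
  is minus the second coefficient of \<open>P\<close>, a polynomial of linear growth.
\<close>

section \<open>Polynomial functions\<close>

text \<open>Dimension and degree come from unrelated definitions: chains of irreducible subvarieties
  and general linear sections. They meet in a third number \<open>k\<close>, the least size of a set
  of functions over which all polynomials on the variety are finite. A chain yields \<open>m\<close>
  independent functions, so \<open>m\<close> is at most \<open>k\<close>; if \<open>k\<close> were
  larger, the projection to \<open>k\<close> general coordinates would still be onto, and the linear
  section counted for the degree would be infinite. The obstacle is that an equation of least degree
  is minimal only over rational functions of \<open>y\<close>: its leading coefficient may vanish at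
  some points. Degrees of families are therefore formal, division is fraction-free, and growth
  estimates take the place of the normality of the polynomial ring. Linear growth is used again to
  see that the second coefficient has degree at most 1 on a line, which is why integral equations
  carry weights. One form need not separate every fibre, so a family with one parameter
  \<open>c\<close> is used: finitely many \<open>c\<close> fail for given points, and comparing
  powers of \<open>c\<close> recovers each coordinate.\<close>

lemma poly_funs_comp:
  assumes "f \<in> poly_funs X" "\<And>x. x \<in> X \<Longrightarrow> (\<lambda>p. x (\<phi> p)) \<in> poly_funs Y"
  shows "(\<lambda>p. f (\<phi> p)) \<in> poly_funs Y"
  using assms(1) by induction (auto intro: assms(2) poly_funs.intros)

lemma poly_funs_mono: "f \<in> poly_funs X \<Longrightarrow> X \<subseteq> Y \<Longrightarrow> f \<in> poly_funs Y"
  using poly_funs_comp[of f X "\<lambda>p. p" Y] by (auto intro: poly_funs.coord)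

lemma poly_funs_cong_point:
  assumes "f \<in> poly_funs X" "\<And>x. x \<in> X \<Longrightarrow> x p = x q"
  shows "f p = f q"
  using assms(1) by induction (auto simp: assms(2))

lemma poly_funs_uminus: "f \<in> poly_funs X \<Longrightarrow> (\<lambda>p. - f p) \<in> poly_funs X"
  using poly_funs.mult[OF poly_funs.const[of "-1"]] by fastforce

lemma poly_funs_diff: "f \<in> poly_funs X \<Longrightarrow> g \<in> poly_funs X \<Longrightarrow> (\<lambda>p. f p - g p) \<in> poly_funs X"
  using poly_funs.add[OF _ poly_funs_uminus] by fastforce

lemma poly_funs_sum:
  "(\<And>i. i \<in> A \<Longrightarrow> f i \<in> poly_funs X) \<Longrightarrow> (\<lambda>p. \<Sum>i\<in>A. f i p) \<in> poly_funs X"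
  by (induction A rule: infinite_finite_induct) (auto intro: poly_funs.intros)

lemma poly_funs_prod:
  "(\<And>i. i \<in> A \<Longrightarrow> f i \<in> poly_funs X) \<Longrightarrow> (\<lambda>p. \<Prod>i\<in>A. f i p) \<in> poly_funs X"
  by (induction A rule: infinite_finite_induct) (auto intro: poly_funs.intros)

lemma poly_funs_power: "f \<in> poly_funs X \<Longrightarrow> (\<lambda>p. f p ^ k) \<in> poly_funs X"
  by (induction k) (auto intro: poly_funs.intros)

lemma poly_funs_det:
  assumes "\<And>p. M p \<in> carrier_mat k k"
    and "\<And>i j. i < k \<Longrightarrow> j < k \<Longrightarrow> (\<lambda>p. M p $$ (i, j)) \<in> poly_funs X"
  shows "(\<lambda>p. det (M p)) \<in> poly_funs X"
proof -
  have "(\<lambda>p. \<Sum>\<sigma>\<in>{\<sigma>. \<sigma> permutes {0..<k}}. signof \<sigma> * (\<Prod>i = 0..<k. M p $$ (i, \<sigma> i))) \<in> poly_funs X"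
    by (intro poly_funs_sum poly_funs.mult poly_funs.const poly_funs_prod assms(2))
      (auto dest: permutes_in_image)
  moreover have "det (M p) = (\<Sum>\<sigma>\<in>{\<sigma>. \<sigma> permutes {0..<k}}. signof \<sigma> * (\<Prod>i = 0..<k. M p $$ (i, \<sigma> i)))" for p
    using assms(1)[of p] by (rule det_def')
  ultimately show ?thesis by simp
qed

section \<open>Univariate polynomials with polynomial coefficients\<close>

definition poly_families :: "('a \<Rightarrow> complex) set \<Rightarrow> ('a \<Rightarrow> complex poly) set" where
  "poly_families X = {p. (\<forall>j. (\<lambda>s. coeff (p s) j) \<in> poly_funs X) \<and> (\<exists>N. \<forall>s. degree (p s) \<le> N)}"

lemma poly_families_coeff: "p \<in> poly_families X \<Longrightarrow> (\<lambda>s. coeff (p s) j) \<in> poly_funs X"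
  by (simp add: poly_families_def)

lemma poly_families_bound: "p \<in> poly_families X \<Longrightarrow> \<exists>N. \<forall>s. degree (p s) \<le> N"
  by (simp add: poly_families_def)

lemma poly_families_const: "(\<lambda>_. p) \<in> poly_families X"
  by (auto simp: poly_families_def intro: poly_funs.const)

lemma poly_families_pCons:
  assumes "f \<in> poly_funs X" "p \<in> poly_families X"
  shows "(\<lambda>s. pCons (f s) (p s)) \<in> poly_families X"
proof -
  obtain N where "\<forall>s. degree (p s) \<le> N" using assms(2) by (auto simp: poly_families_def)
  then have "\<forall>s. degree (pCons (f s) (p s)) \<le> Suc N"
    by (metis degree_pCons_le le_trans not_less_eq_eq)
  moreover have "(\<lambda>s. coeff (pCons (f s) (p s)) j) \<in> poly_funs X" for j
    using assms by (cases j) (auto simp: poly_families_def)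
  ultimately show ?thesis unfolding poly_families_def by blast
qed

lemma poly_families_coef: "f \<in> poly_funs X \<Longrightarrow> (\<lambda>s. [:f s:]) \<in> poly_families X"
  by (intro poly_families_pCons poly_families_const)

lemma poly_families_add:
  assumes "p \<in> poly_families X" "q \<in> poly_families X"
  shows "(\<lambda>s. p s + q s) \<in> poly_families X"
proof -
  obtain M N where "\<forall>s. degree (p s) \<le> M" "\<forall>s. degree (q s) \<le> N"
    using assms by (auto simp: poly_families_def)
  then have "\<forall>s. degree (p s + q s) \<le> max M N" by (meson degree_add_le_max le_trans max.mono)
  then show ?thesis using assms by (auto simp: poly_families_def intro: poly_funs.add)
qed

lemma poly_families_mult:
  assumes "p \<in> poly_families X" "q \<in> poly_families X"
  shows "(\<lambda>s. p s * q s) \<in> poly_families X"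
proof -
  obtain M N where "\<forall>s. degree (p s) \<le> M" "\<forall>s. degree (q s) \<le> N"
    using assms by (auto simp: poly_families_def)
  then have "\<forall>s. degree (p s * q s) \<le> M + N" by (meson add_mono degree_mult_le le_trans)
  moreover have "(\<lambda>s. coeff (p s * q s) j) \<in> poly_funs X" for j
    unfolding coeff_mult using assms
    by (intro poly_funs_sum poly_funs.mult) (auto simp: poly_families_def)
  ultimately show ?thesis by (auto simp: poly_families_def)
qed

lemma poly_families_smult:
  "f \<in> poly_funs X \<Longrightarrow> p \<in> poly_families X \<Longrightarrow> (\<lambda>s. smult (f s) (p s)) \<in> poly_families X"
  using poly_families_mult[OF poly_families_coef] by fastforce

lemma poly_families_diff:
  "p \<in> poly_families X \<Longrightarrow> q \<in> poly_families X \<Longrightarrow> (\<lambda>s. p s - q s) \<in> poly_families X"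
  using poly_families_add[OF _ poly_families_mult[OF poly_families_const[of "-1"]]] by fastforce

lemma poly_families_pderiv:
  assumes "p \<in> poly_families X"
  shows "(\<lambda>s. pderiv (p s)) \<in> poly_families X"
proof -
  obtain N where "\<forall>s. degree (p s) \<le> N" using assms by (auto simp: poly_families_def)
  then have "\<forall>s. degree (pderiv (p s)) \<le> N" by (simp add: degree_pderiv le_diff_conv le_SucI)
  then show ?thesis using assms
    by (auto simp: poly_families_def coeff_pderiv intro!: poly_funs.mult poly_funs.const)
qed

lemma poly_families_mono: "p \<in> poly_families X \<Longrightarrow> X \<subseteq> Y \<Longrightarrow> p \<in> poly_families Y"
  by (auto simp: poly_families_def intro: poly_funs_mono)

lemma poly_families_comp:
  assumes "p \<in> poly_families X" "\<And>x. x \<in> X \<Longrightarrow> (\<lambda>s. x (\<phi> s)) \<in> poly_funs Y"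
  shows "(\<lambda>s. p (\<phi> s)) \<in> poly_families Y"
proof -
  have "(\<lambda>s. coeff (p (\<phi> s)) j) \<in> poly_funs Y" for j
    by (rule poly_funs_comp[OF poly_families_coeff[OF assms(1)] assms(2)])
  then show ?thesis using assms(1) unfolding poly_families_def by blast
qed

text \<open>The uniform degree bound in \<open>poly_families\<close> matters here: it turns the
  value into one fixed finite sum, which finite degree at each point alone would not do.\<close>

lemma poly_families_eval:
  assumes "p \<in> poly_families X" "f \<in> poly_funs X"
  shows "(\<lambda>s. poly (p s) (f s)) \<in> poly_funs X"
proof -
  obtain N where N: "\<forall>s. degree (p s) \<le> N" using assms by (auto simp: poly_families_def)
  have "poly (p s) (f s) = (\<Sum>j\<le>N. coeff (p s) j * f s ^ j)" for s
    unfolding poly_altdef using N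
    by (intro sum.mono_neutral_left) (auto simp: coeff_eq_0)
  then show ?thesis using assms
    by (simp add: poly_families_def poly_funs_sum poly_funs.mult poly_funs_power)
qed

lemma poly_families_cong_point:
  assumes "p \<in> poly_families X" "\<And>x. x \<in> X \<Longrightarrow> x s = x t"
  shows "p s = p t"
proof (rule poly_eqI)
  fix j show "coeff (p s) j = coeff (p t) j"
    by (rule poly_funs_cong_point[OF poly_families_coeff[OF assms(1)] assms(2)])
qed

text \<open>One induction serves both restriction to a line and isolation of the last variable: in
  each case the coordinates of \<open>\<phi> b t\<close> are polynomials in \<open>t\<close> with
  coefficients polynomial in \<open>b\<close>.\<close>

lemma poly_funs_expand:
  assumes "f \<in> poly_funs X"
    and "\<And>x. x \<in> X \<Longrightarrow> \<exists>p\<in>poly_families Y. \<forall>b t. x (\<phi> b t) = poly (p b) t"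
  shows "\<exists>p\<in>poly_families Y. \<forall>b t. f (\<phi> b t) = poly (p b) t"
  using assms(1)
proof induction
  case (const c)
  show ?case by (rule bexI[OF _ poly_families_const[of "[:c:]"]]) auto
next
  case (add f g)
  then obtain p q where pq: "p \<in> poly_families Y" "q \<in> poly_families Y"
    "\<forall>b t. f (\<phi> b t) = poly (p b) t" "\<forall>b t. g (\<phi> b t) = poly (q b) t" by auto
  then show ?case by (intro bexI[OF _ poly_families_add[of p _ q]]) auto
next
  case (mult f g)
  then obtain p q where pq: "p \<in> poly_families Y" "q \<in> poly_families Y"
    "\<forall>b t. f (\<phi> b t) = poly (p b) t" "\<forall>b t. g (\<phi> b t) = poly (q b) t" by auto
  then show ?case by (intro bexI[OF _ poly_families_mult[of p _ q]]) auto
qed (use assms(2) in auto)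

section \<open>Coordinate functions, restriction to lines, density of open sets\<close>

definition coords :: "'i set \<Rightarrow> (('i \<Rightarrow> complex) \<Rightarrow> complex) set" where
  "coords I = (\<lambda>i s. s i) ` I"

lemma coordsI: "i \<in> I \<Longrightarrow> (\<lambda>s. s i) \<in> coords I"
  by (auto simp: coords_def)

lemma coords_mono: "I \<subseteq> J \<Longrightarrow> coords I \<subseteq> coords J"
  by (auto simp: coords_def)

lemma poly_funs_coord: "i \<in> I \<Longrightarrow> (\<lambda>s. s i) \<in> poly_funs (coords I)"
  by (intro poly_funs.coord coordsI)

lemma poly_funs_agree:
  "f \<in> poly_funs (coords I) \<Longrightarrow> (\<And>i. i \<in> I \<Longrightarrow> s i = t i) \<Longrightarrow> f s = f t"
  by (erule poly_funs_cong_point) (auto simp: coords_def)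

lemma poly_families_agree:
  "p \<in> poly_families (coords I) \<Longrightarrow> (\<And>i. i \<in> I \<Longrightarrow> s i = t i) \<Longrightarrow> p s = p t"
  by (erule poly_families_cong_point) (auto simp: coords_def)

lemma poly_funs_line:
  assumes "f \<in> poly_funs (coords I)"
  shows "\<exists>p\<in>poly_families (coords I). \<forall>v t. f (\<lambda>i. a i + t * v i) = poly (p v) t"
proof (rule poly_funs_expand[OF assms])
  fix x :: "('a \<Rightarrow> complex) \<Rightarrow> complex" assume "x \<in> coords I"
  then obtain i where i: "i \<in> I" "x = (\<lambda>s. s i)" by (auto simp: coords_def)
  have "(\<lambda>v. [:a i, v i:]) \<in> poly_families (coords I)"
    by (intro poly_families_pCons poly_families_const poly_funs.const poly_funs_coord i)
  then show "\<exists>p\<in>poly_families (coords I). \<forall>v t. x (\<lambda>i. a i + t * v i) = poly (p v) t"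
    by (rule bexI[rotated]) (simp add: i)
qed

lemma poly_funs_split_last:
  assumes "f \<in> poly_funs (coords {..<Suc k})"
  shows "\<exists>p\<in>poly_families (coords {..<k}). \<forall>s t. f (s(k := t)) = poly (p s) t"
proof (rule poly_funs_expand[OF assms])
  fix x :: "(nat \<Rightarrow> complex) \<Rightarrow> complex" assume "x \<in> coords {..<Suc k}"
  then obtain i where i: "i < Suc k" "x = (\<lambda>s. s i)" by (auto simp: coords_def)
  show "\<exists>p\<in>poly_families (coords {..<k}). \<forall>s t. x (s(k := t)) = poly (p s) t"
  proof (cases "i = k")
    case True
    then show ?thesis by (intro bexI[OF _ poly_families_const[of "[:0, 1:]"]]) (auto simp: i)
  next
    case False
    with i have "i \<in> {..<k}" by auto
    then show ?thesis
      by (intro bexI[OF _ poly_families_coef[OF poly_funs_coord]]) (auto simp: i False)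
  qed
qed

text \<open>Irreducibility of affine space: on the line joining \<open>a\<close> to \<open>b\<close>
  both functions become nonzero polynomials in one variable, and so does their product.\<close>

lemma poly_funs_common_nonzero:
  assumes "f \<in> poly_funs (coords I)" "g \<in> poly_funs (coords I)" "f a \<noteq> 0" "g b \<noteq> 0"
  shows "\<exists>c. f c \<noteq> 0 \<and> g c \<noteq> 0"
proof -
  let ?v = "\<lambda>i. b i - a i"
  obtain p q where pq: "\<forall>t. f (\<lambda>i. a i + t * ?v i) = poly p t" "\<forall>t. g (\<lambda>i. a i + t * ?v i) = poly q t"
    using poly_funs_line[OF assms(1), of a] poly_funs_line[OF assms(2), of a] by metis
  have "poly p 0 \<noteq> 0" "poly q 1 \<noteq> 0" using assms pq[rule_format, symmetric] by auto
  then have "p * q \<noteq> 0" by auto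
  then obtain t where "poly (p * q) t \<noteq> 0" using poly_all_0_iff_0 by blast
  then show ?thesis using pq by (metis poly_mult mult_eq_0_iff)
qed

lemma poly_funs_zero_on_open:
  assumes "f \<in> poly_funs (coords I)" "g \<in> poly_funs (coords I)" "g b \<noteq> 0"
    and "\<And>s. g s \<noteq> 0 \<Longrightarrow> f s = 0"
  shows "f s = 0"
  using poly_funs_common_nonzero[OF assms(1,2) _ assms(3)] assms(4) by blast

lemma poly_funs_prod_nonzero:
  assumes "finite A" "\<And>i. i \<in> A \<Longrightarrow> f i \<in> poly_funs (coords I)" "\<And>i. i \<in> A \<Longrightarrow> \<exists>s. f i s \<noteq> 0"
  shows "\<exists>s. (\<Prod>i\<in>A. f i s) \<noteq> 0"
  using assms
proof (induction A rule: finite_induct)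
  case (insert i A)
  then obtain a b where "f i a \<noteq> 0" "(\<Prod>i\<in>A. f i b) \<noteq> 0" by (metis insertCI)
  then obtain c where "f i c \<noteq> 0 \<and> (\<Prod>i\<in>A. f i c) \<noteq> 0"
    using poly_funs_common_nonzero[of "f i" I "\<lambda>s. \<Prod>i\<in>A. f i s" a b] insert.prems
      poly_funs_prod[of A f "coords I"] by auto
  then show ?case using insert.hyps by auto
qed auto

section \<open>The filtration by degree\<close>

inductive poly_upto :: "('a \<Rightarrow> complex) set \<Rightarrow> nat \<Rightarrow> ('a \<Rightarrow> complex) \<Rightarrow> bool"
  for X :: "('a \<Rightarrow> complex) set" where
  const: "poly_upto X k (\<lambda>_. c)"
| add: "poly_upto X k f \<Longrightarrow> poly_upto X k g \<Longrightarrow> poly_upto X k (\<lambda>p. f p + g p)"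
| up: "poly_upto X k f \<Longrightarrow> poly_upto X (Suc k) f"
| coord_mult: "x \<in> X \<Longrightarrow> poly_upto X k f \<Longrightarrow> poly_upto X (Suc k) (\<lambda>p. x p * f p)"

definition polys_upto :: "('a \<Rightarrow> complex) set \<Rightarrow> nat \<Rightarrow> ('a \<Rightarrow> complex) set" where
  "polys_upto X k = {f. poly_upto X k f}"

lemma polys_upto_const: "(\<lambda>_. c) \<in> polys_upto X k"
  and polys_upto_add: "f \<in> polys_upto X k \<Longrightarrow> g \<in> polys_upto X k \<Longrightarrow> (\<lambda>p. f p + g p) \<in> polys_upto X k"
  and polys_upto_up: "f \<in> polys_upto X k \<Longrightarrow> f \<in> polys_upto X (Suc k)"
  and polys_upto_coord_mult:
    "x \<in> X \<Longrightarrow> f \<in> polys_upto X k \<Longrightarrow> (\<lambda>p. x p * f p) \<in> polys_upto X (Suc k)"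
  by (auto simp: polys_upto_def intro: poly_upto.intros)

lemmas polys_upto_intros = polys_upto_const polys_upto_add polys_upto_up polys_upto_coord_mult

lemma polys_upto_induct [consumes 1, case_names const add up coord_mult, induct set: polys_upto]:
  assumes "f \<in> polys_upto X k"
    and "\<And>c k. P k (\<lambda>_. c)"
    and "\<And>f k g. f \<in> polys_upto X k \<Longrightarrow> P k f \<Longrightarrow> g \<in> polys_upto X k \<Longrightarrow> P k g \<Longrightarrow> P k (\<lambda>p. f p + g p)"
    and "\<And>f k. f \<in> polys_upto X k \<Longrightarrow> P k f \<Longrightarrow> P (Suc k) f"
    and "\<And>x f k. x \<in> X \<Longrightarrow> f \<in> polys_upto X k \<Longrightarrow> P k f \<Longrightarrow> P (Suc k) (\<lambda>p. x p * f p)"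
  shows "P k f"
  using assms(1) unfolding polys_upto_def mem_Collect_eq
  by induction (auto intro: assms(2-) simp: polys_upto_def)

lemma polys_upto_mono: "f \<in> polys_upto X j \<Longrightarrow> j \<le> k \<Longrightarrow> f \<in> polys_upto X k"
  by (rotate_tac, induction k rule: dec_induct) (auto intro: polys_upto_up)

lemma polys_upto_subset: "j \<le> k \<Longrightarrow> polys_upto X j \<subseteq> polys_upto X k"
  by (auto intro: polys_upto_mono)

lemma polys_upto_mult:
  assumes "f \<in> polys_upto X j" "g \<in> polys_upto X k"
  shows "(\<lambda>p. f p * g p) \<in> polys_upto X (j + k)"
  using assms(1)
proof induction
  case (const c j)
  have "(\<lambda>p. c * g p) \<in> polys_upto X k" using assms(2)
  proof induction
    case (const d k)
    show ?case by (rule polys_upto_const)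
  next
    case (add f k g)
    then show ?case using polys_upto_add by (fastforce simp: distrib_left)
  next
    case (coord_mult x f k)
    then show ?case using polys_upto_coord_mult[OF coord_mult(1,3)] by (simp add: mult.left_commute)
  qed (rule polys_upto_up)
  then show ?case by (rule polys_upto_mono) auto
next
  case (add f j h)
  then show ?case using polys_upto_add by (fastforce simp: distrib_right)
next
  case (up f j)
  then show ?case by (auto intro: polys_upto_up)
next
  case (coord_mult x f j)
  then show ?case using polys_upto_coord_mult[OF coord_mult(1,3)] by (simp add: mult.assoc)
qed

lemma polys_upto_coord: "x \<in> X \<Longrightarrow> x \<in> polys_upto X 1"
  using polys_upto_coord_mult[OF _ polys_upto_const[of 1], of x X 0] by simp

lemma polys_upto_scale: "f \<in> polys_upto X k \<Longrightarrow> (\<lambda>p. c * f p) \<in> polys_upto X k"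
  using polys_upto_mult[OF polys_upto_const[of c X 0]] by simp

lemma polys_upto_sum:
  "(\<And>i. i \<in> A \<Longrightarrow> f i \<in> polys_upto X k) \<Longrightarrow> (\<lambda>p. \<Sum>i\<in>A. f i p) \<in> polys_upto X k"
  by (induction A rule: infinite_finite_induct) (auto intro: polys_upto_intros)

lemma polys_upto_imp_poly_funs: "f \<in> polys_upto X k \<Longrightarrow> f \<in> poly_funs X"
  by (induction rule: polys_upto_induct) (auto intro: poly_funs.intros)

lemma poly_funs_imp_polys_upto: "f \<in> poly_funs X \<Longrightarrow> \<exists>k. f \<in> polys_upto X k"
proof (induction rule: poly_funs.induct)
  case (add f g)
  then obtain j k where "f \<in> polys_upto X j" "g \<in> polys_upto X k" by auto
  then have "f \<in> polys_upto X (max j k)" "g \<in> polys_upto X (max j k)"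
    by (auto intro: polys_upto_mono)
  then show ?case by (auto intro: polys_upto_add)
qed (auto intro: polys_upto_coord polys_upto_const polys_upto_mult)

lemma polys_upto_comp:
  assumes "f \<in> polys_upto X k" "\<And>x. x \<in> X \<Longrightarrow> (\<lambda>p. x (\<phi> p)) \<in> polys_upto Y 1"
  shows "(\<lambda>p. f (\<phi> p)) \<in> polys_upto Y k"
  using assms(1)
proof induction
  case (coord_mult x f k)
  then show ?case using polys_upto_mult[OF assms(2)[OF coord_mult(1)] coord_mult(3)] by simp
qed (auto intro: polys_upto_intros)

text \<open>Polynomials in the functions \<open>w i\<close> are lifted to coordinates with the same
  degree bound. This turns an equation on \<open>V\<close> into one that can be evaluated at points
  off \<open>V\<close>.\<close>

lemma polys_upto_image:
  assumes "f \<in> polys_upto (w ` I) k"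
  shows "\<exists>G\<in>polys_upto (coords I) k. f = (\<lambda>s. G (\<lambda>i. w i s))"
  using assms
proof induction
  case (const c k)
  show ?case by (rule bexI[OF _ polys_upto_const[of c]]) simp
next
  case (add f k g)
  then obtain F G where "F \<in> polys_upto (coords I) k" "f = (\<lambda>s. F (\<lambda>i. w i s))"
    "G \<in> polys_upto (coords I) k" "g = (\<lambda>s. G (\<lambda>i. w i s))" by auto
  then show ?case by (intro bexI[OF _ polys_upto_add[of F _ _ G]]) auto
next
  case (up f k)
  then show ?case by (auto intro: polys_upto_up)
next
  case (coord_mult x f k)
  then obtain F i where "F \<in> polys_upto (coords I) k" "f = (\<lambda>s. F (\<lambda>i. w i s))"
    "i \<in> I" "x = w i" by auto
  then show ?case by (intro bexI[OF _ polys_upto_coord_mult[OF coordsI[of i]]]) auto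
qed

section \<open>Linear relations over rings of functions\<close>

text \<open>Gaussian elimination without division: more vectors than entries are linearly dependent over
  every ring of functions without zero divisors.\<close>

lemma linear_relation_over_functions:
  fixes M :: "'r \<Rightarrow> 'c \<Rightarrow> ('i \<Rightarrow> complex) \<Rightarrow> complex"
  assumes "finite T" "finite A" "card T < card A"
    and "\<And>\<alpha> \<tau>. \<alpha> \<in> A \<Longrightarrow> \<tau> \<in> T \<Longrightarrow> M \<alpha> \<tau> \<in> poly_funs (coords I)"
  shows "\<exists>c. (\<forall>\<alpha>\<in>A. c \<alpha> \<in> poly_funs (coords I)) \<and> (\<exists>\<alpha>\<in>A. \<exists>b. c \<alpha> b \<noteq> 0) \<and>
    (\<forall>\<tau>\<in>T. \<forall>b. (\<Sum>\<alpha>\<in>A. c \<alpha> b * M \<alpha> \<tau> b) = 0)"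
  using assms
proof (induction T arbitrary: A M rule: finite_induct)
  case empty
  then obtain \<alpha> where "\<alpha> \<in> A" by fastforce
  then show ?case by (intro exI[of _ "\<lambda>_ _. 1"]) (auto intro: poly_funs.const)
next
  case (insert \<tau> T)
  show ?case
  proof (cases "\<forall>\<alpha>\<in>A. \<forall>b. M \<alpha> \<tau> b = 0")
    case True
    obtain c where "(\<forall>\<alpha>\<in>A. c \<alpha> \<in> poly_funs (coords I)) \<and> (\<exists>\<alpha>\<in>A. \<exists>b. c \<alpha> b \<noteq> 0) \<and>
      (\<forall>\<tau>\<in>T. \<forall>b. (\<Sum>\<alpha>\<in>A. c \<alpha> b * M \<alpha> \<tau> b) = 0)"
      using insert.IH[of A M] insert.prems insert.hyps by auto
    then show ?thesis using True by (intro exI[of _ c]) auto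
  next
    case False
    then obtain \<beta> b0 where \<beta>: "\<beta> \<in> A" "M \<beta> \<tau> b0 \<noteq> 0" by auto
    \<comment> \<open>Cross-multiplication by the pivot \<open>M \<beta> \<tau>\<close> removes
      column \<open>\<tau>\<close>.\<close>
    define M' where "M' \<alpha> \<sigma> = (\<lambda>b. M \<beta> \<tau> b * M \<alpha> \<sigma> b - M \<alpha> \<tau> b * M \<beta> \<sigma> b)" for \<alpha> \<sigma>
    have "\<exists>c. (\<forall>\<alpha>\<in>A - {\<beta>}. c \<alpha> \<in> poly_funs (coords I)) \<and> (\<exists>\<alpha>\<in>A - {\<beta>}. \<exists>b. c \<alpha> b \<noteq> 0) \<and>
      (\<forall>\<sigma>\<in>T. \<forall>b. (\<Sum>\<alpha>\<in>A - {\<beta>}. c \<alpha> b * M' \<alpha> \<sigma> b) = 0)"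
    proof (rule insert.IH)
      show "M' \<alpha> \<sigma> \<in> poly_funs (coords I)" if "\<alpha> \<in> A - {\<beta>}" "\<sigma> \<in> T" for \<alpha> \<sigma>
        unfolding M'_def using that \<beta> insert.prems
        by (intro poly_funs_diff poly_funs.mult) auto
    qed (use insert.prems insert.hyps \<beta> in auto)
    then obtain c where c: "\<forall>\<alpha>\<in>A - {\<beta>}. c \<alpha> \<in> poly_funs (coords I)"
      "\<exists>\<alpha>\<in>A - {\<beta>}. \<exists>b. c \<alpha> b \<noteq> 0"
      "\<forall>\<sigma>\<in>T. \<forall>b. (\<Sum>\<alpha>\<in>A - {\<beta>}. c \<alpha> b * M' \<alpha> \<sigma> b) = 0" by auto
    \<comment> \<open>Multiplying \<open>c\<close> by the pivot leaves room to choose the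
      coefficient of \<open>\<beta>\<close> so that column \<open>\<tau>\<close> cancels; the other
      columns reduce to the relation for \<open>M'\<close>.\<close>
    define e where "e \<alpha> = (if \<alpha> = \<beta> then (\<lambda>b. - (\<Sum>\<alpha>\<in>A - {\<beta>}. c \<alpha> b * M \<alpha> \<tau> b))
      else (\<lambda>b. M \<beta> \<tau> b * c \<alpha> b))" for \<alpha>
    have split: "(\<Sum>\<alpha>\<in>A. e \<alpha> b * M \<alpha> \<sigma> b) =
      - (\<Sum>\<alpha>\<in>A - {\<beta>}. c \<alpha> b * M \<alpha> \<tau> b) * M \<beta> \<sigma> b + (\<Sum>\<alpha>\<in>A - {\<beta>}. M \<beta> \<tau> b * c \<alpha> b * M \<alpha> \<sigma> b)" for \<sigma> b
      using \<beta> insert.prems by (simp add: sum.remove[of A \<beta>] e_def)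
    have "(\<Sum>\<alpha>\<in>A. e \<alpha> b * M \<alpha> \<sigma> b) = 0" if "\<sigma> \<in> insert \<tau> T" for \<sigma> b
    proof (cases "\<sigma> = \<tau>")
      case True
      then show ?thesis unfolding split by (simp add: sum_distrib_right sum_distrib_left mult_ac)
    next
      case False
      have "(\<Sum>\<alpha>\<in>A. e \<alpha> b * M \<alpha> \<sigma> b) = (\<Sum>\<alpha>\<in>A - {\<beta>}. c \<alpha> b * M' \<alpha> \<sigma> b)"
        unfolding split M'_def
        by (simp add: sum_distrib_right sum_distrib_left right_diff_distrib sum_subtractf mult_ac)
      then show ?thesis using c(3) that False by auto
    qed
    moreover have "e \<alpha> \<in> poly_funs (coords I)" if "\<alpha> \<in> A" for \<alpha>
      using that c(1) \<beta> insert.prems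
      by (auto simp: e_def intro!: poly_funs_uminus poly_funs_sum poly_funs.mult)
    moreover obtain \<alpha> b1 where "\<alpha> \<in> A - {\<beta>}" "c \<alpha> b1 \<noteq> 0" using c(2) by auto
    \<comment> \<open>The pivot and \<open>c \<alpha>\<close> are both nonzero functions, so their
      product \<open>e \<alpha>\<close> is nonzero somewhere.\<close>
    then obtain b where "M \<beta> \<tau> b \<noteq> 0 \<and> c \<alpha> b \<noteq> 0"
      using poly_funs_common_nonzero[of "M \<beta> \<tau>" I "c \<alpha>"] \<beta> c(1) insert.prems by blast
    then have "\<exists>\<alpha>\<in>A. \<exists>b. e \<alpha> b \<noteq> 0" using \<open>\<alpha> \<in> A - {\<beta>}\<close>
      by (intro bexI[of _ \<alpha>] exI[of _ b]) (auto simp: e_def)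
    ultimately show ?thesis by (intro exI[of _ e]) auto
  qed
qed

section \<open>Monomials and dimension counts\<close>

definition monomial :: "'i set \<Rightarrow> ('i \<Rightarrow> nat) \<Rightarrow> ('i \<Rightarrow> complex) \<Rightarrow> complex" where
  "monomial I \<alpha> s = (\<Prod>i\<in>I. s i ^ \<alpha> i)"

text \<open>Sorted by powers of the new variable, the sum has a coefficient that induction makes
  nonzero at suitable values of the others; some value of the new variable then avoids the finitely
  many roots.\<close>

lemma monomials_independent:
  fixes c :: "('i \<Rightarrow> nat) \<Rightarrow> complex"
  assumes "finite I" "\<beta> \<in> PiE I (\<lambda>_. {..<K})" "c \<beta> \<noteq> 0"
  shows "\<exists>s. (\<Sum>\<alpha>\<in>PiE I (\<lambda>_. {..<K}). c \<alpha> * monomial I \<alpha> s) \<noteq> 0"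
  using assms
proof (induction I arbitrary: c \<beta> rule: finite_induct)
  case empty
  then show ?case by (simp add: monomial_def)
next
  case (insert i I)
  let ?B = "PiE I (\<lambda>_. {..<K})"
  define r where "r e s = (\<Sum>\<alpha>\<in>?B. c (\<alpha>(i := e)) * monomial I \<alpha> s)" for e s
  have eq: "(\<Sum>\<alpha>\<in>PiE (insert i I) (\<lambda>_. {..<K}). c \<alpha> * monomial (insert i I) \<alpha> s)
     = (\<Sum>e<K. r e s * s i ^ e)" for s
  proof -
    have "(\<Sum>\<alpha>\<in>PiE (insert i I) (\<lambda>_. {..<K}). c \<alpha> * monomial (insert i I) \<alpha> s)
      = (\<Sum>(e, \<alpha>)\<in>{..<K} \<times> ?B. c (\<alpha>(i := e)) * monomial (insert i I) (\<alpha>(i := e)) s)"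
      using insert.hyps
      by (subst PiE_insert_eq, subst sum.reindex[OF inj_combinator]) (auto simp: case_prod_unfold)
    also have "\<dots> = (\<Sum>(e, \<alpha>)\<in>{..<K} \<times> ?B. c (\<alpha>(i := e)) * monomial I \<alpha> s * s i ^ e)"
    proof (rule sum.cong, simp, clarify)
      fix e \<alpha>
      have "(\<Prod>j\<in>I. s j ^ (\<alpha>(i := e)) j) = (\<Prod>j\<in>I. s j ^ \<alpha> j)"
        using insert.hyps by (intro prod.cong) auto
      then show "c (\<alpha>(i := e)) * monomial (insert i I) (\<alpha>(i := e)) s = c (\<alpha>(i := e)) * monomial I \<alpha> s * s i ^ e"
        using insert.hyps by (simp add: monomial_def)
    qed
    also have "\<dots> = (\<Sum>e<K. r e s * s i ^ e)"
      by (simp add: sum.cartesian_product[symmetric] r_def sum_distrib_right)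
    finally show ?thesis .
  qed
  from insert.prems have \<beta>: "\<beta> i < K" "restrict \<beta> I \<in> ?B" "c ((restrict \<beta> I)(i := \<beta> i)) \<noteq> 0"
  proof -
    have "(restrict \<beta> I)(i := \<beta> i) = \<beta>" using insert.prems insert.hyps
      by (auto simp: fun_eq_iff PiE_iff extensional_def restrict_def)
    then show "c ((restrict \<beta> I)(i := \<beta> i)) \<noteq> 0" using insert.prems by simp
  qed (use insert.prems in \<open>auto simp: PiE_iff\<close>)
  obtain s where s: "r (\<beta> i) s \<noteq> 0"
    using insert.IH[of "restrict \<beta> I" "\<lambda>\<alpha>. c (\<alpha>(i := \<beta> i))"] \<beta>(2,3) unfolding r_def by blast
  define p where "p = (\<Sum>e<K. monom (r e s) e)"
  have "coeff p (\<beta> i) = r (\<beta> i) s" using \<beta>(1) by (simp add: p_def coeff_sum)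
  then have "p \<noteq> 0" using s by auto
  then obtain t where t: "poly p t \<noteq> 0" using poly_all_0_iff_0 by blast
  have "r e (s(i := t)) = r e s" for e
    unfolding r_def monomial_def using insert.hyps
    by (intro sum.cong arg_cong2[of _ _ _ _ "(*)"] prod.cong refl) auto
  then have "(\<Sum>e<K. r e (s(i := t)) * (s(i := t)) i ^ e) = poly p t"
    by (simp add: p_def poly_sum poly_monom)
  then show ?case using t eq[of "s(i := t)"] by (intro exI[of _ "s(i := t)"]) (simp del: fun_upd_apply)
qed

text \<open>Sums of products of a polynomial in the parameters \<open>b\<close> and a function of
  the point \<open>s\<close>. Keeping the arguments apart lets the coefficients of generic forms
  stay indeterminate while points range over \<open>V\<close>.\<close>

inductive_set param_span :: "'j set \<Rightarrow> ('a \<Rightarrow> complex) set \<Rightarrow> (('j \<Rightarrow> complex) \<Rightarrow> 'a \<Rightarrow> complex) set"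
  for J S where
  zero: "(\<lambda>_ _. 0) \<in> param_span J S"
| add: "F \<in> param_span J S \<Longrightarrow> G \<in> param_span J S \<Longrightarrow> (\<lambda>b s. F b s + G b s) \<in> param_span J S"
| scaled: "a \<in> poly_funs (coords J) \<Longrightarrow> \<phi> \<in> S \<Longrightarrow> (\<lambda>b s. a b * \<phi> s) \<in> param_span J S"

lemma param_span_sum:
  "(\<And>i. i \<in> A \<Longrightarrow> F i \<in> param_span J S) \<Longrightarrow> (\<lambda>b s. \<Sum>i\<in>A. F i b s) \<in> param_span J S"
  by (induction A rule: infinite_finite_induct) (auto intro: param_span.intros)

lemma param_span_mono: "F \<in> param_span J S \<Longrightarrow> S \<subseteq> T \<Longrightarrow> F \<in> param_span J T"
  by (induction rule: param_span.induct) (auto intro: param_span.intros)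

lemma param_span_mult:
  assumes "F \<in> param_span J S" "G \<in> param_span J T"
    and "\<And>\<phi> \<psi>. \<phi> \<in> S \<Longrightarrow> \<psi> \<in> T \<Longrightarrow> (\<lambda>s. \<phi> s * \<psi> s) \<in> W"
  shows "(\<lambda>b s. F b s * G b s) \<in> param_span J W"
  using assms(1)
proof induction
  case (add F H)
  then show ?case using param_span.add by (fastforce simp: distrib_right)
next
  case (scaled a \<phi>)
  show ?case using assms(2)
  proof induction
    case (add F H)
    then show ?case using param_span.add by (fastforce simp: distrib_left)
  next
    case (scaled a' \<phi>')
    have "(\<lambda>b s. (a b * a' b) * (\<phi> s * \<phi>' s)) \<in> param_span J W"
      using scaled \<open>a \<in> poly_funs (coords J)\<close> \<open>\<phi> \<in> S\<close>
      by (intro param_span.scaled poly_funs.mult assms(3)) auto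
    then show ?case by (simp add: mult_ac)
  qed (auto intro: param_span.zero)
qed (auto intro: param_span.zero)

lemma param_span_upto_mult:
  "F \<in> param_span J (polys_upto X j) \<Longrightarrow> G \<in> param_span J (polys_upto X k) \<Longrightarrow>
    (\<lambda>b s. F b s * G b s) \<in> param_span J (polys_upto X (j + k))"
  by (rule param_span_mult[OF _ _ polys_upto_mult])

lemma param_span_const: "(\<lambda>_ _. c) \<in> param_span J (polys_upto X k)"
  using param_span.scaled[OF poly_funs.const[of c] polys_upto_const[of 1]] by simp

lemma param_span_upto_power:
  "F \<in> param_span J (polys_upto X j) \<Longrightarrow> (\<lambda>b s. F b s ^ k) \<in> param_span J (polys_upto X (j * k))"
proof (induction k)
  case 0
  show ?case by (simp add: param_span_const)
next
  case (Suc k)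
  then show ?case using param_span_upto_mult[OF Suc.prems Suc.IH[OF Suc.prems]] by simp
qed

lemma param_span_upto_monomial:
  assumes "finite I" "\<And>i. i \<in> I \<Longrightarrow> F i \<in> param_span J (polys_upto X c)"
  shows "(\<lambda>b s. monomial I \<alpha> (\<lambda>i. F i b s)) \<in> param_span J (polys_upto X (c * (\<Sum>i\<in>I. \<alpha> i)))"
  using assms
proof (induction I rule: finite_induct)
  case empty
  show ?case by (simp add: monomial_def param_span_const)
next
  case (insert i I)
  have "(\<lambda>b s. F i b s ^ \<alpha> i * monomial I \<alpha> (\<lambda>i. F i b s)) \<in>
    param_span J (polys_upto X (c * \<alpha> i + c * (\<Sum>i\<in>I. \<alpha> i)))"
    using insert by (intro param_span_upto_mult param_span_upto_power) auto
  then show ?case using insert.hyps by (simp add: monomial_def distrib_left)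
qed

lemma param_span_finite:
  assumes "F \<in> param_span J S" "finite T"
    and "\<And>\<phi>. \<phi> \<in> S \<Longrightarrow> \<exists>e. \<forall>s\<in>V. \<phi> s = (\<Sum>\<tau>\<in>T. e \<tau> * \<psi> \<tau> s)"
  shows "\<exists>M. (\<forall>\<tau>\<in>T. M \<tau> \<in> poly_funs (coords J)) \<and> (\<forall>b. \<forall>s\<in>V. F b s = (\<Sum>\<tau>\<in>T. M \<tau> b * \<psi> \<tau> s))"
  using assms(1)
proof induction
  case zero
  then show ?case by (intro exI[of _ "\<lambda>_ _. 0"]) (auto intro: poly_funs.const)
next
  case (add F G)
  then obtain M N where "\<forall>\<tau>\<in>T. M \<tau> \<in> poly_funs (coords J)" "\<forall>b. \<forall>s\<in>V. F b s = (\<Sum>\<tau>\<in>T. M \<tau> b * \<psi> \<tau> s)"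
    "\<forall>\<tau>\<in>T. N \<tau> \<in> poly_funs (coords J)" "\<forall>b. \<forall>s\<in>V. G b s = (\<Sum>\<tau>\<in>T. N \<tau> b * \<psi> \<tau> s)" by auto
  then show ?case by (intro exI[of _ "\<lambda>\<tau> b. M \<tau> b + N \<tau> b"])
      (auto intro: poly_funs.add simp: distrib_right sum.distrib)
next
  case (scaled a \<phi>)
  then obtain e where "\<forall>s\<in>V. \<phi> s = (\<Sum>\<tau>\<in>T. e \<tau> * \<psi> \<tau> s)" using assms(3) by blast
  then show ?case using scaled
    by (intro exI[of _ "\<lambda>\<tau> b. a b * e \<tau>"])
      (auto intro!: poly_funs.mult poly_funs.const simp: sum_distrib_left mult.assoc)
qed

lemma polys_upto_monomials:
  assumes "f \<in> polys_upto Y K" "finite Y"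
  shows "\<exists>e. \<forall>s. f s = (\<Sum>\<tau>\<in>PiE Y (\<lambda>_. {..K}). e \<tau> * monomial Y \<tau> (\<lambda>y. y s))"
  using assms(1)
proof induction
  case (const c K)
  have fin: "finite (PiE Y (\<lambda>_. {..K}))" using assms(2) by (intro finite_PiE) auto
  have 0: "(\<lambda>y\<in>Y. 0) \<in> PiE Y (\<lambda>_. {..K})" by auto
  have "(\<Sum>\<tau>\<in>PiE Y (\<lambda>_. {..K}). (if \<tau> = (\<lambda>y\<in>Y. 0) then c else 0) * monomial Y \<tau> (\<lambda>y. y s))
    = c * monomial Y (\<lambda>y\<in>Y. 0) (\<lambda>y. y s)" for s
  proof -
    have "(\<Sum>\<tau>\<in>PiE Y (\<lambda>_. {..K}). (if \<tau> = (\<lambda>y\<in>Y. 0) then c else 0) * monomial Y \<tau> (\<lambda>y. y s))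
      = (\<Sum>\<tau>\<in>PiE Y (\<lambda>_. {..K}). if \<tau> = (\<lambda>y\<in>Y. 0) then c * monomial Y (\<lambda>y\<in>Y. 0) (\<lambda>y. y s) else 0)"
      by (intro sum.cong) auto
    also have "\<dots> = c * monomial Y (\<lambda>y\<in>Y. 0) (\<lambda>y. y s)"
      unfolding sum.delta[OF fin] using 0 by (simp only: if_True)
    finally show ?thesis .
  qed
  then show ?case by (intro exI[of _ "\<lambda>\<tau>. if \<tau> = (\<lambda>y\<in>Y. 0) then c else 0"]) (simp add: monomial_def)
next
  case (add f K g)
  then obtain d e where "\<forall>s. f s = (\<Sum>\<tau>\<in>PiE Y (\<lambda>_. {..K}). d \<tau> * monomial Y \<tau> (\<lambda>y. y s))"
    "\<forall>s. g s = (\<Sum>\<tau>\<in>PiE Y (\<lambda>_. {..K}). e \<tau> * monomial Y \<tau> (\<lambda>y. y s))" by auto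
  then show ?case by (intro exI[of _ "\<lambda>\<tau>. d \<tau> + e \<tau>"]) (auto simp: distrib_right sum.distrib)
next
  case (up f K)
  then obtain e where e: "\<forall>s. f s = (\<Sum>\<tau>\<in>PiE Y (\<lambda>_. {..K}). e \<tau> * monomial Y \<tau> (\<lambda>y. y s))" by auto
  have "finite (PiE Y (\<lambda>_. {..Suc K}))" using assms(2) by (intro finite_PiE) auto
  moreover have "PiE Y (\<lambda>_. {..K}) \<subseteq> PiE Y (\<lambda>_. {..Suc K})" by (intro PiE_mono) auto
  ultimately have "f s = (\<Sum>\<tau>\<in>PiE Y (\<lambda>_. {..Suc K}).
      (if \<tau> \<in> PiE Y (\<lambda>_. {..K}) then e \<tau> else 0) * monomial Y \<tau> (\<lambda>y. y s))" for s
    unfolding e[rule_format] by (intro sum.mono_neutral_cong_left) auto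
  then show ?case by (intro exI[of _ "\<lambda>\<tau>. if \<tau> \<in> PiE Y (\<lambda>_. {..K}) then e \<tau> else 0"] allI)
next
  case (coord_mult x f K)
  then obtain e where e: "\<forall>s. f s = (\<Sum>\<tau>\<in>PiE Y (\<lambda>_. {..K}). e \<tau> * monomial Y \<tau> (\<lambda>y. y s))" by auto
  \<comment> \<open>Multiplication by \<open>x\<close> raises one exponent. Exponents are bounded
    separately, so one more degree enlarges the box by one in each direction.\<close>
  define g where "g \<tau> = \<tau>(x := Suc (\<tau> x))" for \<tau> :: "('a \<Rightarrow> complex) \<Rightarrow> nat"
  let ?B = "PiE Y (\<lambda>_. {..K})" and ?B' = "PiE Y (\<lambda>_. {..Suc K})"
  have g: "monomial Y (g \<tau>) (\<lambda>y. y s) = x s * monomial Y \<tau> (\<lambda>y. y s)" for \<tau> s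
  proof -
    have "(\<Prod>y\<in>Y - {x}. y s ^ (if y = x then Suc (\<tau> x) else \<tau> y)) = (\<Prod>y\<in>Y - {x}. y s ^ \<tau> y)"
      by (intro prod.cong) auto
    then show ?thesis
      unfolding monomial_def g_def using coord_mult(1) assms(2)
      by (simp add: prod.remove[of Y x] mult.assoc)
  qed
  have fin: "finite ?B" "finite ?B'" using assms(2) by (auto intro!: finite_PiE)
  have im: "g ` ?B \<subseteq> ?B'"
  proof (intro image_subsetI PiE_I)
    fix \<tau> y assume "\<tau> \<in> ?B" "y \<in> Y"
    then show "g \<tau> y \<in> {..Suc K}" using coord_mult(1) by (force simp: g_def PiE_iff)
  next
    fix \<tau> y assume "\<tau> \<in> ?B" "y \<notin> Y"
    then show "g \<tau> y = undefined" using coord_mult(1) by (auto simp: g_def PiE_iff extensional_def)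
  qed
  have "x s * f s = (\<Sum>\<sigma>\<in>?B'. (\<Sum>\<tau> | \<tau> \<in> ?B \<and> g \<tau> = \<sigma>. e \<tau>) * monomial Y \<sigma> (\<lambda>y. y s))" for s
  proof -
    have "x s * f s = (\<Sum>\<tau>\<in>?B. e \<tau> * monomial Y (g \<tau>) (\<lambda>y. y s))"
      by (simp add: e g sum_distrib_left mult_ac)
    also have "\<dots> = (\<Sum>\<sigma>\<in>?B'. \<Sum>\<tau> | \<tau> \<in> ?B \<and> g \<tau> = \<sigma>. e \<tau> * monomial Y (g \<tau>) (\<lambda>y. y s))"
      by (rule sum.group[OF fin im, symmetric])
    also have "\<dots> = (\<Sum>\<sigma>\<in>?B'. (\<Sum>\<tau> | \<tau> \<in> ?B \<and> g \<tau> = \<sigma>. e \<tau>) * monomial Y \<sigma> (\<lambda>y. y s))"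
      by (simp add: sum_distrib_right)
    finally show ?thesis .
  qed
  then show ?case by (intro exI[of _ "\<lambda>\<sigma>. \<Sum>\<tau> | \<tau> \<in> ?B \<and> g \<tau> = \<sigma>. e \<tau>"]) auto
qed

text \<open>On \<open>V\<close>, the polynomials in \<open>X\<close> form a finite module over the polynomials in \<open>Y\<close>, with linear
  control of degrees.\<close>

definition finite_over :: "'a set \<Rightarrow> ('a \<Rightarrow> complex) set \<Rightarrow> ('a \<Rightarrow> complex) set \<Rightarrow> bool" where
  "finite_over V X Y \<longleftrightarrow> (\<exists>(\<Phi> :: nat set) e c. finite \<Phi> \<and> (\<forall>K. \<forall>f\<in>polys_upto X K.
     \<exists>a. (\<forall>\<phi>\<in>\<Phi>. a \<phi> \<in> polys_upto Y (c * K)) \<and> (\<forall>s\<in>V. f s = (\<Sum>\<phi>\<in>\<Phi>. a \<phi> s * e \<phi> s))))"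

text \<open>The numerical core of the count: the right side has the larger exponent of
  \<open>K\<close>.\<close>

lemma exists_box_larger:
  fixes P c y N :: nat
  assumes "y < N"
  shows "\<exists>K>0. P * Suc (c * K) ^ y < K ^ N"
proof -
  \<comment> \<open>\<open>K\<close> exceeds the constant that is left after estimating
    \<open>Suc (c * K)\<close> by \<open>Suc c * K\<close>.\<close>
  define K where "K = Suc (P * Suc c ^ y)"
  have "P * Suc (c * K) ^ y \<le> P * (Suc c * K) ^ y"
    by (intro mult_left_mono power_mono) (auto simp: K_def)
  also have "\<dots> = (P * Suc c ^ y) * K ^ y" by (simp only: power_mult_distrib mult.assoc)
  also have "\<dots> < K * K ^ y" by (intro mult_strict_right_mono) (auto simp: K_def)
  also have "\<dots> = K ^ Suc y" by simp
  also have "\<dots> \<le> K ^ N" using assms by (intro power_increasing) (auto simp: K_def)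
  finally show ?thesis by (intro exI[of _ K]) (auto simp: K_def)
qed

text \<open>On \<open>V\<close> the \<open>K ^ card I\<close> monomials in the \<open>F i\<close>
  lie in the span of products of module generators and monomials in \<open>Y\<close>, whose number
  grows only like \<open>K ^ card Y\<close>. Linear algebra over the polynomials in the parameters
  gives the relation, so its coefficients are polynomial in \<open>b\<close>.\<close>

lemma finite_over_relation:
  assumes V: "finite_over V X Y" and "finite Y" "finite I" "card Y < card I"
    and F: "\<And>i. i \<in> I \<Longrightarrow> F i \<in> param_span J (polys_upto X c)"
  shows "\<exists>K C. (\<forall>\<alpha>\<in>PiE I (\<lambda>_. {..<K}). C \<alpha> \<in> poly_funs (coords J)) \<and>
    (\<exists>\<alpha>\<in>PiE I (\<lambda>_. {..<K}). \<exists>b. C \<alpha> b \<noteq> 0) \<and>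
    (\<forall>b. \<forall>s\<in>V. (\<Sum>\<alpha>\<in>PiE I (\<lambda>_. {..<K}). C \<alpha> b * monomial I \<alpha> (\<lambda>i. F i b s)) = 0)"
proof -
  obtain \<Phi> :: "nat set" and g d where \<Phi>: "finite \<Phi>" "\<And>K f. f \<in> polys_upto X K \<Longrightarrow>
     \<exists>a. (\<forall>\<phi>\<in>\<Phi>. a \<phi> \<in> polys_upto Y (d * K)) \<and> (\<forall>s\<in>V. f s = (\<Sum>\<phi>\<in>\<Phi>. a \<phi> s * g \<phi> s))"
    using V unfolding finite_over_def by blast
  obtain K where K: "K > 0" "card \<Phi> * Suc ((d * (c * card I)) * K) ^ card Y < K ^ card I"
    using exists_box_larger[OF assms(4)] by blast
  \<comment> \<open>Each \<open>F i\<close> has degree at most \<open>c\<close> and exponent below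
    \<open>K\<close>, so \<open>L\<close> bounds the degree of every monomial considered.\<close>
  define L where "L = c * (card I * K)"
  define T where "T = \<Phi> \<times> PiE Y (\<lambda>_. {..d * L})"
  define A where "A = PiE I (\<lambda>_. {..<K})"
  define \<psi> where "\<psi> \<tau> s = g (fst \<tau>) s * monomial Y (snd \<tau>) (\<lambda>y. y s)" for \<tau> :: "nat \<times> (('a \<Rightarrow> complex) \<Rightarrow> nat)" and s
  have fin: "finite T" "finite A"
    using \<Phi>(1) assms(2,3) by (auto simp: T_def A_def intro!: finite_PiE)
  have "card T = card \<Phi> * Suc (d * L) ^ card Y" "card A = K ^ card I"
    using assms(2,3) by (simp_all add: T_def A_def card_cartesian_product card_PiE)
  then have card: "card T < card A" using K by (simp add: L_def mult_ac)
  have span: "\<exists>e. \<forall>s\<in>V. f s = (\<Sum>\<tau>\<in>T. e \<tau> * \<psi> \<tau> s)" if f: "f \<in> polys_upto X L" for f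
  proof -
    obtain a where a: "\<forall>\<phi>\<in>\<Phi>. a \<phi> \<in> polys_upto Y (d * L)" "\<forall>s\<in>V. f s = (\<Sum>\<phi>\<in>\<Phi>. a \<phi> s * g \<phi> s)"
      using \<Phi>(2)[OF f] by auto
    then have "\<forall>\<phi>\<in>\<Phi>. \<exists>e. \<forall>s. a \<phi> s = (\<Sum>\<tau>\<in>PiE Y (\<lambda>_. {..d * L}). e \<tau> * monomial Y \<tau> (\<lambda>y. y s))"
      using polys_upto_monomials assms(2) by blast
    then obtain e where "\<forall>\<phi>\<in>\<Phi>. \<forall>s. a \<phi> s = (\<Sum>\<tau>\<in>PiE Y (\<lambda>_. {..d * L}). e \<phi> \<tau> * monomial Y \<tau> (\<lambda>y. y s))"
      unfolding bchoice_iff by blast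
    then have "\<forall>s\<in>V. f s = (\<Sum>\<phi>\<in>\<Phi>. (\<Sum>\<tau>\<in>PiE Y (\<lambda>_. {..d * L}). e \<phi> \<tau> * monomial Y \<tau> (\<lambda>y. y s)) * g \<phi> s)"
      using a(2) by simp
    moreover have "(\<Sum>\<phi>\<in>\<Phi>. (\<Sum>\<tau>\<in>PiE Y (\<lambda>_. {..d * L}). e \<phi> \<tau> * monomial Y \<tau> (\<lambda>y. y s)) * g \<phi> s)
      = (\<Sum>\<tau>\<in>T. e (fst \<tau>) (snd \<tau>) * \<psi> \<tau> s)" for s
      unfolding T_def \<psi>_def sum_distrib_right sum.cartesian_product by (intro sum.cong) (auto simp: mult_ac)
    ultimately have "\<forall>s\<in>V. f s = (\<Sum>\<tau>\<in>T. e (fst \<tau>) (snd \<tau>) * \<psi> \<tau> s)" by simp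
    then show ?thesis by (intro exI[of _ "\<lambda>\<tau>. e (fst \<tau>) (snd \<tau>)"])
  qed
  have "\<forall>\<alpha>\<in>A. \<exists>M. (\<forall>\<tau>\<in>T. M \<tau> \<in> poly_funs (coords J)) \<and>
    (\<forall>b. \<forall>s\<in>V. monomial I \<alpha> (\<lambda>i. F i b s) = (\<Sum>\<tau>\<in>T. M \<tau> b * \<psi> \<tau> s))"
  proof (rule ballI, rule param_span_finite[OF _ fin(1) span])
    fix \<alpha> assume "\<alpha> \<in> A"
    then have "(\<Sum>i\<in>I. \<alpha> i) \<le> (\<Sum>i\<in>I. K)" by (intro sum_mono) (force simp: A_def PiE_iff)
    then have "c * (\<Sum>i\<in>I. \<alpha> i) \<le> L" by (simp add: L_def)
    then show "(\<lambda>b s. monomial I \<alpha> (\<lambda>i. F i b s)) \<in> param_span J (polys_upto X L)"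
      using param_span_mono[OF param_span_upto_monomial[of I F J X c \<alpha>, OF assms(3) F] polys_upto_subset]
      by blast
  qed
  then obtain M where "\<forall>\<alpha>\<in>A. (\<forall>\<tau>\<in>T. M \<alpha> \<tau> \<in> poly_funs (coords J)) \<and>
    (\<forall>b. \<forall>s\<in>V. monomial I \<alpha> (\<lambda>i. F i b s) = (\<Sum>\<tau>\<in>T. M \<alpha> \<tau> b * \<psi> \<tau> s))"
    unfolding bchoice_iff by blast
  then have M: "\<And>\<alpha> \<tau>. \<alpha> \<in> A \<Longrightarrow> \<tau> \<in> T \<Longrightarrow> M \<alpha> \<tau> \<in> poly_funs (coords J)"
    "\<And>\<alpha> b s. \<alpha> \<in> A \<Longrightarrow> s \<in> V \<Longrightarrow> monomial I \<alpha> (\<lambda>i. F i b s) = (\<Sum>\<tau>\<in>T. M \<alpha> \<tau> b * \<psi> \<tau> s)"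
    by blast+
  obtain C where C: "\<forall>\<alpha>\<in>A. C \<alpha> \<in> poly_funs (coords J)" "\<exists>\<alpha>\<in>A. \<exists>b. C \<alpha> b \<noteq> 0"
    "\<forall>\<tau>\<in>T. \<forall>b. (\<Sum>\<alpha>\<in>A. C \<alpha> b * M \<alpha> \<tau> b) = 0"
    using linear_relation_over_functions[of T A M J, OF fin card M(1)] by blast
  have "(\<Sum>\<alpha>\<in>A. C \<alpha> b * monomial I \<alpha> (\<lambda>i. F i b s)) = 0" if "s \<in> V" for b s
  proof -
    have "(\<Sum>\<alpha>\<in>A. C \<alpha> b * monomial I \<alpha> (\<lambda>i. F i b s)) = (\<Sum>\<alpha>\<in>A. \<Sum>\<tau>\<in>T. C \<alpha> b * M \<alpha> \<tau> b * \<psi> \<tau> s)"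
      using M(2) that by (simp add: sum_distrib_left mult.assoc)
    also have "\<dots> = (\<Sum>\<tau>\<in>T. (\<Sum>\<alpha>\<in>A. C \<alpha> b * M \<alpha> \<tau> b) * \<psi> \<tau> s)"
      by (subst sum.swap) (simp add: sum_distrib_right)
    finally show ?thesis using C(3) by simp
  qed
  then show ?thesis using C unfolding A_def by blast
qed

section \<open>Weighted integral dependence\<close>

text \<open>The weight \<open>D - j\<close> of the coefficient of \<open>x ^ j\<close> makes the
  equation a dehomogenized form of degree \<open>D\<close>; it gives integrality and a linear bound
  on \<open>x\<close> at once. For \<open>D = 0\<close> the equation reads \<open>1 = 0\<close>, so
  \<open>V\<close> is empty.\<close>

definition weighted_integral :: "'a set \<Rightarrow> ('a \<Rightarrow> complex) set \<Rightarrow> ('a \<Rightarrow> complex) \<Rightarrow> bool" where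
  "weighted_integral V Y x \<longleftrightarrow> (\<exists>D r. (\<forall>j<D. r j \<in> polys_upto Y (D - j)) \<and>
     (\<forall>s\<in>V. x s ^ D + (\<Sum>j<D. r j s * x s ^ j) = 0))"

text \<open>Here \<open>x\<close> has weight 1 like the elements of \<open>Y\<close>, and the
  coefficient \<open>c\<close> of \<open>x ^ D\<close> is constant, so leading coefficients multiply
  under multiplication by linear factors.\<close>

definition graded :: "('a \<Rightarrow> complex) set \<Rightarrow> ('a \<Rightarrow> complex) \<Rightarrow> nat \<Rightarrow> complex \<Rightarrow> ('a \<Rightarrow> complex) set" where
  "graded Y x D c = {f. \<exists>r. (\<forall>j<D. r j \<in> polys_upto Y (D - j)) \<and>
     f = (\<lambda>s. c * x s ^ D + (\<Sum>j<D. r j s * x s ^ j))}"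

lemma gradedI:
  "(\<And>j. j < D \<Longrightarrow> r j \<in> polys_upto Y (D - j)) \<Longrightarrow> (\<And>s. f s = c * x s ^ D + (\<Sum>j<D. r j s * x s ^ j)) \<Longrightarrow>
    f \<in> graded Y x D c"
  unfolding graded_def by blast

lemma graded_const: "(\<lambda>_. c) \<in> graded Y x 0 c"
  by (rule gradedI) auto

lemma graded_zero: "(\<lambda>_. 0) \<in> graded Y x D 0"
  by (rule gradedI[of _ "\<lambda>_ _. 0"]) (auto intro: polys_upto_const)

lemma graded_add:
  assumes "f \<in> graded Y x D c" "g \<in> graded Y x D e"
  shows "(\<lambda>s. f s + g s) \<in> graded Y x D (c + e)"
proof -
  obtain p q where "\<forall>j<D. p j \<in> polys_upto Y (D - j)" "f = (\<lambda>s. c * x s ^ D + (\<Sum>j<D. p j s * x s ^ j))"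
    "\<forall>j<D. q j \<in> polys_upto Y (D - j)" "g = (\<lambda>s. e * x s ^ D + (\<Sum>j<D. q j s * x s ^ j))"
    using assms unfolding graded_def by blast
  then show ?thesis
    by (intro gradedI[of _ "\<lambda>j s. p j s + q j s"])
      (auto intro: polys_upto_add simp: distrib_right sum.distrib)
qed

lemma graded_scale:
  assumes "f \<in> graded Y x D c"
  shows "(\<lambda>s. k * f s) \<in> graded Y x D (k * c)"
proof -
  obtain p where "\<forall>j<D. p j \<in> polys_upto Y (D - j)" "f = (\<lambda>s. c * x s ^ D + (\<Sum>j<D. p j s * x s ^ j))"
    using assms unfolding graded_def by blast
  then show ?thesis
    by (intro gradedI[of _ "\<lambda>j s. k * p j s"])
      (auto intro: polys_upto_scale simp: distrib_left sum_distrib_left mult.assoc)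
qed

lemma graded_sum:
  assumes "\<And>i. i \<in> A \<Longrightarrow> f i \<in> graded Y x D (c i)"
  shows "(\<lambda>s. \<Sum>i\<in>A. f i s) \<in> graded Y x D (\<Sum>i\<in>A. c i)"
  using assms
  by (induction A rule: infinite_finite_induct) (auto intro: graded_zero graded_add)

text \<open>At a larger weight the old top term counts as a lower one; hence only monomials of full
  degree contribute to the leading coefficient.\<close>

lemma graded_up:
  assumes "f \<in> graded Y x D c" "D < E"
  shows "f \<in> graded Y x E 0"
proof -
  obtain p where p: "\<forall>j<D. p j \<in> polys_upto Y (D - j)" "f = (\<lambda>s. c * x s ^ D + (\<Sum>j<D. p j s * x s ^ j))"
    using assms unfolding graded_def by blast
  define q where "q j = (if j < D then p j else (\<lambda>_. if j = D then c else 0))" for j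
  show ?thesis
  proof (rule gradedI[of _ q])
    show "q j \<in> polys_upto Y (E - j)" if "j < E" for j
      using p(1) assms(2) polys_upto_mono[of "p j" Y "D - j" "E - j"] by (auto simp: q_def polys_upto_const)
    show "f s = 0 * x s ^ E + (\<Sum>j<E. q j s * x s ^ j)" for s
    proof -
      have "(\<Sum>j<E. q j s * x s ^ j) = (\<Sum>j<Suc D. q j s * x s ^ j)"
        using assms(2) by (intro sum.mono_neutral_right) (auto simp: q_def)
      then show ?thesis using p(2) by (simp add: q_def)
    qed
  qed
qed

lemma graded_mult_linear:
  assumes "f \<in> graded Y x D c" "u \<in> polys_upto Y 1"
  shows "(\<lambda>s. (v * x s + u s) * f s) \<in> graded Y x (Suc D) (v * c)"
proof -
  obtain p where p: "\<forall>j<D. p j \<in> polys_upto Y (D - j)" "f = (\<lambda>s. c * x s ^ D + (\<Sum>j<D. p j s * x s ^ j))"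
    using assms unfolding graded_def by blast
  define q1 where "q1 j s = (if j = 0 then 0 else v * p (j - 1) s)" for j s
  define q2 where "q2 j s = (if j < D then u s * p j s else c * u s)" for j s
  show ?thesis
  proof (rule gradedI[of _ "\<lambda>j s. q1 j s + q2 j s"])
    fix j assume j: "j < Suc D"
    have "q1 j \<in> polys_upto Y (Suc D - j)"
    proof (cases j)
      case 0
      then show ?thesis by (simp add: q1_def[abs_def] polys_upto_const)
    next
      case (Suc i)
      then show ?thesis using p(1) j polys_upto_scale[of "p i" Y "D - i" v]
        by (simp add: q1_def[abs_def])
    qed
    moreover have "q2 j \<in> polys_upto Y (Suc D - j)"
      using j p(1) polys_upto_mult[OF assms(2), of "p j" "D - j"]
        polys_upto_mono[OF polys_upto_scale[OF assms(2), of c], of "Suc D - j"]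
      by (cases "j < D") (auto simp: q2_def[abs_def] Suc_diff_le)
    ultimately show "(\<lambda>s. q1 j s + q2 j s) \<in> polys_upto Y (Suc D - j)" by (rule polys_upto_add)
  next
    fix s
    have 1: "(\<Sum>j<Suc D. q1 j s * x s ^ j) = (\<Sum>j<D. v * p j s * x s ^ Suc j)"
      unfolding sum.lessThan_Suc_shift by (simp add: q1_def)
    have 2: "(\<Sum>j<Suc D. q2 j s * x s ^ j) = (\<Sum>j<D. u s * p j s * x s ^ j) + c * u s * x s ^ D"
      by (simp add: q2_def)
    have *: "(\<Sum>j<Suc D. (q1 j s + q2 j s) * x s ^ j)
       = (\<Sum>j<D. v * p j s * x s ^ Suc j) + ((\<Sum>j<D. u s * p j s * x s ^ j) + c * u s * x s ^ D)"
      by (simp only: distrib_right sum.distrib 1 2)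
    show "(v * x s + u s) * f s = v * c * x s ^ Suc D + (\<Sum>j<Suc D. (q1 j s + q2 j s) * x s ^ j)"
    proof -
      define S where "S = (\<Sum>j<D. p j s * x s ^ j)"
      have "(\<Sum>j<D. v * p j s * x s ^ Suc j) = v * x s * S" "(\<Sum>j<D. u s * p j s * x s ^ j) = u s * S"
        unfolding S_def sum_distrib_left by (auto intro!: sum.cong)
      moreover have "f s = c * x s ^ D + S" by (simp add: p(2) S_def)
      ultimately show ?thesis using *
        by (simp add: algebra_simps)
    qed
  qed
qed

lemma graded_mult_power:
  "f \<in> graded Y x D c \<Longrightarrow> u \<in> polys_upto Y 1 \<Longrightarrow>
    (\<lambda>s. (v * x s + u s) ^ k * f s) \<in> graded Y x (k + D) (v ^ k * c)"
proof (induction k)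
  case (Suc k)
  then show ?case using graded_mult_linear[OF Suc.IH[OF Suc.prems] Suc.prems(2), of v]
    by (simp add: mult.assoc)
qed simp

lemma graded_monomial:
  assumes "finite I" "\<And>i. i \<in> I \<Longrightarrow> u i \<in> polys_upto Y 1"
  shows "(\<lambda>s. monomial I \<alpha> (\<lambda>i. v i * x s + u i s)) \<in> graded Y x (\<Sum>i\<in>I. \<alpha> i) (monomial I \<alpha> v)"
  using assms
proof (induction I rule: finite_induct)
  case empty
  show ?case by (simp add: monomial_def graded_const)
next
  case (insert i I)
  then show ?case
    using graded_mult_power[of "\<lambda>s. monomial I \<alpha> (\<lambda>i. v i * x s + u i s)" Y x _ _ "u i" "v i" "\<alpha> i"]
    by (simp add: monomial_def)
qed

text \<open>Substituting \<open>v i * x + u i\<close> into a polynomial of degree \<open>D\<close> gives \<open>x ^ D\<close> the coefficient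
  obtained by evaluating the form of degree \<open>D\<close> at \<open>v\<close>.\<close>

lemma relation_imp_weighted_integral:
  assumes "finite A" "finite I" "\<And>i. i \<in> I \<Longrightarrow> u i \<in> polys_upto Y 1"
    and "\<And>\<alpha>. \<alpha> \<in> A \<Longrightarrow> c \<alpha> \<noteq> 0 \<Longrightarrow> (\<Sum>i\<in>I. \<alpha> i) \<le> D"
    and "\<And>s. s \<in> V \<Longrightarrow> (\<Sum>\<alpha>\<in>A. c \<alpha> * monomial I \<alpha> (\<lambda>i. v i * x s + u i s)) = 0"
    and "(\<Sum>\<alpha> | \<alpha> \<in> A \<and> (\<Sum>i\<in>I. \<alpha> i) = D. c \<alpha> * monomial I \<alpha> v) \<noteq> 0"
  shows "weighted_integral V Y x"
proof -
  let ?S = "\<lambda>\<alpha>. \<Sum>i\<in>I. \<alpha> i"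
  define e where "e = (\<Sum>\<alpha> | \<alpha> \<in> A \<and> ?S \<alpha> = D. c \<alpha> * monomial I \<alpha> v)"
  have "(\<lambda>s. c \<alpha> * monomial I \<alpha> (\<lambda>i. v i * x s + u i s)) \<in>
      graded Y x D (if ?S \<alpha> = D then c \<alpha> * monomial I \<alpha> v else 0)" if "\<alpha> \<in> A" for \<alpha>
  proof -
    have *: "(\<lambda>s. c \<alpha> * monomial I \<alpha> (\<lambda>i. v i * x s + u i s)) \<in> graded Y x (?S \<alpha>) (c \<alpha> * monomial I \<alpha> v)"
      by (intro graded_scale graded_monomial assms)
    show ?thesis
    proof (cases "c \<alpha> = 0")
      case True
      then show ?thesis by (simp add: graded_zero)
    next
      case False
      then show ?thesis using * graded_up[OF *, of D] assms(4)[OF that] by (cases "?S \<alpha> = D") auto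
    qed
  qed
  then have "(\<lambda>s. \<Sum>\<alpha>\<in>A. c \<alpha> * monomial I \<alpha> (\<lambda>i. v i * x s + u i s)) \<in>
      graded Y x D (\<Sum>\<alpha>\<in>A. if ?S \<alpha> = D then c \<alpha> * monomial I \<alpha> v else 0)"
    by (rule graded_sum)
  moreover have "(\<Sum>\<alpha>\<in>A. if ?S \<alpha> = D then c \<alpha> * monomial I \<alpha> v else 0) = e"
    unfolding e_def using assms(1) by (simp add: sum.inter_filter)
  \<comment> \<open>The value \<open>e\<close> of the leading form at \<open>v\<close> is a nonzero
    constant, so division by it makes the equation monic.\<close>
  ultimately have "(\<lambda>s. (1 / e) * (\<Sum>\<alpha>\<in>A. c \<alpha> * monomial I \<alpha> (\<lambda>i. v i * x s + u i s))) \<in> graded Y x D 1"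
    using graded_scale[of _ Y x D e "1 / e"] assms(6) by (simp add: e_def)
  then obtain r where r: "\<forall>j<D. r j \<in> polys_upto Y (D - j)"
    and *: "(\<lambda>s. (1 / e) * (\<Sum>\<alpha>\<in>A. c \<alpha> * monomial I \<alpha> (\<lambda>i. v i * x s + u i s)))
      = (\<lambda>s. 1 * x s ^ D + (\<Sum>j<D. r j s * x s ^ j))"
    unfolding graded_def by blast
  have "x s ^ D + (\<Sum>j<D. r j s * x s ^ j)
      = (1 / e) * (\<Sum>\<alpha>\<in>A. c \<alpha> * monomial I \<alpha> (\<lambda>i. v i * x s + u i s))" for s
    using fun_cong[OF *, of s] by simp
  then show ?thesis unfolding weighted_integral_def using assms(5) r
    by (intro exI[of _ D] exI[of _ r]) auto
qed

lemma polys_upto_growth: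
  assumes "f \<in> polys_upto Y K" "finite Y"
  shows "\<exists>C\<ge>0. \<forall>s. norm (f s) \<le> C * (1 + (\<Sum>y\<in>Y. norm (y s))) ^ K"
  using assms(1)
proof induction
  case (const c k)
  have "1 \<le> (1 + (\<Sum>y\<in>Y. norm (y s))) ^ k" for s by (intro one_le_power) (simp add: sum_nonneg)
  then show ?case by (intro exI[of _ "norm c"]) (auto simp: mult_le_cancel_left1)
next
  case (add f k g)
  then obtain C D where "C \<ge> 0" "D \<ge> 0" "\<forall>s. norm (f s) \<le> C * (1 + (\<Sum>y\<in>Y. norm (y s))) ^ k"
    "\<forall>s. norm (g s) \<le> D * (1 + (\<Sum>y\<in>Y. norm (y s))) ^ k" by auto
  then show ?case
    by (intro exI[of _ "C + D"]) (auto simp: distrib_right intro: norm_triangle_le add_mono)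
next
  case (up f k)
  then obtain C where C: "C \<ge> 0" "\<forall>s. norm (f s) \<le> C * (1 + (\<Sum>y\<in>Y. norm (y s))) ^ k" by auto
  have "C * (1 + (\<Sum>y\<in>Y. norm (y s))) ^ k \<le> C * (1 + (\<Sum>y\<in>Y. norm (y s))) ^ Suc k" for s
    using C(1) by (intro mult_left_mono power_increasing) (auto simp: sum_nonneg)
  then show ?case using C by (intro exI[of _ C]) (auto intro: order_trans)
next
  case (coord_mult x f k)
  then obtain C where C: "C \<ge> 0" "\<forall>s. norm (f s) \<le> C * (1 + (\<Sum>y\<in>Y. norm (y s))) ^ k" by auto
  have "norm (x s * f s) \<le> C * (1 + (\<Sum>y\<in>Y. norm (y s))) ^ Suc k" for s
  proof -
    have "norm (x s) \<le> (\<Sum>y\<in>Y. norm (y s))" using coord_mult(1) assms(2)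
      by (intro member_le_sum) auto
    then have "norm (x s) * norm (f s) \<le> (1 + (\<Sum>y\<in>Y. norm (y s))) * (C * (1 + (\<Sum>y\<in>Y. norm (y s))) ^ k)"
      using C by (intro mult_mono) (auto simp: sum_nonneg)
    then show ?thesis by (simp add: norm_mult mult_ac)
  qed
  then show ?case using C(1) by blast
qed

text \<open>If \<open>x\<close> were larger than \<open>B * M\<close>, the lower terms of the
  equation would each be at most \<open>C j * M\<close> times the power \<open>D - 1\<close> of its
  norm, and together could not balance \<open>x ^ D\<close>.\<close>

lemma weighted_integral_growth:
  assumes "weighted_integral V Y x" "finite Y"
  shows "\<exists>C\<ge>0. \<forall>s\<in>V. norm (x s) \<le> C * (1 + (\<Sum>y\<in>Y. norm (y s)))"
proof -
  obtain D r where r: "\<forall>j<D. r j \<in> polys_upto Y (D - j)"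
    "\<forall>s\<in>V. x s ^ D + (\<Sum>j<D. r j s * x s ^ j) = 0"
    using assms(1) unfolding weighted_integral_def by blast
  define M where "M s = 1 + (\<Sum>y\<in>Y. norm (y s))" for s
  have M: "M s \<ge> 1" for s unfolding M_def by (simp add: sum_nonneg)
  have "\<forall>j\<in>{..<D}. \<exists>C. C \<ge> 0 \<and> (\<forall>s. norm (r j s) \<le> C * M s ^ (D - j))"
    using r(1) polys_upto_growth assms(2) unfolding M_def by blast
  then obtain C where C: "\<And>j. j < D \<Longrightarrow> C j \<ge> 0" "\<And>j s. j < D \<Longrightarrow> norm (r j s) \<le> C j * M s ^ (D - j)"
    unfolding bchoice_iff by blast
  \<comment> \<open>The summand 1 ensures that a counterexample also has
    \<open>norm (x s) > M s\<close>, so powers of \<open>M s\<close> may be replaced by powers of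
    \<open>norm (x s)\<close>.\<close>
  define B where "B = 1 + (\<Sum>j<D. C j)"
  have B: "B \<ge> 1" unfolding B_def using C(1) by (auto intro: sum_nonneg)
  have "norm (x s) \<le> B * M s" if s: "s \<in> V" for s
  proof (rule ccontr)
    assume "\<not> ?thesis"
    then have big: "norm (x s) > B * M s" by simp
    have xM: "norm (x s) > M s" using big B M[of s] mult_right_mono[OF B, of "M s"] by linarith
    obtain E where E: "D = Suc E"
    proof (cases D)
      case 0
      then show ?thesis using r(2) s by simp
    qed auto
    have "norm (x s) ^ D = norm (\<Sum>j<D. r j s * x s ^ j)"
      using r(2) s by (metis add_eq_0_iff norm_minus_cancel norm_power)
    also have "\<dots> \<le> (\<Sum>j<D. norm (r j s * x s ^ j))" by (rule norm_sum)
    also have "\<dots> \<le> (\<Sum>j<D. C j * (M s * norm (x s) ^ E))"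
    proof (rule sum_mono)
      fix j assume j: "j \<in> {..<D}"
      have "M s ^ (D - j) * norm (x s) ^ j = M s * (M s ^ (E - j) * norm (x s) ^ j)"
        using j E by (simp add: Suc_diff_le)
      also have "\<dots> \<le> M s * (norm (x s) ^ (E - j) * norm (x s) ^ j)"
        using xM M[of s] by (intro mult_left_mono mult_right_mono power_mono) auto
      also have "norm (x s) ^ (E - j) * norm (x s) ^ j = norm (x s) ^ E"
        using j E by (simp flip: power_add)
      finally have *: "C j * (M s ^ (D - j) * norm (x s) ^ j) \<le> C j * (M s * norm (x s) ^ E)"
        using C(1)[of j] j by (intro mult_left_mono) auto
      have "norm (r j s * x s ^ j) \<le> (C j * M s ^ (D - j)) * norm (x s) ^ j"
        unfolding norm_mult norm_power using C j by (intro mult_right_mono) auto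
      then show "norm (r j s * x s ^ j) \<le> C j * (M s * norm (x s) ^ E)"
        using * by (simp only: mult.assoc)
    qed
    also have "\<dots> = (\<Sum>j<D. C j) * M s * norm (x s) ^ E" by (simp add: sum_distrib_right mult.assoc)
    also have "\<dots> \<le> B * M s * norm (x s) ^ E"
      using M[of s] by (intro mult_right_mono) (auto simp: B_def)
    also have "\<dots> < norm (x s) * norm (x s) ^ E"
      using big xM M[of s] by (intro mult_strict_right_mono zero_less_power) linarith+
    finally show False using E by simp
  qed
  then show ?thesis using B unfolding M_def by (intro exI[of _ B]) auto
qed

section \<open>Finite modules: composition and adjunction of integral elements\<close>

lemma finite_over_refl: "finite_over V X X"
  unfolding finite_over_def
  by (rule exI[of _ "{0}"], rule exI[of _ "\<lambda>_ _. 1"], rule exI[of _ 1]) auto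

lemma finite_over_generators:
  assumes "finite_over V X Y" "X' \<subseteq> polys_upto X 1"
  shows "finite_over V X' Y"
proof -
  have "polys_upto X' K \<subseteq> polys_upto X K" for K
    using polys_upto_comp[of _ X' K "\<lambda>p. p" X] assms(2) by blast
  moreover obtain \<Phi> :: "nat set" and e c where \<Phi>: "finite \<Phi>" "\<And>K f. f \<in> polys_upto X K \<Longrightarrow>
     \<exists>a. (\<forall>\<phi>\<in>\<Phi>. a \<phi> \<in> polys_upto Y (c * K)) \<and> (\<forall>s\<in>V. f s = (\<Sum>\<phi>\<in>\<Phi>. a \<phi> s * e \<phi> s))"
    using assms(1) unfolding finite_over_def by blast
  ultimately show ?thesis unfolding finite_over_def
    by (intro exI[of _ \<Phi>] exI[of _ e] exI[of _ c]) blast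
qed

lemma finite_over_trans:
  assumes "finite_over V X Y" "finite_over V Y Z"
  shows "finite_over V X Z"
proof -
  obtain \<Phi> :: "nat set" and e c where \<Phi>: "finite \<Phi>" "\<And>K f. f \<in> polys_upto X K \<Longrightarrow>
     \<exists>a. (\<forall>\<phi>\<in>\<Phi>. a \<phi> \<in> polys_upto Y (c * K)) \<and> (\<forall>s\<in>V. f s = (\<Sum>\<phi>\<in>\<Phi>. a \<phi> s * e \<phi> s))"
    using assms(1) unfolding finite_over_def by blast
  obtain \<Psi> :: "nat set" and h d where \<Psi>: "finite \<Psi>" "\<And>K f. f \<in> polys_upto Y K \<Longrightarrow>
     \<exists>a. (\<forall>\<psi>\<in>\<Psi>. a \<psi> \<in> polys_upto Z (d * K)) \<and> (\<forall>s\<in>V. f s = (\<Sum>\<psi>\<in>\<Psi>. a \<psi> s * h \<psi> s))"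
    using assms(2) unfolding finite_over_def by blast
  \<comment> \<open>The generators are products of generators; pairs are encoded as numbers because
    \<open>finite_over\<close> indexes generators by \<open>nat\<close>.\<close>
  define g where "g k s = e (fst (prod_decode k)) s * h (snd (prod_decode k)) s" for k s
  have "\<exists>a. (\<forall>\<tau>\<in>prod_encode ` (\<Phi> \<times> \<Psi>). a \<tau> \<in> polys_upto Z (d * c * K)) \<and>
     (\<forall>s\<in>V. f s = (\<Sum>\<tau>\<in>prod_encode ` (\<Phi> \<times> \<Psi>). a \<tau> s * g \<tau> s))" if f: "f \<in> polys_upto X K" for f K
  proof -
    obtain a where a: "\<forall>\<phi>\<in>\<Phi>. a \<phi> \<in> polys_upto Y (c * K)" "\<forall>s\<in>V. f s = (\<Sum>\<phi>\<in>\<Phi>. a \<phi> s * e \<phi> s)"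
      using \<Phi>(2)[OF f] by blast
    then have "\<forall>\<phi>\<in>\<Phi>. \<exists>b. (\<forall>\<psi>\<in>\<Psi>. b \<psi> \<in> polys_upto Z (d * (c * K))) \<and>
        (\<forall>s\<in>V. a \<phi> s = (\<Sum>\<psi>\<in>\<Psi>. b \<psi> s * h \<psi> s))" using \<Psi>(2) by blast
    then obtain b where b: "\<forall>\<phi>\<in>\<Phi>. (\<forall>\<psi>\<in>\<Psi>. b \<phi> \<psi> \<in> polys_upto Z (d * (c * K))) \<and>
        (\<forall>s\<in>V. a \<phi> s = (\<Sum>\<psi>\<in>\<Psi>. b \<phi> \<psi> s * h \<psi> s))" unfolding bchoice_iff by blast
    have "f s = (\<Sum>\<tau>\<in>prod_encode ` (\<Phi> \<times> \<Psi>). b (fst (prod_decode \<tau>)) (snd (prod_decode \<tau>)) s * g \<tau> s)"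
      if "s \<in> V" for s
    proof -
      have "f s = (\<Sum>\<phi>\<in>\<Phi>. (\<Sum>\<psi>\<in>\<Psi>. b \<phi> \<psi> s * h \<psi> s) * e \<phi> s)"
        using a(2) b that by simp
      also have "\<dots> = (\<Sum>(\<phi>, \<psi>)\<in>\<Phi> \<times> \<Psi>. b \<phi> \<psi> s * h \<psi> s * e \<phi> s)"
        unfolding sum_distrib_right sum.cartesian_product ..
      also have "\<dots> = (\<Sum>\<tau>\<in>prod_encode ` (\<Phi> \<times> \<Psi>). b (fst (prod_decode \<tau>)) (snd (prod_decode \<tau>)) s * g \<tau> s)"
        by (subst sum.reindex[OF inj_prod_encode]) (auto simp: g_def case_prod_unfold mult_ac)
      finally show ?thesis .
    qed
    then show ?thesis using b
      by (intro exI[of _ "\<lambda>\<tau>. b (fst (prod_decode \<tau>)) (snd (prod_decode \<tau>))"]) (auto simp: mult.assoc)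
  qed
  moreover have "finite (prod_encode ` (\<Phi> \<times> \<Psi>))" using \<Phi>(1) \<Psi>(1) by simp
  ultimately show ?thesis unfolding finite_over_def by blast
qed

text \<open>The powers \<open>x ^ i\<close> with \<open>i < D\<close> generate. Multiplying by
  \<open>x\<close> shifts them, and rewriting \<open>x ^ D\<close> by the equation raises degrees of
  coefficients by at most \<open>D\<close>; this is the factor in the degree bound.\<close>

lemma finite_over_insert:
  assumes "weighted_integral V Y x"
  shows "finite_over V (insert x Y) Y"
proof -
  obtain D r where r: "\<forall>j<D. r j \<in> polys_upto Y (D - j)"
    "\<forall>s\<in>V. x s ^ D + (\<Sum>j<D. r j s * x s ^ j) = 0"
    using assms(1) unfolding weighted_integral_def by blast
  have rD: "r j \<in> polys_upto Y D" if "j < D" for j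
    using r(1) that by (meson diff_le_self polys_upto_mono)
  have "\<exists>a. (\<forall>i\<in>{..<D}. a i \<in> polys_upto Y (D * K)) \<and> (\<forall>s\<in>V. f s = (\<Sum>i<D. a i s * x s ^ i))"
    if "f \<in> polys_upto (insert x Y) K" for f K
  proof (cases D)
    case 0
    then have "V = {}" using r(2) by auto
    then show ?thesis using 0 by auto
  next
    case (Suc E)
    show ?thesis using that
    proof induction
      case (const c k)
      have "(\<Sum>i<D. (if i = 0 then c else 0) * x s ^ i) = c" for s
        unfolding Suc sum.lessThan_Suc_shift by simp
      then show ?case by (intro exI[of _ "\<lambda>i s. if i = 0 then c else 0"]) (auto intro: polys_upto_const)
    next
      case (add f k g)
      then obtain a b where "\<forall>i\<in>{..<D}. a i \<in> polys_upto Y (D * k)" "\<forall>s\<in>V. f s = (\<Sum>i<D. a i s * x s ^ i)"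
        "\<forall>i\<in>{..<D}. b i \<in> polys_upto Y (D * k)" "\<forall>s\<in>V. g s = (\<Sum>i<D. b i s * x s ^ i)" by blast
      then show ?case by (intro exI[of _ "\<lambda>i s. a i s + b i s"])
          (auto intro: polys_upto_add simp: distrib_right sum.distrib)
    next
      case (up f k)
      then obtain a where "\<forall>i\<in>{..<D}. a i \<in> polys_upto Y (D * k)" "\<forall>s\<in>V. f s = (\<Sum>i<D. a i s * x s ^ i)" by blast
      then show ?case using polys_upto_subset[of "D * k" "D * Suc k" Y]
        by (intro exI[of _ a]) auto
    next
      case (coord_mult y f k)
      then obtain a where a: "\<forall>i\<in>{..<D}. a i \<in> polys_upto Y (D * k)" "\<forall>s\<in>V. f s = (\<Sum>i<D. a i s * x s ^ i)" by blast
      show ?case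
      proof (cases "y = x")
        case False
        then have "y \<in> polys_upto Y 1" using coord_mult(1) polys_upto_coord by auto
        then have "(\<lambda>s. y s * a i s) \<in> polys_upto Y (D * Suc k)" if "i < D" for i
          using polys_upto_mono[OF polys_upto_mult[of y Y 1 "a i" "D * k"], of "D * Suc k"] a(1) that Suc by auto
        then show ?thesis using a
          by (intro exI[of _ "\<lambda>i s. y s * a i s"]) (auto simp: sum_distrib_left mult.assoc)
      next
        case True
        \<comment> \<open>The shifted coefficients, corrected by the top coefficient
          \<open>a E\<close> distributed according to the equation for \<open>x ^ D\<close>.\<close>
        define b where "b i s = (if i = 0 then 0 else a (i - 1) s) + (-1) * (r i s * a E s)" for i s
        have "b i \<in> polys_upto Y (D * Suc k)" if "i < D" for i
        proof -
          have "(\<lambda>s. (-1) * (r i s * a E s)) \<in> polys_upto Y (D * Suc k)"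
            using polys_upto_scale[OF polys_upto_mult[OF rD[OF that], of "a E" "D * k"], of "-1"] a(1) Suc by simp
          moreover have "(\<lambda>s. if i = 0 then 0 else a (i - 1) s) \<in> polys_upto Y (D * Suc k)"
            using a(1) that polys_upto_mono[of "a (i - 1)" Y "D * k" "D * Suc k"]
            by (cases "i = 0") (auto intro: polys_upto_const)
          ultimately show ?thesis unfolding b_def[abs_def] using polys_upto_add by blast
        qed
        moreover have "x s * f s = (\<Sum>i<D. b i s * x s ^ i)" if "s \<in> V" for s
        proof -
          have "x s ^ D = - (\<Sum>i<D. r i s * x s ^ i)" using r(2) that by (simp add: eq_neg_iff_add_eq_0)
          moreover have "x s * f s = (\<Sum>i<E. a i s * x s ^ Suc i) + a E s * x s ^ D"
            using a(2) that by (simp add: Suc distrib_left sum_distrib_left mult_ac)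
          moreover have "(\<Sum>i<D. b i s * x s ^ i) =
            (\<Sum>i<D. (if i = 0 then 0 else a (i - 1) s) * x s ^ i) - (\<Sum>i<D. r i s * a E s * x s ^ i)"
            by (simp add: b_def left_diff_distrib sum_subtractf mult.assoc)
          moreover have "(\<Sum>i<D. (if i = 0 then 0 else a (i - 1) s) * x s ^ i) = (\<Sum>i<E. a i s * x s ^ Suc i)"
            unfolding Suc sum.lessThan_Suc_shift by simp
          ultimately show ?thesis by (simp add: sum_distrib_left mult_ac)
        qed
        ultimately show ?thesis using True by (intro exI[of _ b]) auto
      qed
    qed
  qed
  then show ?thesis unfolding finite_over_def
    by (intro exI[of _ "{..<D}"] exI[of _ "\<lambda>i s. x s ^ i"] exI[of _ D]) simp
qed

lemma weighted_integral_mono: "weighted_integral V Y x \<Longrightarrow> Y \<subseteq> Z \<Longrightarrow> weighted_integral V Z x"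
proof -
  assume *: "weighted_integral V Y x" "Y \<subseteq> Z"
  have "polys_upto Y K \<subseteq> polys_upto Z K" for K
    using polys_upto_comp[of _ Y K "\<lambda>p. p" Z] *(2) polys_upto_coord by blast
  then show ?thesis using *(1) unfolding weighted_integral_def by blast
qed

lemma finite_over_weighted_integral:
  assumes "finite W" "\<And>w. w \<in> W \<Longrightarrow> weighted_integral V Y w"
  shows "finite_over V (W \<union> Y) Y"
  using assms
proof (induction W rule: finite_induct)
  case empty
  show ?case by (simp add: finite_over_refl)
next
  case (insert w W)
  have "finite_over V (insert w (W \<union> Y)) (W \<union> Y)"
    by (rule finite_over_insert, rule weighted_integral_mono[of V Y]) (use insert.prems in auto)
  moreover have "finite_over V (W \<union> Y) Y" using insert by blast
  ultimately show ?case using finite_over_trans by simp blast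
qed

section \<open>Noether normalization\<close>

text \<open>The degree bound is required for all parameters, nonvanishing at \<open>v\<close> only
  for one. With \<open>v\<close> fixed, the value of the leading form is thus a nonzero function of
  the parameters.\<close>

definition leading_form_at ::
    "'i set \<Rightarrow> nat \<Rightarrow> (('i \<Rightarrow> nat) \<Rightarrow> 'b \<Rightarrow> complex) \<Rightarrow> nat \<Rightarrow> 'b \<Rightarrow> ('i \<Rightarrow> complex) \<Rightarrow> bool" where
  "leading_form_at I K C D b v \<longleftrightarrow>
    (\<forall>\<alpha>\<in>PiE I (\<lambda>_. {..<K}). \<forall>b. C \<alpha> b \<noteq> 0 \<longrightarrow> (\<Sum>i\<in>I. \<alpha> i) \<le> D) \<and>
    (\<Sum>\<alpha> | \<alpha> \<in> PiE I (\<lambda>_. {..<K}) \<and> (\<Sum>i\<in>I. \<alpha> i) = D. C \<alpha> b * monomial I \<alpha> v) \<noteq> 0"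

text \<open>\<open>D\<close> is the largest total degree of a monomial whose coefficient is not
  identically zero; independence of monomials gives \<open>v\<close>. If \<open>v\<close> vanished
  on \<open>I\<close>, then \<open>D\<close> would be 0 and the relation a nonzero constant, which
  is impossible on a nonempty \<open>V\<close>.\<close>

lemma leading_form_exists:
  fixes C :: "('i \<Rightarrow> nat) \<Rightarrow> 'b \<Rightarrow> complex"
  assumes "finite I" "\<beta> \<in> PiE I (\<lambda>_. {..<K})" "C \<beta> b0 \<noteq> 0" "V \<noteq> {}"
    and rel: "\<And>b s. s \<in> V \<Longrightarrow> (\<Sum>\<alpha>\<in>PiE I (\<lambda>_. {..<K}). C \<alpha> b * monomial I \<alpha> (w b s)) = 0"
  shows "\<exists>D b v. (\<exists>i\<in>I. v i \<noteq> 0) \<and> leading_form_at I K C D b v"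
proof -
  let ?A = "PiE I (\<lambda>_. {..<K})" and ?S = "\<lambda>\<alpha>. \<Sum>i\<in>I. \<alpha> i"
  have fin: "finite ?A" using assms(1) by (intro finite_PiE) auto
  define N where "N = {\<alpha> \<in> ?A. \<exists>b. C \<alpha> b \<noteq> 0}"
  define D where "D = Max (?S ` N)"
  have N: "finite N" "N \<noteq> {}" using fin assms(2,3) by (auto simp: N_def)
  then have "D \<in> ?S ` N" unfolding D_def by (intro Max_in) auto
  then obtain \<gamma> b where \<gamma>: "\<gamma> \<in> ?A" "?S \<gamma> = D" "C \<gamma> b \<noteq> 0" by (auto simp: N_def)
  have le: "?S \<alpha> \<le> D" if "\<alpha> \<in> ?A" "C \<alpha> b' \<noteq> 0" for \<alpha> b'
    unfolding D_def using that N(1) by (intro Max_ge) (auto simp: N_def)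
  obtain v where v0: "(\<Sum>\<alpha>\<in>?A. (if ?S \<alpha> = D then C \<alpha> b else 0) * monomial I \<alpha> v) \<noteq> 0"
    using monomials_independent[OF assms(1) \<gamma>(1), of "\<lambda>\<alpha>. if ?S \<alpha> = D then C \<alpha> b else 0"] \<gamma> by auto
  moreover have "(\<Sum>\<alpha>\<in>?A. (if ?S \<alpha> = D then C \<alpha> b else 0) * monomial I \<alpha> v)
    = (\<Sum>\<alpha> | \<alpha> \<in> ?A \<and> ?S \<alpha> = D. C \<alpha> b * monomial I \<alpha> v)"
    unfolding sum.inter_filter[OF fin] by (intro sum.cong) auto
  ultimately have v: "(\<Sum>\<alpha> | \<alpha> \<in> ?A \<and> ?S \<alpha> = D. C \<alpha> b * monomial I \<alpha> v) \<noteq> 0" by simp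
  have "\<exists>i\<in>I. v i \<noteq> 0"
  proof (rule ccontr)
    assume zero: "\<not> ?thesis"
    have mon: "monomial I \<alpha> t = 1" if "?S \<alpha> = 0" for \<alpha> and t :: "'i \<Rightarrow> complex"
      using that assms(1) by (simp add: monomial_def)
    show False
    proof (cases "D = 0")
      case True
      obtain s where s: "s \<in> V" using assms(4) by blast
      have "(\<Sum>\<alpha> | \<alpha> \<in> ?A \<and> ?S \<alpha> = D. C \<alpha> b * monomial I \<alpha> v) = (\<Sum>\<alpha> | \<alpha> \<in> ?A \<and> ?S \<alpha> = D. C \<alpha> b * monomial I \<alpha> (w b s))"
        using True by (intro sum.cong) (simp_all only: mem_Collect_eq mon)
      also have "\<dots> = (\<Sum>\<alpha>\<in>?A. C \<alpha> b * monomial I \<alpha> (w b s))"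
        unfolding sum.inter_filter[OF fin]
      proof (rule sum.cong)
        fix \<alpha> assume "\<alpha> \<in> ?A"
        then show "(if ?S \<alpha> = D then C \<alpha> b * monomial I \<alpha> (w b s) else 0) = C \<alpha> b * monomial I \<alpha> (w b s)"
          using True le[of \<alpha> b] by (cases "C \<alpha> b = 0") auto
      qed simp
      finally show False using v rel[OF s] by simp
    next
      case False
      have "monomial I \<alpha> v = 0" if "?S \<alpha> = D" for \<alpha>
      proof -
        have "\<exists>i\<in>I. \<alpha> i \<noteq> 0" by (rule ccontr) (use that False in auto)
        then obtain i where "i \<in> I" "\<alpha> i \<noteq> 0" by blast
        then show ?thesis using zero assms(1) unfolding monomial_def by (intro prod_zero) auto
      qed
      then show False using v by simp
    qed
  qed
  then show ?thesis using v le unfolding leading_form_at_def by blast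
qed

text \<open>Noether's step: a linear change of the \<open>w i\<close> turns the direction
  \<open>v\<close>, where the leading form is nonzero, into an axis. The relation becomes monic in
  one new function, and the others suffice as a base.\<close>

lemma finite_over_dependent:
  fixes C :: "('i \<Rightarrow> nat) \<Rightarrow> complex"
  assumes "finite I" "\<beta> \<in> PiE I (\<lambda>_. {..<K})" "C \<beta> \<noteq> 0" "V \<noteq> {}"
    and rel: "\<And>s. s \<in> V \<Longrightarrow> (\<Sum>\<alpha>\<in>PiE I (\<lambda>_. {..<K}). C \<alpha> * monomial I \<alpha> (\<lambda>i. w i s)) = 0"
  shows "\<exists>Y. finite Y \<and> card Y < card I \<and> finite_over V (w ` I) Y"
proof -
  have "\<exists>D b v. (\<exists>i\<in>I. v i \<noteq> 0) \<and> leading_form_at I K (\<lambda>\<alpha> _ :: unit. C \<alpha>) D b v"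
    by (rule leading_form_exists[of I \<beta> K "\<lambda>\<alpha> _. C \<alpha>" "()" V "\<lambda>_ s i. w i s", OF assms(1-4)]) (rule rel)
  then obtain D b v i0 where lf: "i0 \<in> I" "v i0 \<noteq> 0" "leading_form_at I K (\<lambda>\<alpha> _ :: unit. C \<alpha>) D b v" by blast
  have v: "i0 \<in> I" "v i0 \<noteq> 0"
    "\<And>\<alpha>. \<alpha> \<in> PiE I (\<lambda>_. {..<K}) \<Longrightarrow> C \<alpha> \<noteq> 0 \<Longrightarrow> (\<Sum>i\<in>I. \<alpha> i) \<le> D"
    "(\<Sum>\<alpha> | \<alpha> \<in> PiE I (\<lambda>_. {..<K}) \<and> (\<Sum>i\<in>I. \<alpha> i) = D. C \<alpha> * monomial I \<alpha> v) \<noteq> 0"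
    using lf by (auto simp: leading_form_at_def)
  \<comment> \<open>Each \<open>w i\<close> is \<open>v i * x + u i\<close> with
    \<open>u i0 = 0\<close>, so the new base has one element less.\<close>
  define x where "x s = w i0 s / v i0" for s
  define u where "u i = (if i = i0 then (\<lambda>_. 0) else (\<lambda>s. w i s - v i * x s))" for i
  define Y where "Y = u ` (I - {i0})"
  have wi: "w i = (\<lambda>s. v i * x s + u i s)" for i using v(2) by (auto simp: u_def x_def)
  have u: "u i \<in> polys_upto Y 1" if "i \<in> I" for i
    using that polys_upto_const[of 0 Y 1] polys_upto_coord[of "u i" Y] by (cases "i = i0") (auto simp: u_def Y_def)
  have "weighted_integral V Y x"
  proof (rule relation_imp_weighted_integral[where I = I and c = C and A = "PiE I (\<lambda>_. {..<K})" and v = v and u = u and D = D])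
    show "(\<Sum>\<alpha>\<in>PiE I (\<lambda>_. {..<K}). C \<alpha> * monomial I \<alpha> (\<lambda>i. v i * x s + u i s)) = 0" if "s \<in> V" for s
      using rel[OF that] fun_cong[OF wi, of _ s] by simp
  qed (use assms(1) u v in \<open>auto intro: finite_PiE\<close>)
  then have "finite_over V (insert x Y) Y" by (rule finite_over_insert)
  moreover have "w ` I \<subseteq> polys_upto (insert x Y) 1"
  proof
    fix f assume "f \<in> w ` I"
    then obtain i where i: "i \<in> I" "f = (\<lambda>s. v i * x s + u i s)" using wi by auto
    have "polys_upto Y 1 \<subseteq> polys_upto (insert x Y) 1"
      using polys_upto_comp[of _ Y 1 "\<lambda>p. p" "insert x Y"] polys_upto_coord by blast
    then show "f \<in> polys_upto (insert x Y) 1"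
      unfolding i(2) using u[OF i(1)]
      by (intro polys_upto_add[OF polys_upto_scale[OF polys_upto_coord]]) auto
  qed
  ultimately have "finite_over V (w ` I) Y" by (rule finite_over_generators)
  moreover have "card Y \<le> card (I - {i0})" unfolding Y_def using assms(1) by (intro card_image_le) auto
  then have "card Y < card I" using assms(1) v(1)
    by (metis card_Diff1_less le_less_trans)
  ultimately show ?thesis using assms(1) by (intro exI[of _ Y]) (auto simp: Y_def)
qed

definition alg_independent :: "'a set \<Rightarrow> nat \<Rightarrow> (nat \<Rightarrow> 'a \<Rightarrow> complex) \<Rightarrow> bool" where
  "alg_independent V k w \<longleftrightarrow>
     (\<forall>G\<in>poly_funs (coords {..<k}). (\<forall>s\<in>V. G (\<lambda>i. w i s) = 0) \<longrightarrow> (\<forall>s. G s = 0))"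

lemma poly_funs_monomial: "I \<subseteq> J \<Longrightarrow> monomial I \<alpha> \<in> poly_funs (coords J)"
  unfolding monomial_def[abs_def]
  by (intro poly_funs_prod poly_funs_power poly_funs_coord) auto

text \<open>With fewer than \<open>m\<close> elements in \<open>Y\<close>, counting would force a
  nontrivial relation between the \<open>f i\<close>. The parameter set is empty because these
  functions are fixed.\<close>

lemma finite_over_card_ge:
  assumes "finite_over V X Y" "finite Y" and f: "\<And>i. i < m \<Longrightarrow> f i \<in> poly_funs X"
    and "alg_independent V m f"
  shows "m \<le> card Y"
proof (rule ccontr)
  assume "\<not> ?thesis"
  then have card: "card Y < card {..<m}" by simp
  have "\<forall>i\<in>{..<m}. \<exists>k. f i \<in> polys_upto X k" using f poly_funs_imp_polys_upto by blast
  then obtain k where k: "\<And>i. i < m \<Longrightarrow> f i \<in> polys_upto X (k i)" unfolding bchoice_iff by blast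
  define c where "c = (\<Sum>i<m. k i)"
  have "f i \<in> polys_upto X c" if "i < m" for i
    using k[OF that] that member_le_sum[of i "{..<m}" k] by (auto simp: c_def intro: polys_upto_mono)
  then have "(\<lambda>_. f i) \<in> param_span ({} :: nat set) (polys_upto X c)" if "i \<in> {..<m}" for i
    using that param_span.scaled[OF poly_funs.const[of 1], of "f i" "polys_upto X c"] by auto
  then obtain K C b \<alpha> where C: "\<alpha> \<in> PiE {..<m} (\<lambda>_. {..<K})" "C \<alpha> b \<noteq> 0"
    "\<And>b s. s \<in> V \<Longrightarrow> (\<Sum>\<alpha>\<in>PiE {..<m} (\<lambda>_. {..<K}). C \<alpha> b * monomial {..<m} \<alpha> (\<lambda>i. f i s)) = 0"
    using finite_over_relation[OF assms(1,2) _ card, of "\<lambda>i _. f i" "{} :: nat set" c] by auto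
  define G where "G s = (\<Sum>\<alpha>\<in>PiE {..<m} (\<lambda>_. {..<K}). C \<alpha> b * monomial {..<m} \<alpha> s)" for s
  have "G \<in> poly_funs (coords {..<m})"
    unfolding G_def[abs_def] by (intro poly_funs_sum poly_funs.mult poly_funs.const poly_funs_monomial) auto
  moreover have "\<forall>s\<in>V. G (\<lambda>i. f i s) = 0" using C(3) by (simp add: G_def)
  ultimately have "G s = 0" for s using assms(4) unfolding alg_independent_def by blast
  then show False using monomials_independent[of "{..<m}" \<alpha> K "\<lambda>\<alpha>. C \<alpha> b"] C(1,2) by (auto simp: G_def)
qed

text \<open>A relation between the \<open>w i\<close> would allow a smaller base.\<close>

lemma alg_independent_if_minimal:
  assumes "finite_over V X (w ` {..<k})" "V \<noteq> {}"
    and minimal: "\<And>Y. finite Y \<Longrightarrow> finite_over V X Y \<Longrightarrow> k \<le> card Y"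
  shows "alg_independent V k w"
  unfolding alg_independent_def
proof (intro ballI impI allI, rule ccontr)
  fix G s0 assume G: "G \<in> poly_funs (coords {..<k})" "\<forall>s\<in>V. G (\<lambda>i. w i s) = 0" "G s0 \<noteq> 0"
  let ?I = "coords {..<k}"
  have fin: "finite ?I" by (simp add: coords_def)
  obtain K where "G \<in> polys_upto ?I K" using G(1) poly_funs_imp_polys_upto by blast
  then obtain e where e: "\<And>s. G s = (\<Sum>\<tau>\<in>PiE ?I (\<lambda>_. {..K}). e \<tau> * monomial ?I \<tau> (\<lambda>y. y s))"
    using polys_upto_monomials fin by blast
  obtain \<beta> where \<beta>: "\<beta> \<in> PiE ?I (\<lambda>_. {..<Suc K})" "e \<beta> \<noteq> 0"
    using G(3) unfolding e lessThan_Suc_atMost by (metis (no_types, lifting) mult_zero_left sum.neutral)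
  \<comment> \<open>The expansion of \<open>G\<close> is indexed by the coordinate functions
    themselves, so the generators are re-indexed by them.\<close>
  define w' where "w' y = (\<lambda>s. y (\<lambda>i. w i s))" for y :: "(nat \<Rightarrow> complex) \<Rightarrow> complex"
  have "\<exists>Y. finite Y \<and> card Y < card ?I \<and> finite_over V (w' ` ?I) Y"
  proof (rule finite_over_dependent[where C = e and w = w', OF fin \<beta> assms(2)])
    show "(\<Sum>\<alpha>\<in>PiE ?I (\<lambda>_. {..<Suc K}). e \<alpha> * monomial ?I \<alpha> (\<lambda>i. w' i s)) = 0" if "s \<in> V" for s
      using G(2) that unfolding e lessThan_Suc_atMost w'_def by simp
  qed
  then obtain Y where Y: "finite Y" "card Y < card ?I" "finite_over V (w' ` ?I) Y" by blast
  have "w' ` ?I = w ` {..<k}" by (simp add: w'_def coords_def image_image)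
  then have "k \<le> card Y" using minimal[OF Y(1)] finite_over_trans[OF assms(1)] Y(3) by simp
  moreover have "card ?I \<le> k" unfolding coords_def using card_image_le[of "{..<k}"] by fastforce
  ultimately show False using Y(2) by simp
qed

text \<open>Column \<open>n\<close> of \<open>g\<close> holds the constant terms, so all parameters
  are coordinates of one function on pairs.\<close>

definition affine_form :: "nat \<Rightarrow> (nat \<times> nat \<Rightarrow> complex) \<Rightarrow> nat \<Rightarrow> (nat \<Rightarrow> complex) \<Rightarrow> complex" where
  "affine_form n g i s = (\<Sum>j<n. g (i, j) * s j) + g (i, n)"

lemma affine_form_upto: "affine_form n g i \<in> polys_upto (coords {..<n}) 1"
  unfolding affine_form_def[abs_def]
  by (intro polys_upto_add polys_upto_sum polys_upto_scale polys_upto_coord coordsI polys_upto_const) auto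

lemma affine_form_param:
  assumes "{i} \<times> {..n} \<subseteq> J"
  shows "(\<lambda>g. affine_form n g i) \<in> param_span J (polys_upto (coords {..<n}) 1)"
proof -
  have "(\<lambda>g s. (\<Sum>j<n. g (i, j) * s j) + g (i, n) * 1) \<in> param_span J (polys_upto (coords {..<n}) 1)"
    by (intro param_span.add param_span_sum param_span.scaled poly_funs_coord polys_upto_coord coordsI
        polys_upto_const) (use assms in auto)
  then show ?thesis by (simp add: affine_form_def[abs_def])
qed

text \<open>A relation between \<open>k + 1\<close> generic affine forms, after a change of basis that makes it monic in
  the first form.\<close>

lemma generic_weighted_integral:
  fixes V :: "(nat \<Rightarrow> complex) set"
  assumes "finite_over V (coords {..<n}) Y" "finite Y" "card Y \<le> k" "V \<noteq> {}"
  shows "\<exists>q\<in>poly_funs (coords ({..k} \<times> {..n})). (\<exists>g. q g \<noteq> 0) \<and>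
    (\<forall>g. q g \<noteq> 0 \<longrightarrow> weighted_integral V (affine_form n g ` {1..k}) (affine_form n g 0))"
proof -
  let ?J = "{..k} \<times> {..n}" and ?I = "{..k}"
  have "card Y < card ?I" using assms(3) by simp
  moreover have "(\<lambda>g. affine_form n g i) \<in> param_span ?J (polys_upto (coords {..<n}) 1)" if "i \<in> ?I" for i
    using that by (intro affine_form_param) auto
  ultimately obtain K C where C: "\<And>\<alpha>. \<alpha> \<in> PiE ?I (\<lambda>_. {..<K}) \<Longrightarrow> C \<alpha> \<in> poly_funs (coords ?J)"
    "\<exists>\<alpha>\<in>PiE ?I (\<lambda>_. {..<K}). \<exists>g. C \<alpha> g \<noteq> 0"
    "\<And>g s. s \<in> V \<Longrightarrow> (\<Sum>\<alpha>\<in>PiE ?I (\<lambda>_. {..<K}). C \<alpha> g * monomial ?I \<alpha> (\<lambda>i. affine_form n g i s)) = 0"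
    using finite_over_relation[OF assms(1,2), of ?I "\<lambda>i g. affine_form n g i" ?J 1] by blast
  let ?A = "PiE ?I (\<lambda>_. {..<K})"
  obtain \<beta> g1 where \<beta>: "\<beta> \<in> ?A" "C \<beta> g1 \<noteq> 0" using C(2) by blast
  obtain D g0 v i0 where lf: "i0 \<in> ?I" "v i0 \<noteq> 0" "leading_form_at ?I K C D g0 v"
    using leading_form_exists[of ?I \<beta> K C g1 V "\<lambda>g s i. affine_form n g i s", OF finite_atMost \<beta> assms(4) C(3)]
    by blast
  have v: "i0 \<in> ?I" "v i0 \<noteq> 0"
    "\<And>\<alpha> g. \<alpha> \<in> ?A \<Longrightarrow> C \<alpha> g \<noteq> 0 \<Longrightarrow> (\<Sum>i\<in>?I. \<alpha> i) \<le> D"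
    "(\<Sum>\<alpha> | \<alpha> \<in> ?A \<and> (\<Sum>i\<in>?I. \<alpha> i) = D. C \<alpha> g0 * monomial ?I \<alpha> v) \<noteq> 0"
    using lf unfolding leading_form_at_def by blast+
  \<comment> \<open>Form 0 is to become the direction \<open>v\<close>. Slot \<open>i0\<close> then
    holds a multiple of form 0, so if \<open>i0\<close> is not 0, form \<open>i0\<close> moves to
    slot 0.\<close>
  define \<sigma> where "\<sigma> i = (if i = 0 then i0 else i)" for i :: nat
  define h where "h g = (\<lambda>(i, j). if i = i0 then v i0 * g (0, j) else g (\<sigma> i, j) + v i * g (0, j))"
    for g :: "nat \<times> nat \<Rightarrow> complex"
  \<comment> \<open>The leading form at the fixed \<open>v\<close>, with coefficients taken at the
    transformed parameters \<open>h g\<close>.\<close>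
  define q where "q g = (\<Sum>\<alpha> | \<alpha> \<in> ?A \<and> (\<Sum>i\<in>?I. \<alpha> i) = D. C \<alpha> (h g) * monomial ?I \<alpha> v)" for g
  have "(\<lambda>g. h g (i, j)) \<in> poly_funs (coords ?J)" if "i \<le> k" "j \<le> n" for i j
    using that v(1) by (cases "i = i0")
      (auto simp: h_def \<sigma>_def intro!: poly_funs.add poly_funs.mult poly_funs.const poly_funs_coord)
  then have "(\<lambda>g. C \<alpha> (h g)) \<in> poly_funs (coords ?J)" if "\<alpha> \<in> ?A" for \<alpha>
    by (intro poly_funs_comp[OF C(1)[OF that]]) (auto simp: coords_def)
  then have "q \<in> poly_funs (coords ?J)"
    unfolding q_def[abs_def] by (intro poly_funs_sum poly_funs.mult poly_funs.const) auto
  moreover have "\<exists>g. q g \<noteq> 0"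
  proof -
    \<comment> \<open>A preimage of \<open>g0\<close> under the substitution \<open>h\<close>,
      available because \<open>v i0\<close> is nonzero; there \<open>q\<close> takes the nonzero
      value found before.\<close>
    define r where "r j = g0 (i0, j) / v i0" for j
    define g where "g = (\<lambda>(l, j). if l = 0 then r j else let i = (if l = i0 then 0 else l) in g0 (i, j) - v i * r j)"
    have "h g = g0"
      using v(2) by (auto simp: fun_eq_iff h_def g_def \<sigma>_def r_def Let_def)
    then show ?thesis using v(4) by (intro exI[of _ g]) (simp add: q_def)
  qed
  moreover have "weighted_integral V (affine_form n g ` {1..k}) (affine_form n g 0)" if "q g \<noteq> 0" for g
  proof -
    define u where "u i = (if i = i0 then (\<lambda>_. 0) else affine_form n g (\<sigma> i))" for i
    have eq: "affine_form n (h g) i s = v i * affine_form n g 0 s + u i s" for i s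
      by (auto simp: affine_form_def h_def u_def distrib_right sum.distrib distrib_left sum_distrib_left mult_ac)
    show ?thesis
    proof (rule relation_imp_weighted_integral[where I = ?I and c = "\<lambda>\<alpha>. C \<alpha> (h g)" and A = ?A and v = v and u = u and D = D])
      show "u i \<in> polys_upto (affine_form n g ` {1..k}) 1" if "i \<in> ?I" for i
      proof (cases "i = i0")
        case False
        then have "\<sigma> i \<in> {1..k}" "u i = affine_form n g (\<sigma> i)" using that v(1) by (auto simp: u_def \<sigma>_def)
        then show ?thesis by (simp only: polys_upto_coord imageI)
      qed (simp add: u_def polys_upto_const)
      show "(\<Sum>\<alpha>\<in>?A. C \<alpha> (h g) * monomial ?I \<alpha> (\<lambda>i. v i * affine_form n g 0 s + u i s)) = 0" if "s \<in> V" for s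
        using C(3)[OF that, of "h g"] by (simp add: eq)
    qed (use v that in \<open>auto intro: finite_PiE simp: q_def\<close>)
  qed
  ultimately show ?thesis by blast
qed

section \<open>Lying over\<close>

text \<open>Constant degrees fix the size and shape of the Sylvester matrix, so its determinant is
  one polynomial in the coefficients.\<close>

lemma poly_families_resultant:
  assumes "p \<in> poly_families X" "q \<in> poly_families X"
    and "\<And>s. degree (p s) = a" "\<And>s. degree (q s) = b"
  shows "(\<lambda>s. resultant (p s) (q s)) \<in> poly_funs X"
  unfolding resultant_def
proof (rule poly_funs_det)
  show "sylvester_mat (p s) (q s) \<in> carrier_mat (a + b) (a + b)" for s
    using sylvester_carrier_mat[of "p s" "q s"] assms(3,4) by simp
  fix i j assume ij: "i < a + b" "j < a + b"
  have "(\<lambda>s. sylvester_mat (p s) (q s) $$ (i, j)) =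
    (\<lambda>s. if i < b then if i \<le> j \<and> j - i \<le> a then coeff (p s) (a + i - j) else 0
     else if i - b \<le> j \<and> j \<le> i then coeff (q s) (i - j) else 0)"
    using sylvester_index_mat[of i "p _" "q _" j] ij assms(3,4) by (intro ext) simp
  also have "\<dots> \<in> poly_funs X"
    using poly_families_coeff[OF assms(1), of "a + i - j"] poly_families_coeff[OF assms(2), of "i - j"]
    by (cases "i < b"; cases "i \<le> j \<and> j - i \<le> a"; cases "i - b \<le> j \<and> j \<le> i") (auto simp: poly_funs.const)
  finally show "(\<lambda>s. sylvester_mat (p s) (q s) $$ (i, j)) \<in> poly_funs X" .
qed

lemma complex_poly_root: "degree p \<noteq> 0 \<Longrightarrow> \<exists>x :: complex. poly p x = 0"
  using fundamental_theorem_of_algebra[of p] constant_degree[of p] by simp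

lemma resultant_eq_0_iff_common_root:
  fixes p q :: "complex poly"
  assumes "p \<noteq> 0"
  shows "resultant p q = 0 \<longleftrightarrow> (\<exists>x. poly p x = 0 \<and> poly q x = 0)"
proof
  assume "resultant p q = 0"
  then have "degree (gcd p q) \<noteq> 0" by (simp add: resultant_0_gcd)
  then obtain x where "poly (gcd p q) x = 0"
    using complex_poly_root by blast
  then show "\<exists>x. poly p x = 0 \<and> poly q x = 0"
    by (metis dvd_trans gcd_dvd1 gcd_dvd2 poly_eq_0_iff_dvd)
next
  assume "\<exists>x. poly p x = 0 \<and> poly q x = 0"
  then obtain x where "[:-x, 1:] dvd gcd p q" by (auto simp: poly_eq_0_iff_dvd)
  moreover have "gcd p q \<noteq> 0" using assms by simp
  ultimately have "degree (gcd p q) \<noteq> 0"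
    using dvd_imp_degree_le[of "[:-x, 1:]" "gcd p q"] by auto
  then show "resultant p q = 0" by (simp add: resultant_0_gcd)
qed

text \<open>The point \<open>p\<close> lies, up to irrelevant coordinates, in the Zariski closure of the image of \<open>V\<close>
  under the first \<open>k\<close> components of \<open>u\<close>.\<close>

definition closure_point :: "'a set \<Rightarrow> ('a \<Rightarrow> nat \<Rightarrow> complex) \<Rightarrow> nat \<Rightarrow> (nat \<Rightarrow> complex) \<Rightarrow> bool" where
  "closure_point V u k p \<longleftrightarrow>
     (\<forall>G\<in>poly_funs (coords {..<k}). (\<forall>s\<in>V. G (u s) = 0) \<longrightarrow> G p = 0)"

text \<open>Points of \<open>V\<close> are seen through the map \<open>u\<close>, so that
  coordinates may be added. The degree of \<open>Q\<close> is constant for the sake of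
  resultants.\<close>

definition integral_over :: "'a set \<Rightarrow> ('a \<Rightarrow> nat \<Rightarrow> complex) \<Rightarrow> nat \<Rightarrow> ('a \<Rightarrow> complex) \<Rightarrow> bool" where
  "integral_over V u k x \<longleftrightarrow> (\<exists>Q\<in>poly_families (coords {..<k}). \<exists>D.
     (\<forall>s. degree (Q s) = D \<and> lead_coeff (Q s) = 1) \<and> (\<forall>s\<in>V. poly (Q (u s)) (x s) = 0))"

lemma poly_families_eval_last:
  assumes "Q \<in> poly_families (coords {..<k})"
  shows "(\<lambda>s. poly (Q s) (s k)) \<in> poly_funs (coords {..<Suc k})"
  by (intro poly_families_eval poly_families_mono[OF assms] coords_mono poly_funs_coord) auto

text \<open>Relations on \<open>V\<close>, specialized at \<open>p\<close>, form an ideal of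
  polynomials in the new coordinate, and a root of its generator extends \<open>p\<close>. Were the
  ideal everything, some relation \<open>G\<close> would specialize to a nonzero constant. Its
  resultant with the integral equation is a relation in the old coordinates alone, so it vanishes at
  \<open>p\<close> and yields a root of that constant.\<close>

lemma closure_point_extend:
  assumes p: "closure_point V u k p" and "integral_over V u k (\<lambda>s. u s k)"
  shows "\<exists>x. closure_point V u (Suc k) (p(k := x))"
proof -
  obtain Q D where Q: "Q \<in> poly_families (coords {..<k})" "\<And>s. degree (Q s) = D" "\<And>s. lead_coeff (Q s) = 1"
    "\<And>s. s \<in> V \<Longrightarrow> poly (Q (u s)) (u s k) = 0"
    using assms(2) unfolding integral_over_def by blast
  define I where "I = {\<phi>. \<exists>G\<in>poly_funs (coords {..<Suc k}). (\<forall>s\<in>V. G (u s) = 0) \<and> (\<forall>x. G (p(k := x)) = poly \<phi> x)}"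
  have "Q p \<in> I"
    unfolding I_def
  proof (intro CollectI bexI[OF _ poly_families_eval_last[OF Q(1)]] conjI allI ballI)
    fix x
    have "Q (p(k := x)) = Q p" by (rule poly_families_agree[OF Q(1)]) auto
    then show "poly (Q (p(k := x))) ((p(k := x)) k) = poly (Q p) x" by simp
  qed (rule Q(4))
  have I_comb: "\<phi> + \<chi> * \<psi> \<in> I" if I: "\<phi> \<in> I" "\<psi> \<in> I" for \<phi> \<chi> \<psi>
  proof -
    obtain F G where FG: "F \<in> poly_funs (coords {..<Suc k})" "G \<in> poly_funs (coords {..<Suc k})"
      "\<forall>s\<in>V. F (u s) = 0" "\<forall>s\<in>V. G (u s) = 0" "\<forall>x. F (p(k := x)) = poly \<phi> x" "\<forall>x. G (p(k := x)) = poly \<psi> x"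
      using I unfolding I_def by blast
    have "(\<lambda>s. poly \<chi> (s k)) \<in> poly_funs (coords {..<Suc k})"
      using poly_families_eval_last[OF poly_families_const[of \<chi>]] .
    then have "(\<lambda>s. F s + poly \<chi> (s k) * G s) \<in> poly_funs (coords {..<Suc k})"
      using FG by (intro poly_funs.add poly_funs.mult)
    then show ?thesis unfolding I_def using FG(3-6) by (intro CollectI bexI) auto
  qed
  have "Q p \<noteq> 0" using Q(3)[of p] by auto
  then obtain \<phi> where \<phi>: "\<phi> \<in> I" "\<phi> \<noteq> 0" "\<And>\<psi>. \<psi> \<in> I \<Longrightarrow> \<psi> \<noteq> 0 \<Longrightarrow> degree \<phi> \<le> degree \<psi>"
    using ex_has_least_nat[of "\<lambda>\<phi>. \<phi> \<in> I \<and> \<phi> \<noteq> 0" "Q p" degree] \<open>Q p \<in> I\<close> by blast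
  have dvd: "\<phi> dvd \<psi>" if "\<psi> \<in> I" for \<psi>
  proof -
    have "\<psi> mod \<phi> = \<psi> + (- (\<psi> div \<phi>)) * \<phi>" by (simp add: minus_div_mult_eq_mod[symmetric])
    then have "\<psi> mod \<phi> \<in> I" using I_comb[OF that \<phi>(1), of "- (\<psi> div \<phi>)"] by simp
    have "\<psi> mod \<phi> = 0"
    proof (rule ccontr)
      assume *: "\<psi> mod \<phi> \<noteq> 0"
      then have "degree (\<psi> mod \<phi>) < degree \<phi>" using degree_mod_less[OF \<phi>(2), of \<psi>] by simp
      then show False using \<phi>(3)[OF \<open>\<psi> mod \<phi> \<in> I\<close> *] by simp
    qed
    then show ?thesis by auto
  qed
  show ?thesis
  proof (cases "degree \<phi> = 0")
    case False
    then obtain x where x: "poly \<phi> x = 0"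
      using complex_poly_root by blast
    have "G (p(k := x)) = 0" if G: "G \<in> poly_funs (coords {..<Suc k})" "\<forall>s\<in>V. G (u s) = 0" for G
    proof -
      obtain g where "\<forall>s t. G (s(k := t)) = poly (g s) t" using poly_funs_split_last[OF G(1)] by blast
      then have "g p \<in> I" "G (p(k := x)) = poly (g p) x" using G unfolding I_def by auto
      then show ?thesis using dvd[of "g p"] x by auto
    qed
    then show ?thesis unfolding closure_point_def by blast
  next
    case True
    then obtain c where c: "\<phi> = [:c:]" "c \<noteq> 0" using \<phi>(2) by (metis degree_eq_zeroE pCons_eq_0_iff)
    obtain G where G: "G \<in> poly_funs (coords {..<Suc k})" "\<forall>s\<in>V. G (u s) = 0" "\<forall>x. G (p(k := x)) = c"
      using \<phi>(1) c(1) unfolding I_def by auto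
    obtain g where g: "g \<in> poly_families (coords {..<k})" "\<And>s t. G (s(k := t)) = poly (g s) t"
      using poly_funs_split_last[OF G(1)] by blast
    obtain N where N: "\<And>s. degree (g s) \<le> N" using poly_families_bound[OF g(1)] by blast
    \<comment> \<open>Adding a multiple of \<open>Q\<close> leaves the common roots with
      \<open>Q\<close> unchanged and fixes the degree at \<open>Suc N + D\<close>, so that the
      resultant is polynomial in \<open>s\<close>.\<close>
    define h where "h s = g s + monom 1 (Suc N) * Q s" for s
    have h: "h \<in> poly_families (coords {..<k})"
      unfolding h_def[abs_def] by (intro poly_families_add poly_families_mult poly_families_const g(1) Q(1))
    have degh: "degree (h s) = Suc N + D" for s
    proof -
      have "Q s \<noteq> 0" using Q(3)[of s] by auto
      then have "degree (monom 1 (Suc N) * Q s) = Suc N + D"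
        using Q(2) by (simp add: degree_mult_eq degree_monom_eq)
      moreover have "degree (g s) < Suc N + D" using N[of s] by simp
      ultimately show ?thesis unfolding h_def by (simp add: degree_add_eq_right)
    qed
    have "(\<lambda>s. resultant (Q s) (h s)) \<in> poly_funs (coords {..<k})"
      by (rule poly_families_resultant[OF Q(1) h Q(2) degh])
    moreover have "resultant (Q (u s)) (h (u s)) = 0" if "s \<in> V" for s
    proof (subst resultant_eq_0_iff_common_root)
      show "Q (u s) \<noteq> 0" using Q(3)[of "u s"] by auto
      have "poly (g (u s)) (u s k) = G (u s)" using g(2)[of "u s" "u s k"] by simp
      then show "\<exists>x. poly (Q (u s)) x = 0 \<and> poly (h (u s)) x = 0"
        using G(2) Q(4) that by (intro exI[of _ "u s k"]) (simp add: h_def)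
    qed
    ultimately have "resultant (Q p) (h p) = 0"
      using p[unfolded closure_point_def, THEN bspec[of _ _ "\<lambda>s. resultant (Q s) (h s)"]] by simp
    then obtain x where "poly (Q p) x = 0" "poly (h p) x = 0"
      using \<open>Q p \<noteq> 0\<close> by (auto simp: resultant_eq_0_iff_common_root)
    then have "poly (g p) x = 0" by (simp add: h_def)
    then show ?thesis using g(2)[of p x] G(3) c(2) by simp
  qed
qed

lemma integral_over_mono:
  assumes "integral_over V u k x" "k \<le> l"
  shows "integral_over V u l x"
proof -
  have "coords {..<k} \<subseteq> (coords {..<l} :: ((nat \<Rightarrow> complex) \<Rightarrow> complex) set)" using assms(2) by (intro coords_mono) auto
  then show ?thesis using assms(1) poly_families_mono unfolding integral_over_def by blast
qed

lemma lying_over: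
  assumes "closure_point V u k p" "k \<le> n"
    and "\<And>i. k \<le> i \<Longrightarrow> i < n \<Longrightarrow> integral_over V u k (\<lambda>s. u s i)"
  shows "\<exists>p'. (\<forall>i<k. p' i = p i) \<and> closure_point V u n p'"
  using assms(2,3)
proof (induction n rule: dec_induct)
  case base
  then show ?case using assms(1) by blast
next
  case (step n)
  then obtain p' where p': "\<forall>i<k. p' i = p i" "closure_point V u n p'" by auto
  have "integral_over V u k (\<lambda>s. u s n)" using step.prems step.hyps by auto
  then have "integral_over V u n (\<lambda>s. u s n)"
    using integral_over_mono step.hyps by blast
  then obtain x where "closure_point V u (Suc n) (p'(n := x))" using closure_point_extend[OF p'(2)] by blast
  then show ?case using p'(1) step.hyps by (intro exI[of _ "p'(n := x)"]) (auto simp del: fun_upd_apply simp: fun_upd_other)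
qed

lemma weighted_integral_imp_integral_over:
  assumes "weighted_integral V (w ` {..<k}) x" "\<And>s i. s \<in> V \<Longrightarrow> i < k \<Longrightarrow> u s i = w i s"
  shows "integral_over V u k x"
proof -
  obtain D r where r: "\<forall>j<D. r j \<in> polys_upto (w ` {..<k}) (D - j)"
    "\<forall>s\<in>V. x s ^ D + (\<Sum>j<D. r j s * x s ^ j) = 0"
    using assms(1) unfolding weighted_integral_def by blast
  have "\<forall>j\<in>{..<D}. \<exists>R. R \<in> polys_upto (coords {..<k}) (D - j) \<and> r j = (\<lambda>s. R (\<lambda>i. w i s))"
    using r(1) polys_upto_image by blast
  then obtain R where R: "\<And>j. j < D \<Longrightarrow> R j \<in> polys_upto (coords {..<k}) (D - j)"
    "\<And>j. j < D \<Longrightarrow> r j = (\<lambda>s. R j (\<lambda>i. w i s))" unfolding bchoice_iff by blast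
  define Q where "Q s = monom 1 D + (\<Sum>j<D. monom (R j s) j)" for s
  have coeff: "coeff (Q s) j = (if j = D then 1 else if j < D then R j s else 0)" for s j
    by (simp add: Q_def coeff_sum)
  have deg: "degree (Q s) = D" for s
    by (rule order_antisym[OF degree_le le_degree]) (auto simp: coeff)
  have Rp: "R j \<in> poly_funs (coords {..<k})" if "j < D" for j
    using R(1)[OF that] polys_upto_imp_poly_funs by blast
  then have "Q \<in> poly_families (coords {..<k})"
  proof -
    have "(\<lambda>s. coeff (Q s) j) \<in> poly_funs (coords {..<k})" for j
      using Rp
      by (cases "j = D"; cases "j < D") (auto simp: coeff poly_funs.const)
    then show ?thesis unfolding poly_families_def using deg by auto
  qed
  moreover have "poly (Q (u s)) (x s) = 0" if s: "s \<in> V" for s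
  proof -
    have "R j (u s) = r j s" if "j < D" for j
      unfolding R(2)[OF that]
      by (rule poly_funs_agree[OF polys_upto_imp_poly_funs[OF R(1)[OF that]]]) (use assms(2) s in auto)
    then have "poly (Q (u s)) (x s) = x s ^ D + (\<Sum>j<D. r j s * x s ^ j)"
      by (simp add: Q_def poly_sum poly_monom)
    then show ?thesis using r(2) s by simp
  qed
  ultimately show ?thesis unfolding integral_over_def using deg coeff
    by (intro bexI[of _ Q] exI[of _ D]) auto
qed

section \<open>Division in families of polynomials\<close>

text \<open>\<open>e\<close> bounds the degree at all points at once, and the coefficient at
  \<open>e\<close> may vanish at some of them. Multiplying by it at every step avoids division, so
  quotient and remainder are again polynomial families.\<close>

lemma pseudo_division:
  assumes P: "P \<in> poly_families X" "\<And>s j. j > e \<Longrightarrow> coeff (P s) j = 0" and "Q \<in> poly_families X"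
  shows "\<exists>N. \<exists>H\<in>poly_families X. \<exists>R\<in>poly_families X.
    (\<forall>s. smult (coeff (P s) e ^ N) (Q s) = P s * H s + R s) \<and> (\<forall>s j. j \<ge> e \<longrightarrow> coeff (R s) j = 0)"
proof -
  have *: "\<exists>N. \<exists>H\<in>poly_families X. \<exists>R\<in>poly_families X.
    (\<forall>s. smult (coeff (P s) e ^ N) (Q s) = P s * H s + R s) \<and> (\<forall>s j. j \<ge> e \<longrightarrow> coeff (R s) j = 0)"
    if "Q \<in> poly_families X" "\<forall>s j. j \<ge> M \<longrightarrow> coeff (Q s) j = 0" for M Q
    using that
  proof (induction M arbitrary: Q)
    case 0
    then show ?case
      by (intro exI[of _ 0] bexI[OF _ poly_families_const[of 0]] bexI[OF _ poly_families_const[of 0]])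
        (auto simp: poly_eq_iff)
  next
    case (Suc M)
    show ?case
    proof (cases "M < e")
      case True
      then show ?thesis using Suc.prems
        by (intro exI[of _ 0] bexI[OF _ poly_families_const[of 0]] bexI[OF _ Suc.prems(1)]) auto
    next
      case False
      \<comment> \<open>This multiplier cancels the coefficient at \<open>M\<close> once
        \<open>Q\<close> has been multiplied by \<open>coeff (P s) e\<close>.\<close>
      define T where "T s = smult (coeff (Q s) M) (monom 1 (M - e))" for s
      define Q' where "Q' s = smult (coeff (P s) e) (Q s) - T s * P s" for s
      have T: "T \<in> poly_families X"
        unfolding T_def[abs_def]
        by (intro poly_families_smult poly_families_coeff Suc.prems poly_families_const)
      have Q': "Q' \<in> poly_families X"
        unfolding Q'_def[abs_def] using P(1) Suc.prems(1) T
        by (intro poly_families_diff poly_families_smult poly_families_mult poly_families_coeff)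
      have "coeff (Q' s) j = 0" if j: "j \<ge> M" for s j
      proof -
        have T: "coeff (T s * P s) j = coeff (Q s) M * coeff (P s) (j - (M - e))"
          using j by (simp add: T_def coeff_monom_mult mult_smult_left)
        show ?thesis
        proof (cases "j = M")
          case True
          then show ?thesis using False T by (simp add: Q'_def)
        next
          case False
          with j \<open>\<not> M < e\<close> have "j \<ge> Suc M" "j - (M - e) > e" by auto
          then show ?thesis using P(2) Suc.prems(2) by (simp add: Q'_def T)
        qed
      qed
      then obtain N H R where NHR: "H \<in> poly_families X" "R \<in> poly_families X"
        "\<And>s. smult (coeff (P s) e ^ N) (Q' s) = P s * H s + R s" "\<forall>s j. j \<ge> e \<longrightarrow> coeff (R s) j = 0"
        using Suc.IH[OF Q'] by blast
      define H' where "H' s = H s + smult (coeff (P s) e ^ N) (T s)" for s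
      have "H' \<in> poly_families X"
        unfolding H'_def[abs_def] using P(1) T NHR(1)
        by (intro poly_families_add poly_families_smult poly_funs_power poly_families_coeff)
      moreover have "smult (coeff (P s) e ^ Suc N) (Q s) = P s * H' s + R s" for s
      proof -
        have "smult (coeff (P s) e ^ Suc N) (Q s) = smult (coeff (P s) e ^ N) (Q' s) + smult (coeff (P s) e ^ N) (T s) * P s"
          by (simp add: Q'_def smult_diff_right mult.commute)
        then show ?thesis by (simp add: NHR(3) H'_def algebra_simps)
      qed
      ultimately show ?thesis using NHR(2,4) by (intro exI[of _ "Suc N"] bexI[of _ H'] bexI[of _ R]) auto
    qed
  qed
  obtain M where "\<forall>s. degree (Q s) \<le> M" using poly_families_bound[OF assms(3)] by blast
  then have "\<forall>s j. j \<ge> Suc M \<longrightarrow> coeff (Q s) j = 0"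
    by (metis Suc_le_eq coeff_eq_0 le_less_trans)
  then show ?thesis using *[OF assms(3)] by blast
qed

lemma minimal_family:
  assumes "P0 \<in> S" "S \<subseteq> poly_families X" "P0 s0 \<noteq> 0"
  shows "\<exists>P\<in>S. \<exists>e. (\<forall>s j. j > e \<longrightarrow> coeff (P s) j = 0) \<and> (\<exists>s. coeff (P s) e \<noteq> 0) \<and>
    (\<forall>Q\<in>S. (\<forall>s j. j \<ge> e \<longrightarrow> coeff (Q s) j = 0) \<longrightarrow> (\<forall>s. Q s = 0))"
proof -
  \<comment> \<open>\<open>B e\<close> speaks of degree below \<open>e\<close>, so the degree sought
    is one less than the least such \<open>e\<close>.\<close>
  define B where "B e \<longleftrightarrow> (\<exists>P\<in>S. (\<exists>s. P s \<noteq> 0) \<and> (\<forall>s j. j \<ge> e \<longrightarrow> coeff (P s) j = 0))" for e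
  obtain M where "\<forall>s. degree (P0 s) \<le> M" using poly_families_bound assms(1,2) by blast
  then have "B (Suc M)" unfolding B_def using assms(1,3)
    by (metis Suc_le_eq coeff_eq_0 le_less_trans)
  define E where "E = (LEAST e. B e)"
  have "B E" unfolding E_def using \<open>B (Suc M)\<close> by (rule LeastI)
  then obtain P s1 where P: "P \<in> S" "P s1 \<noteq> 0" "\<forall>s j. j \<ge> E \<longrightarrow> coeff (P s) j = 0" unfolding B_def by blast
  obtain e where e: "E = Suc e"
  proof (cases E)
    case 0
    then have "P s1 = 0" using P(3) by (intro poly_eqI) simp
    then show ?thesis using P(2) by simp
  qed auto
  have "\<not> B e" using not_less_Least[of e B] e by (simp add: E_def)
  then have min: "\<forall>s. Q s = 0" if "Q \<in> S" "\<forall>s j. j \<ge> e \<longrightarrow> coeff (Q s) j = 0" for Q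
    using that unfolding B_def by blast
  have "\<exists>s. coeff (P s) e \<noteq> 0"
  proof (rule ccontr)
    assume *: "\<not> ?thesis"
    have "\<forall>s j. j \<ge> e \<longrightarrow> coeff (P s) j = 0"
    proof (intro allI impI)
      fix s j assume "j \<ge> e"
      then show "coeff (P s) j = 0" using * P(3) e by (cases "j = e") auto
    qed
    then show False using min P(1,2) by blast
  qed
  then show ?thesis using P(1,3) e min by (intro bexI[of _ P] exI[of _ e]) auto
qed

text \<open>Splitting off a root writes each coefficient as a sum of two terms with the same bound,
  so every root contributes a factor 2. This is Vieta with \<open>2 ^ e\<close> in place of binomial
  coefficients.\<close>

lemma poly_root_bound_imp_coeff_bound:
  fixes p :: "complex poly"
  assumes "degree p = e" "\<And>x. poly p x = 0 \<Longrightarrow> norm x \<le> R" "R \<ge> 0" "j \<le> e"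
  shows "norm (coeff p j) \<le> norm (lead_coeff p) * 2 ^ e * R ^ (e - j)"
  using assms
proof (induction e arbitrary: p j)
  case (Suc e)
  then obtain r where r: "poly p r = 0" using complex_poly_root[of p] by auto
  then obtain q where q: "p = [:-r, 1:] * q" using poly_eq_0_iff_dvd by (metis dvdE)
  have "q \<noteq> 0" using Suc.prems(1) q by auto
  then have deg: "degree q = e" using Suc.prems(1) by (simp add: q degree_mult_eq del: mult_pCons_left)
  have lc: "lead_coeff p = lead_coeff q" by (simp add: q lead_coeff_mult del: mult_pCons_left)
  have IH: "norm (coeff q i) \<le> norm (lead_coeff q) * 2 ^ e * R ^ (e - i)" if "i \<le> e" for i
  proof (rule Suc.IH[OF deg _ Suc.prems(3) that])
    show "norm x \<le> R" if "poly q x = 0" for x using that Suc.prems(2)[of x] by (simp add: q)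
  qed
  have coeff: "coeff p j = (if j = 0 then 0 else coeff q (j - 1)) - r * coeff q j"
    by (cases j) (simp_all add: q)
  have rR: "norm r \<le> R" using Suc.prems(2)[OF r] .
  let ?L = "norm (lead_coeff q)"
  have 1: "norm (if j = 0 then 0 else coeff q (j - 1)) \<le> ?L * 2 ^ e * R ^ (Suc e - j)"
    using IH[of "j - 1"] Suc.prems(3,4) by (cases j) auto
  have 2: "norm (r * coeff q j) \<le> ?L * 2 ^ e * R ^ (Suc e - j)"
  proof (cases "j = Suc e")
    case True
    then show ?thesis using deg by (simp add: coeff_eq_0)
  next
    case False
    then have "norm (r * coeff q j) \<le> R * (?L * 2 ^ e * R ^ (e - j))"
      unfolding norm_mult using IH[of j] rR Suc.prems(3,4) by (intro mult_mono) auto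
    also have "\<dots> = ?L * 2 ^ e * R ^ (Suc e - j)" using False Suc.prems(4) by (simp add: Suc_diff_le)
    finally show ?thesis .
  qed
  have "norm (coeff p j) \<le> ?L * 2 ^ e * R ^ (Suc e - j) + ?L * 2 ^ e * R ^ (Suc e - j)"
    unfolding coeff by (rule order_trans[OF norm_triangle_ineq4 add_mono[OF 1 2]])
  then show ?case unfolding lc by (simp add: algebra_simps)
qed auto

section \<open>Polynomial quotients with polynomial growth\<close>

text \<open>Bounded polynomials are constant; otherwise removing the constant term and dividing by
  the variable lowers the exponent by one.\<close>

lemma degree_le_if_growth:
  fixes p :: "complex poly"
  assumes "\<And>t. norm t \<ge> 1 \<Longrightarrow> norm (poly p t) \<le> C * norm t ^ k"
  shows "degree p \<le> k"
  using assms
proof (induction k arbitrary: p C)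
  case 0
  obtain a q where p: "p = pCons a q" by (rule pCons_cases)
  have "q = 0"
  proof (rule ccontr)
    assume "q \<noteq> 0"
    then obtain r where r: "\<forall>z. r \<le> norm z \<longrightarrow> C + 1 \<le> norm (poly (pCons a q) z)"
      using poly_infinity[of q "C + 1" a] by blast
    define z :: complex where "z = of_real (max 1 \<bar>r\<bar>)"
    have "norm z = max 1 \<bar>r\<bar>" by (simp add: z_def)
    then have "norm z \<ge> 1" "r \<le> norm z" by auto
    then show False using r 0[of z] p by force
  qed
  then show ?case using p by simp
next
  case (Suc k)
  obtain a q where p: "p = pCons a q" by (rule pCons_cases)
  have "degree q \<le> k"
  proof (rule Suc.IH[of q "C + norm a"])
    fix t :: complex assume t: "norm t \<ge> 1"
    have "norm t * norm (poly q t) = norm (poly p t - a)" by (simp add: p norm_mult)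
    also have "\<dots> \<le> C * norm t ^ Suc k + norm a * 1"
      using Suc.prems[OF t] norm_triangle_ineq4[of "poly p t" a] by simp
    also have "\<dots> \<le> C * norm t ^ Suc k + norm a * norm t ^ Suc k"
      by (intro add_left_mono mult_left_mono one_le_power t) auto
    also have "\<dots> = norm t * ((C + norm a) * norm t ^ k)" by (simp add: algebra_simps)
    finally show "norm (poly q t) \<le> (C + norm a) * norm t ^ k"
      using t by (auto simp: mult_le_cancel_left)
  qed
  then show ?case using p by (simp add: degree_pCons_le)
qed

text \<open>Used to carry an estimate across the finitely many zeros of a denominator.\<close>

lemma le_extend_over_finite:
  fixes f h :: "complex \<Rightarrow> real"
  assumes "\<And>t. isCont f t" "\<And>t. isCont h t" "finite F" "\<And>t. t \<notin> F \<Longrightarrow> f t \<le> h t"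
  shows "f t \<le> h t"
proof (rule tendsto_le[of "at t" h _ f])
  have "open (- (F - {t}))" using assms(3) by (intro open_Compl finite_imp_closed) auto
  then show "\<forall>\<^sub>F x in at t. f x \<le> h x"
    unfolding eventually_at_topological using assms(4) by (intro exI[of _ "- (F - {t})"]) auto
qed (use assms(1,2) in \<open>auto simp: isCont_def\<close>)

text \<open>The bound makes every root of \<open>g\<close> a root of \<open>p\<close>, and after a
  common factor is cancelled it persists by continuity, so multiplicities are matched too. The
  quotient inherits the growth and hence the degree bound.\<close>

lemma poly_quotient_of_growth:
  fixes p g :: "complex poly"
  assumes "g \<noteq> 0" "A \<ge> 0" "B \<ge> 0" "C \<ge> 0"
    and "\<And>t. poly g t \<noteq> 0 \<Longrightarrow> norm (poly p t) \<le> C * (A + B * norm t) ^ k * norm (poly g t)"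
  shows "\<exists>c. p = g * c \<and> degree c \<le> k"
proof -
  have main: "\<exists>c. p = g * c" if "\<And>t. norm (poly p t) \<le> C * (A + B * norm t) ^ k * norm (poly g t)" "degree g = N" "g \<noteq> 0"
    for p g :: "complex poly" and N
    using that
  proof (induction N arbitrary: p g)
    case 0
    then obtain a where "g = [:a:]" "a \<noteq> 0" by (metis degree_eq_zeroE pCons_eq_0_iff)
    then show ?case by (intro exI[of _ "smult (1 / a) p"]) simp
  next
    case (Suc N)
    then obtain r where r: "poly g r = 0" using complex_poly_root[of g] by auto
    then have "poly p r = 0" using Suc.prems(1)[of r] by simp
    then obtain g' p' where q: "g = [:-r, 1:] * g'" "p = [:-r, 1:] * p'"
      using r poly_eq_0_iff_dvd by (metis dvdE)
    have "g' \<noteq> 0" using Suc.prems q by auto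
    then have deg: "degree g' = N" using Suc.prems(2) by (simp add: q degree_mult_eq del: mult_pCons_left)
    have "norm (poly p' t) \<le> C * (A + B * norm t) ^ k * norm (poly g' t)" for t
    proof (rule le_extend_over_finite[where F = "{r}" and f = "\<lambda>t. norm (poly p' t)"
          and h = "\<lambda>t. C * (A + B * norm t) ^ k * norm (poly g' t)"])
      show "norm (poly p' t) \<le> C * (A + B * norm t) ^ k * norm (poly g' t)" if "t \<notin> {r}" for t
      proof -
        have "norm (t - r) * norm (poly p' t) \<le> norm (t - r) * (C * (A + B * norm t) ^ k * norm (poly g' t))"
          using Suc.prems(1)[of t] by (simp add: q norm_mult mult_ac flip: left_diff_distrib)
        then show ?thesis using that by (simp add: mult_le_cancel_left)
      qed
    qed (auto intro!: continuous_intros)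
    then obtain c where "p' = g' * c" using Suc.IH deg \<open>g' \<noteq> 0\<close> by blast
    then show ?case using q by (metis mult.assoc)
  qed
  have bound: "norm (poly p t) \<le> C * (A + B * norm t) ^ k * norm (poly g t)" for t
    by (rule le_extend_over_finite[where F = "{t. poly g t = 0}"])
      (use assms(1,5) in \<open>auto intro!: continuous_intros poly_roots_finite\<close>)
  then obtain c where c: "p = g * c" using main assms(1) by blast
  have cb: "norm (poly c t) \<le> C * (A + B * norm t) ^ k" for t
  proof (rule le_extend_over_finite[where F = "{t. poly g t = 0}" and f = "\<lambda>t. norm (poly c t)"
        and h = "\<lambda>t. C * (A + B * norm t) ^ k"])
    show "norm (poly c t) \<le> C * (A + B * norm t) ^ k" if "t \<notin> {t. poly g t = 0}" for t
      using bound[of t] that by (simp add: c norm_mult mult.commute[of "norm (poly g t)"])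
  qed (use assms(1) in \<open>auto intro!: continuous_intros poly_roots_finite\<close>)
  have "degree c \<le> k"
  proof (rule degree_le_if_growth)
    fix t :: complex assume t: "norm t \<ge> 1"
    have "A + B * norm t \<le> (A + B) * norm t" using t assms(2) by (simp add: distrib_right mult_le_cancel_left1)
    then have "C * (A + B * norm t) ^ k \<le> C * ((A + B) * norm t) ^ k"
      using assms(2-4) by (intro mult_left_mono power_mono) auto
    then show "norm (poly c t) \<le> (C * (A + B) ^ k) * norm t ^ k"
      using cb[of t] by (simp add: power_mult_distrib mult.assoc)
  qed
  then show ?thesis using c by blast
qed

text \<open>The coefficients of the quotient along the lines through a point where \<open>g\<close> does not vanish are
  computed by power series division, hence are polynomials in the direction of the line.\<close>

lemma quotient_poly_funs:
  fixes m :: nat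
  assumes p: "p \<in> poly_funs (coords {..<m})" and g: "g \<in> poly_funs (coords {..<m})" "g y \<noteq> 0" and "C \<ge> 0"
    and bound: "\<And>s. g s \<noteq> 0 \<Longrightarrow> norm (p s) \<le> C * (1 + (\<Sum>j<m. norm (s j))) ^ k * norm (g s)"
  shows "\<exists>q\<in>poly_funs (coords {..<m}). \<forall>s. p s = g s * q s"
proof -
  obtain P where P: "P \<in> poly_families (coords {..<m})" "\<And>v t. p (\<lambda>i. y i + t * v i) = poly (P v) t"
    using poly_funs_line[OF p, of y] by blast
  obtain G where G: "G \<in> poly_families (coords {..<m})" "\<And>v t. g (\<lambda>i. y i + t * v i) = poly (G v) t"
    using poly_funs_line[OF g(1), of y] by blast
  \<comment> \<open>In every direction \<open>G v\<close> has the same nonzero constant term, so the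
    recursion for the quotient divides only by the constant \<open>g y\<close> and stays polynomial
    in \<open>v\<close>.\<close>
  have G0: "coeff (G v) 0 = g y" for v using G(2)[of 0 v] by (simp add: poly_0_coeff_0)
  have "\<exists>c. P v = G v * c \<and> degree c \<le> k" for v
  proof (rule poly_quotient_of_growth[where C = C and A = "1 + (\<Sum>j<m. norm (y j))" and B = "\<Sum>j<m. norm (v j)"])
    show "G v \<noteq> 0" using G0[of v] g(2) by auto
    fix t assume t: "poly (G v) t \<noteq> 0"
    have "(\<Sum>j<m. norm (y j + t * v j)) \<le> (\<Sum>j<m. norm (y j) + norm (v j) * norm t)"
      by (intro sum_mono norm_triangle_le) (simp add: norm_mult mult.commute)
    then have "1 + (\<Sum>j<m. norm (y j + t * v j)) \<le> 1 + (\<Sum>j<m. norm (y j)) + (\<Sum>j<m. norm (v j)) * norm t"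
      by (simp add: sum.distrib sum_distrib_right)
    then have "C * (1 + (\<Sum>j<m. norm (y j + t * v j))) ^ k * norm (poly (G v) t)
        \<le> C * (1 + (\<Sum>j<m. norm (y j)) + (\<Sum>j<m. norm (v j)) * norm t) ^ k * norm (poly (G v) t)"
      using assms(4) by (intro mult_right_mono mult_left_mono power_mono) (auto simp: sum_nonneg)
    then show "norm (poly (P v) t) \<le> C * (1 + (\<Sum>j<m. norm (y j)) + (\<Sum>j<m. norm (v j)) * norm t) ^ k * norm (poly (G v) t)"
      using bound[of "\<lambda>i. y i + t * v i"] t by (simp add: P(2) G(2))
  qed (use assms(4) in \<open>auto simp: sum_nonneg\<close>)
  then obtain c where c: "\<And>v. P v = G v * c v" "\<And>v. degree (c v) \<le> k" by metis
  have coeffs: "(\<lambda>v. coeff (c v) j) \<in> poly_funs (coords {..<m})" for j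
  proof (induction j rule: less_induct)
    case (less j)
    have "coeff (P v) j = g y * coeff (c v) j + (\<Sum>i<j. coeff (G v) (j - i) * coeff (c v) i)" for v
    proof -
      have "coeff (P v) j = coeff (c v * G v) j" by (simp add: c(1) mult.commute)
      also have "\<dots> = (\<Sum>i\<le>j. coeff (c v) i * coeff (G v) (j - i))" by (rule coeff_mult)
      also have "{..j} = insert j {..<j}" by auto
      finally show ?thesis by (simp add: G0 mult.commute)
    qed
    then have "(\<lambda>v. coeff (c v) j) = (\<lambda>v. (1 / g y) * (coeff (P v) j - (\<Sum>i<j. coeff (G v) (j - i) * coeff (c v) i)))"
      using g(2) by (auto simp: fun_eq_iff)
    also have "\<dots> \<in> poly_funs (coords {..<m})"
      by (intro poly_funs.mult poly_funs.const poly_funs_diff poly_funs_sum)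
        (auto intro: less poly_families_coeff[OF P(1)] poly_families_coeff[OF G(1)])
    finally show ?case .
  qed
  then have "c \<in> poly_families (coords {..<m})" using c(2) by (auto simp: poly_families_def)
  then have "(\<lambda>v. poly (c v) 1) \<in> poly_funs (coords {..<m})"
    using poly_families_eval poly_funs.const by fast
  \<comment> \<open>The point \<open>s\<close> is reached from \<open>y\<close> at time 1 in the
    direction \<open>s - y\<close>.\<close>
  then have "(\<lambda>s. poly (c (\<lambda>i. s i - y i)) 1) \<in> poly_funs (coords {..<m})"
    by (rule poly_funs_comp) (auto simp: coords_def intro!: poly_funs_diff poly_funs.const poly_funs_coord[unfolded coords_def])
  moreover have "p s = g s * poly (c (\<lambda>i. s i - y i)) 1" for s
    using P(2)[of 1 "\<lambda>i. s i - y i"] G(2)[of 1 "\<lambda>i. s i - y i"] c(1)[of "\<lambda>i. s i - y i"] by simp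
  ultimately show ?thesis by (intro bexI[of _ "\<lambda>s. poly (c (\<lambda>i. s i - y i)) 1"]) auto
qed

section \<open>Varieties in Noether position\<close>

text \<open>Points of \<open>n\<close>-space are infinite sequences, of which only the first \<open>n\<close> entries matter; the
  coordinates \<open>y\<close> come first.\<close>

locale noether_position =
  fixes V :: "(nat \<Rightarrow> complex) set" and n m :: nat
  assumes m_le: "m \<le> n"
    and irreducible: "f \<in> poly_funs (coords {..<n}) \<Longrightarrow> g \<in> poly_funs (coords {..<n}) \<Longrightarrow>
      (\<And>s. s \<in> V \<Longrightarrow> f s * g s = 0) \<Longrightarrow> (\<forall>s\<in>V. f s = 0) \<or> (\<forall>s\<in>V. g s = 0)"
    and closed: "closure_point V (\<lambda>s. s) n p \<Longrightarrow> \<exists>s\<in>V. \<forall>i<n. s i = p i"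
    and indep: "alg_independent V m (\<lambda>i s. s i)"
    and integral: "m \<le> i \<Longrightarrow> i < n \<Longrightarrow> integral_over V (\<lambda>s. s) m (\<lambda>s. s i)"
    and growth: "\<exists>C\<ge>0. \<forall>s\<in>V. \<forall>i<n. norm (s i) \<le> C * (1 + (\<Sum>j<m. norm (s j)))"
    and dependent: "l \<in> poly_funs (coords {..<n}) \<Longrightarrow>
      \<exists>G\<in>poly_funs (coords {..<Suc m}). (\<exists>s. G s \<noteq> 0) \<and> (\<forall>s\<in>V. G (s(m := l s)) = 0)"
begin

abbreviation families :: "((nat \<Rightarrow> complex) \<Rightarrow> complex poly) set" where
  "families \<equiv> poly_families (coords {..<m})"

definition vanishes :: "((nat \<Rightarrow> complex) \<Rightarrow> complex) \<Rightarrow> ((nat \<Rightarrow> complex) \<Rightarrow> complex poly) \<Rightarrow> bool" where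
  "vanishes l P \<longleftrightarrow> (\<forall>s\<in>V. poly (P s) (l s) = 0)"

lemma coords_m: "coords {..<m} \<subseteq> (coords {..<n} :: ((nat \<Rightarrow> complex) \<Rightarrow> complex) set)"
  using m_le by (intro coords_mono) auto

lemma families_eval: "P \<in> families \<Longrightarrow> l \<in> poly_funs (coords {..<n}) \<Longrightarrow>
    (\<lambda>s. poly (P s) (l s)) \<in> poly_funs (coords {..<n})"
  using poly_families_eval poly_families_mono[OF _ coords_m] by blast

text \<open>Irreducibility of \<open>V\<close> says that the polynomials annihilating
  \<open>l\<close> form a prime ideal.\<close>

lemma vanishes_mult:
  assumes "P \<in> families" "Q \<in> families" "l \<in> poly_funs (coords {..<n})"
    and "\<And>s. s \<in> V \<Longrightarrow> poly (P s * Q s) (l s) = 0"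
  shows "vanishes l P \<or> vanishes l Q"
  unfolding vanishes_def
  by (rule irreducible[OF families_eval[OF assms(1,3)] families_eval[OF assms(2,3)]])
    (use assms(4) in simp)

lemma zero_if_zero_on_V: "g \<in> poly_funs (coords {..<m}) \<Longrightarrow> (\<And>s. s \<in> V \<Longrightarrow> g s = 0) \<Longrightarrow> g s = 0"
  using indep unfolding alg_independent_def by blast

text \<open>The degree is formal, taken over all points at once: the coefficient at \<open>e\<close>
  is a nonzero polynomial in \<open>y\<close> that may have zeros. This is a minimal polynomial over
  rational functions with denominators cleared.\<close>

definition minimal_for ::
    "((nat \<Rightarrow> complex) \<Rightarrow> complex) \<Rightarrow> nat \<Rightarrow> ((nat \<Rightarrow> complex) \<Rightarrow> complex poly) \<Rightarrow> bool" where
  "minimal_for l e P \<longleftrightarrow> P \<in> families \<and> vanishes l P \<and>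
     (\<forall>s j. j > e \<longrightarrow> coeff (P s) j = 0) \<and> (\<exists>s. coeff (P s) e \<noteq> 0) \<and>
     (\<forall>Q\<in>families. vanishes l Q \<longrightarrow> (\<forall>s j. j \<ge> e \<longrightarrow> coeff (Q s) j = 0) \<longrightarrow> (\<forall>s. Q s = 0))"

lemma minimal_exists:
  assumes "l \<in> poly_funs (coords {..<n})"
  shows "\<exists>e P. minimal_for l e P"
proof -
  obtain G s0 where G: "G \<in> poly_funs (coords {..<Suc m})" "G s0 \<noteq> 0" "\<forall>s\<in>V. G (s(m := l s)) = 0"
    using dependent[OF assms] by blast
  obtain P where P: "P \<in> families" "\<forall>s t. G (s(m := t)) = poly (P s) t"
    using poly_funs_split_last[OF G(1)] by blast
  have "P s0 \<noteq> 0" using G(2) P(2)[rule_format, of s0 "s0 m"] by auto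
  moreover have "P \<in> {P \<in> families. vanishes l P}" using P G(3) by (auto simp: vanishes_def)
  ultimately have "\<exists>P\<in>{P \<in> families. vanishes l P}. \<exists>e. (\<forall>s j. j > e \<longrightarrow> coeff (P s) j = 0) \<and>
      (\<exists>s. coeff (P s) e \<noteq> 0) \<and>
      (\<forall>Q\<in>{P \<in> families. vanishes l P}. (\<forall>s j. j \<ge> e \<longrightarrow> coeff (Q s) j = 0) \<longrightarrow> (\<forall>s. Q s = 0))"
    by (intro minimal_family) auto
  then show ?thesis unfolding minimal_for_def by blast
qed

text \<open>In degree 0 the polynomial would be a nonzero function of \<open>y\<close> alone that
  vanishes on \<open>V\<close>, against the independence of the coordinates
  \<open>y\<close>.\<close>

lemma minimal_pos:
  assumes "minimal_for l e P"
  shows "e > 0"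
proof (rule ccontr)
  assume "\<not> e > 0"
  then have e: "e = 0" by simp
  have P: "P \<in> families" "vanishes l P" "\<And>s j. j > 0 \<Longrightarrow> coeff (P s) j = 0" "\<exists>s. coeff (P s) 0 \<noteq> 0"
    using assms e unfolding minimal_for_def by auto
  have "P s = [:coeff (P s) 0:]" for s
    by (rule poly_eqI) (use P(3) in \<open>auto simp: coeff_pCons split: nat.split\<close>)
  then have "coeff (P s) 0 = poly (P s) x" for s x by (metis mult_zero_right add.right_neutral poly_0 poly_pCons)
  then have "coeff (P s) 0 = 0" if "s \<in> V" for s using P(2) that unfolding vanishes_def by metis
  then have "coeff (P s) 0 = 0" for s using zero_if_zero_on_V[OF poly_families_coeff[OF P(1)]] by blast
  then show False using P(4) by simp
qed

text \<open>The pseudo-remainder annihilates \<open>l\<close> in lower degree, so it is zero. Where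
  the leading coefficient is nonzero, roots of \<open>P\<close> are therefore roots of every
  annihilating polynomial.\<close>

lemma minimal_divides:
  assumes P: "minimal_for l e P" and Q: "Q \<in> families" "vanishes l Q"
  shows "\<exists>N. \<exists>H\<in>families. \<forall>s. smult (coeff (P s) e ^ N) (Q s) = P s * H s"
proof -
  have P': "P \<in> families" "\<And>s j. j > e \<Longrightarrow> coeff (P s) j = 0" "vanishes l P"
    using P unfolding minimal_for_def by auto
  obtain N H R where NHR: "H \<in> families" "R \<in> families"
    "\<And>s. smult (coeff (P s) e ^ N) (Q s) = P s * H s + R s" "\<forall>s j. j \<ge> e \<longrightarrow> coeff (R s) j = 0"
    using pseudo_division[OF P'(1,2) Q(1)] by blast
  have "R s = smult (coeff (P s) e ^ N) (Q s) - P s * H s" for s using NHR(3)[of s] by simp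
  then have "vanishes l R" using Q(2) P'(3) by (simp add: vanishes_def)
  then have "\<forall>s. R s = 0" using P NHR(2,4) unfolding minimal_for_def by blast
  then show ?thesis using NHR(1,3) by (intro exI[of _ N] bexI[of _ H]) auto
qed

text \<open>The greatest common divisor of a minimal polynomial and its derivative, computed up to
  denominators as an element of least degree in the ideal they generate, is constant.\<close>

lemma minimal_separable:
  assumes P: "minimal_for l e P" and l: "l \<in> poly_funs (coords {..<n})"
  shows "\<exists>\<mu>\<in>poly_funs (coords {..<m}). (\<exists>s. \<mu> s \<noteq> 0) \<and>
    (\<forall>s x. \<mu> s \<noteq> 0 \<longrightarrow> poly (P s) x = 0 \<longrightarrow> poly (pderiv (P s)) x \<noteq> 0)"
proof -
  have P': "P \<in> families" "\<And>s j. j > e \<Longrightarrow> coeff (P s) j = 0" "vanishes l P"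
    using P unfolding minimal_for_def by auto
  obtain s0 where s0: "coeff (P s0) e \<noteq> 0" using P unfolding minimal_for_def by blast
  have min: "\<forall>s. Q s = 0" if "Q \<in> families" "vanishes l Q" "\<forall>s j. j \<ge> e \<longrightarrow> coeff (Q s) j = 0" for Q
    using P that unfolding minimal_for_def by blast
  have e: "e > 0" using minimal_pos[OF P] .
  define S where "S = {Q. \<exists>A\<in>families. \<exists>B\<in>families. Q = (\<lambda>s. A s * P s + B s * pderiv (P s))}"
  have S_fam: "S \<subseteq> families"
    unfolding S_def using P'(1) by (auto intro!: poly_families_add poly_families_mult poly_families_pderiv)
  have "P \<in> S" unfolding S_def
    by (intro CollectI bexI[OF _ poly_families_const[of 1]] bexI[OF _ poly_families_const[of 0]]) simp
  have dP: "(\<lambda>s. pderiv (P s)) \<in> S" unfolding S_def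
    by (intro CollectI bexI[OF _ poly_families_const[of 0]] bexI[OF _ poly_families_const[of 1]]) simp
  have "P s0 \<noteq> 0" using s0 by auto
  with \<open>P \<in> S\<close> S_fam have "\<exists>P\<in>S. \<exists>e. (\<forall>s j. j > e \<longrightarrow> coeff (P s) j = 0) \<and> (\<exists>s. coeff (P s) e \<noteq> 0) \<and>
    (\<forall>Q\<in>S. (\<forall>s j. j \<ge> e \<longrightarrow> coeff (Q s) j = 0) \<longrightarrow> (\<forall>s. Q s = 0))"
    by (rule minimal_family[of P S _ s0])
  then obtain M f where M0: "M \<in> S"
    "(\<forall>s j. j > f \<longrightarrow> coeff (M s) j = 0) \<and> (\<exists>s. coeff (M s) f \<noteq> 0) \<and>
      (\<forall>Q\<in>S. (\<forall>s j. j \<ge> f \<longrightarrow> coeff (Q s) j = 0) \<longrightarrow> (\<forall>s. Q s = 0))"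
    by (elim bexE exE) (rule that)
  then have M: "M \<in> S" "\<And>s j. j > f \<Longrightarrow> coeff (M s) j = 0" "\<exists>s. coeff (M s) f \<noteq> 0" by auto
  have M_min: "\<forall>s. Q s = 0" if "Q \<in> S" "\<forall>s j. j \<ge> f \<longrightarrow> coeff (Q s) j = 0" for Q
    using conjunct2[OF conjunct2[OF M0(2)], THEN bspec, OF that(1)] that(2) by (rule mp)
  define \<mu> where "\<mu> s = coeff (M s) f" for s
  have Mf: "M \<in> families" using M(1) S_fam by blast
  then have \<mu>: "\<mu> \<in> poly_funs (coords {..<m})" unfolding \<mu>_def[abs_def] by (rule poly_families_coeff)
  obtain A B where AB: "M = (\<lambda>s. A s * P s + B s * pderiv (P s))" "A \<in> families" "B \<in> families"
    using M(1) unfolding S_def by blast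
  have divides: "\<exists>N. \<exists>H\<in>families. \<forall>s. smult (\<mu> s ^ N) (Q s) = M s * H s" if "Q \<in> S" for Q
  proof -
    have Q: "Q \<in> families" using that S_fam by blast
    obtain N H R where NHR: "H \<in> families" "R \<in> families"
      "\<And>s. smult (\<mu> s ^ N) (Q s) = M s * H s + R s" "\<forall>s j. j \<ge> f \<longrightarrow> coeff (R s) j = 0"
      using pseudo_division[OF Mf M(2) Q] unfolding \<mu>_def by blast
    obtain A' B' where AB': "Q = (\<lambda>s. A' s * P s + B' s * pderiv (P s))" "A' \<in> families" "B' \<in> families"
      using \<open>Q \<in> S\<close> unfolding S_def by blast
    have "R \<in> S"
      unfolding S_def
    proof (intro CollectI bexI)
      show "R = (\<lambda>s. (smult (\<mu> s ^ N) (A' s) - A s * H s) * P s + (smult (\<mu> s ^ N) (B' s) - B s * H s) * pderiv (P s))"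
      proof
        fix s
        have "R s = smult (\<mu> s ^ N) (Q s) - M s * H s" using NHR(3)[of s] by simp
        then show "R s = (smult (\<mu> s ^ N) (A' s) - A s * H s) * P s + (smult (\<mu> s ^ N) (B' s) - B s * H s) * pderiv (P s)"
          by (simp add: AB(1) AB'(1) algebra_simps smult_add_right)
      qed
    qed (intro poly_families_diff poly_families_smult poly_families_mult poly_funs_power \<mu> AB AB' NHR)+
    then have "\<forall>s. R s = 0" using NHR(4) by (rule M_min)
    then show ?thesis using NHR(1,3) by (intro exI[of _ N] bexI[of _ H]) auto
  qed
  have "f = 0"
  proof (rule ccontr)
    assume "f \<noteq> 0"
    \<comment> \<open>Otherwise the derivative would lie below the least degree \<open>f\<close> and
      be zero, which characteristic 0 excludes.\<close>
    have "f < e"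
    proof (rule ccontr)
      assume "\<not> f < e"
      then have "\<forall>s j. j \<ge> f \<longrightarrow> coeff (pderiv (P s)) j = 0" using P'(2) by (simp add: coeff_pderiv)
      then have "\<forall>s. pderiv (P s) = 0" by (rule M_min[OF dP])
      then have "coeff (pderiv (P s0)) (e - 1) = 0" by simp
      then show False using s0 e by (simp add: coeff_pderiv)
    qed
    obtain N H where H: "H \<in> families" "\<And>s. smult (\<mu> s ^ N) (P s) = M s * H s"
      using divides[OF \<open>P \<in> S\<close>] by blast
    \<comment> \<open>\<open>M\<close> divides \<open>P\<close> up to a power of
      \<open>\<mu>\<close>. Both factors have degree below \<open>e\<close> since
      \<open>0 < f < e\<close>, so neither can annihilate \<open>l\<close>.\<close>
    have "vanishes l M \<or> vanishes l H"
    proof (rule vanishes_mult[OF Mf H(1) l])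
      show "poly (M s * H s) (l s) = 0" if "s \<in> V" for s
        unfolding H(2)[symmetric] using P'(3) that by (simp add: vanishes_def)
    qed
    then show False
    proof
      assume "vanishes l M"
      then have "\<forall>s. M s = 0" using min[OF Mf] M(2) \<open>f < e\<close> by simp
      then show False using M(3) by simp
    next
      assume "vanishes l H"
      \<comment> \<open>The degree of \<open>M s\<close> is known only where \<open>\<mu>\<close> is
        nonzero; density carries the vanishing of the coefficient to all points.\<close>
      have "coeff (H s) j = 0" if j: "j \<ge> e" for s j
      proof (rule poly_funs_zero_on_open[OF poly_families_coeff[OF H(1)] \<mu>])
        show "\<mu> (SOME s. \<mu> s \<noteq> 0) \<noteq> 0" using M(3) unfolding \<mu>_def by (rule someI_ex)
        fix s assume "\<mu> s \<noteq> 0"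
        then have "f \<le> degree (M s)" "M s \<noteq> 0" unfolding \<mu>_def by (auto intro: le_degree)
        have "degree (smult (\<mu> s ^ N) (P s)) \<le> e" using P'(2) by (intro degree_le) auto
        then have "degree (M s * H s) \<le> e" by (simp add: H(2))
        then show "coeff (H s) j = 0"
          using \<open>f \<le> degree (M s)\<close> \<open>M s \<noteq> 0\<close> \<open>f \<noteq> 0\<close> j
          by (cases "H s = 0") (auto simp: degree_mult_eq intro: coeff_eq_0)
      qed
      then have H0: "\<forall>s. H s = 0" using min[OF H(1) \<open>vanishes l H\<close>] by blast
      obtain s where "\<mu> s \<noteq> 0" "coeff (P s) e \<noteq> 0"
        using poly_funs_common_nonzero[OF \<mu> poly_families_coeff[OF P'(1)] _ s0] M(3) unfolding \<mu>_def by blast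
      then show False using H(2)[of s] H0 by auto
    qed
  qed
  have "poly (pderiv (P s)) x \<noteq> 0" if "\<mu> s \<noteq> 0" "poly (P s) x = 0" for s x
  proof
    assume "poly (pderiv (P s)) x = 0"
    then have "poly (M s) x = 0" using that(2) by (simp add: AB(1))
    moreover have "M s = [:\<mu> s:]"
      by (rule poly_eqI) (use M(2) \<open>f = 0\<close> in \<open>auto simp: coeff_pCons \<mu>_def split: nat.split\<close>)
    ultimately show False using that(1) by simp
  qed
  then show ?thesis using \<mu> M(3) unfolding \<mu>_def by (intro bexI[of _ \<mu>]) (auto simp: \<mu>_def[abs_def])
qed

text \<open>The value of \<open>l\<close> is inserted as an extra coordinate after \<open>y\<close>.
  The hypothesis says that \<open>(s, x)\<close> satisfies all relations between \<open>y\<close>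
  and \<open>l\<close> on \<open>V\<close>; the remaining coordinates are integral over
  \<open>y\<close>, so lying over produces a point of \<open>V\<close>.\<close>

lemma root_attained:
  assumes l: "l \<in> poly_funs (coords {..<n})"
    and root: "\<And>Q. Q \<in> families \<Longrightarrow> vanishes l Q \<Longrightarrow> poly (Q s) x = 0"
  shows "\<exists>z\<in>V. (\<forall>i<m. z i = s i) \<and> l z = x"
proof -
  define u where "u z i = (if i < m then z i else if i = m then l z else z (i - 1))" for z :: "nat \<Rightarrow> complex" and i
  have "closure_point V u (Suc m) (s(m := x))"
    unfolding closure_point_def
  proof (intro ballI impI)
    fix G assume G: "G \<in> poly_funs (coords {..<Suc m})" "\<forall>z\<in>V. G (u z) = 0"
    obtain g where g: "g \<in> families" "\<And>s t. G (s(m := t)) = poly (g s) t"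
      using poly_funs_split_last[OF G(1)] by blast
    have "poly (g z) (l z) = 0" if "z \<in> V" for z
    proof -
      have "g (u z) = g z" by (rule poly_families_agree[OF g(1)]) (auto simp: u_def)
      then have "poly (g z) (l z) = G ((u z)(m := l z))" by (simp only: g(2))
      also have "(u z)(m := l z) = u z" by (auto simp: u_def)
      finally show ?thesis using G(2) that by simp
    qed
    then show "G (s(m := x)) = 0" unfolding g(2) by (intro root g(1)) (simp add: vanishes_def)
  qed
  moreover have "integral_over V u (Suc m) (\<lambda>z. u z i)" if i: "Suc m \<le> i" "i < Suc n" for i
  proof (rule integral_over_mono)
    have "m \<le> i - 1" "i - 1 < n" using i by auto
    then obtain Q D where Q: "Q \<in> families" "\<forall>s. degree (Q s) = D \<and> lead_coeff (Q s) = 1"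
      "\<forall>z\<in>V. poly (Q z) (z (i - 1)) = 0"
      using integral[of "i - 1"] unfolding integral_over_def by blast
    have "Q (u z) = Q z" for z by (rule poly_families_agree[OF Q(1)]) (auto simp: u_def)
    then show "integral_over V u m (\<lambda>z. u z i)"
      unfolding integral_over_def using Q(3) i
      by (intro bexI[OF _ Q(1)] exI[of _ D] conjI[OF Q(2)]) (simp add: u_def)
  qed simp
  ultimately obtain p' where p': "\<forall>i<Suc m. p' i = (s(m := x)) i" "closure_point V u (Suc n) p'"
    using lying_over[of V u "Suc m" "s(m := x)" "Suc n"] m_le by auto
  \<comment> \<open>\<open>w\<close> deletes the inserted coordinate and so undoes
    \<open>u\<close>.\<close>
  define w where "w t i = (if i < m then t i else t (Suc i))" for t :: "nat \<Rightarrow> complex" and i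
  have wu: "w (u z) i = z i" for z i by (auto simp: w_def u_def)
  have w_fun: "(\<lambda>t. G (w t)) \<in> poly_funs (coords {..<Suc n})" if "G \<in> poly_funs (coords {..<n})" for G
  proof (rule poly_funs_comp[OF that])
    fix x :: "(nat \<Rightarrow> complex) \<Rightarrow> complex" assume "x \<in> coords {..<n}"
    then obtain i where "i < n" "x = (\<lambda>s. s i)" by (auto simp: coords_def)
    then show "(\<lambda>t. x (w t)) \<in> poly_funs (coords {..<Suc n})"
      by (cases "i < m") (auto simp: w_def intro: poly_funs_coord)
  qed
  have "closure_point V (\<lambda>s. s) n (w p')"
    unfolding closure_point_def
  proof (intro ballI impI)
    fix G assume G: "G \<in> poly_funs (coords {..<n})" "\<forall>z\<in>V. G z = 0"
    have "w (u z) = z" for z using wu by (intro ext)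
    then show "G (w p') = 0"
      using p'(2)[unfolded closure_point_def, THEN bspec[of _ _ "\<lambda>t. G (w t)"]] w_fun[OF G(1)] G(2) by simp
  qed
  then obtain z where z: "z \<in> V" "\<forall>i<n. z i = w p' i" using closed by blast
  \<comment> \<open>That entry \<open>m\<close> is the value of \<open>l\<close> is itself a
    relation on the image, so it holds at \<open>p'\<close>.\<close>
  have "(\<lambda>t. l (w t) - t m) \<in> poly_funs (coords {..<Suc n})"
    using m_le by (intro poly_funs_diff w_fun l poly_funs_coord) auto
  moreover have "l (w (u z)) - u z m = 0" for z
    using poly_funs_agree[OF l, of "w (u z)" z] wu by (simp add: u_def)
  ultimately have "l (w p') - p' m = 0"
    using p'(2)[unfolded closure_point_def, THEN bspec[of _ _ "\<lambda>t. l (w t) - t m"]] by simp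
  moreover have "l z = l (w p')" using z(2) by (intro poly_funs_agree[OF l]) auto
  moreover have "z i = s i" if "i < m" for i using z(2) p'(1) that m_le by (simp add: w_def)
  ultimately show ?thesis using z(1) p'(1) by (intro bexI[of _ z]) auto
qed

lemma monic_minimal_exists:
  assumes l: "l \<in> poly_funs (coords {..<n})"
    and growth_l: "C \<ge> 0" "\<And>s. s \<in> V \<Longrightarrow> norm (l s) \<le> C * (1 + (\<Sum>j<m. norm (s j)))"
  shows "\<exists>e P. minimal_for l e P \<and> (\<forall>s. coeff (P s) e = 1)"
proof -
  obtain e P where P: "minimal_for l e P" using minimal_exists[OF l] by blast
  have P': "P \<in> families" "\<And>s j. j > e \<Longrightarrow> coeff (P s) j = 0" "vanishes l P"
    using P unfolding minimal_for_def by auto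
  obtain s0 where s0: "coeff (P s0) e \<noteq> 0" using P unfolding minimal_for_def by blast
  define g where "g s = coeff (P s) e" for s
  have g: "g \<in> poly_funs (coords {..<m})" "g s0 \<noteq> 0"
    unfolding g_def[abs_def] using s0 P'(1) by (auto intro: poly_families_coeff)
  define M where "M s = 1 + (\<Sum>j<m. norm (s j))" for s :: "nat \<Rightarrow> complex"
  have M: "M s \<ge> 0" for s by (simp add: M_def sum_nonneg)
  have bound: "norm (coeff (P s) j) \<le> (2 ^ e * C ^ (e - j)) * M s ^ (e - j) * norm (g s)"
    if s: "g s \<noteq> 0" and j: "j \<le> e" for s j
  proof -
    have deg: "degree (P s) = e"
      by (rule order_antisym[OF degree_le le_degree]) (use P'(2) s in \<open>auto simp: g_def\<close>)
    have "norm x \<le> C * M s" if x: "poly (P s) x = 0" for x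
    proof -
      have "poly (Q s) x = 0" if Q: "Q \<in> families" "vanishes l Q" for Q
      proof -
        obtain N H where "smult (g s ^ N) (Q s) = P s * H s"
          using minimal_divides[OF P Q] unfolding g_def by blast
        then have "poly (smult (g s ^ N) (Q s)) x = 0" using x by simp
        then show ?thesis using s by simp
      qed
      then obtain z where z: "z \<in> V" "\<forall>i<m. z i = s i" "l z = x" using root_attained[OF l] by blast
      \<comment> \<open>\<open>M\<close> depends on the coordinates \<open>y\<close> only, so growth
        at the point above \<open>s\<close> is growth in \<open>s\<close>.\<close>
      then have "M z = M s" by (simp add: M_def)
      then show ?thesis using growth_l(2)[OF z(1)] z(3) by (simp add: M_def)
    qed
    then have "norm (coeff (P s) j) \<le> norm (lead_coeff (P s)) * 2 ^ e * (C * M s) ^ (e - j)"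
      using deg j growth_l(1) M[of s] by (intro poly_root_bound_imp_coeff_bound) auto
    then show ?thesis using deg by (simp add: g_def power_mult_distrib mult_ac)
  qed
  have "\<exists>q\<in>poly_funs (coords {..<m}). \<forall>s. coeff (P s) j = g s * q s" if "j \<le> e" for j
    using bound that growth_l(1) unfolding M_def
    by (intro quotient_poly_funs[OF poly_families_coeff[OF P'(1)] g, of "2 ^ e * C ^ (e - j)" _ "e - j"]) auto
  then have "\<forall>j\<in>{..<e}. \<exists>q. q \<in> poly_funs (coords {..<m}) \<and> (\<forall>s. coeff (P s) j = g s * q s)"
    by (meson less_imp_le lessThan_iff)
  then obtain q where q: "\<And>j. j < e \<Longrightarrow> q j \<in> poly_funs (coords {..<m})"
    "\<And>j s. j < e \<Longrightarrow> coeff (P s) j = g s * q j s" unfolding bchoice_iff by blast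
  define R where "R s = monom 1 e + (\<Sum>j<e. monom (q j s) j)" for s
  have coeff: "coeff (R s) j = (if j = e then 1 else if j < e then q j s else 0)" for s j
    by (simp add: R_def coeff_sum)
  have "degree (R s) \<le> e" for s by (rule degree_le) (simp add: coeff)
  moreover have "(\<lambda>s. coeff (R s) j) \<in> poly_funs (coords {..<m})" for j
    using q(1) by (cases "j = e"; cases "j < e") (auto simp: coeff poly_funs.const)
  ultimately have R: "R \<in> families" unfolding poly_families_def by auto
  have PR: "P s = smult (g s) (R s)" for s
    by (rule poly_eqI) (use P'(2) q(2) in \<open>auto simp: coeff g_def\<close>)
  \<comment> \<open>\<open>P\<close> is \<open>g\<close> times the monic family \<open>R\<close>. As
    \<open>g\<close> is not zero on all of \<open>V\<close>, primeness leaves \<open>R\<close> as an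
    annihilating family.\<close>
  have "vanishes l (\<lambda>s. [:g s:]) \<or> vanishes l R"
    by (rule vanishes_mult[OF poly_families_coef[OF g(1)] R l])
      (use P'(3) in \<open>simp add: vanishes_def PR\<close>)
  moreover have "\<not> vanishes l (\<lambda>s. [:g s:])"
    using zero_if_zero_on_V[OF g(1)] g(2) unfolding vanishes_def by auto
  ultimately have "minimal_for l e R"
    using P R unfolding minimal_for_def by (auto simp: coeff)
  then show ?thesis by (intro exI[of _ e] exI[of _ R]) (simp add: coeff)
qed

end

section \<open>Simple roots and the sum of the roots\<close>

lemma card_roots_if_separable:
  fixes p :: "complex poly"
  assumes "p \<noteq> 0" "\<And>x. poly p x = 0 \<Longrightarrow> poly (pderiv p) x \<noteq> 0"
  shows "card {x. poly p x = 0} = degree p"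
proof -
  have "rsquarefree p" using assms(2) by (auto simp: rsquarefree_roots)
  then have "smult (lead_coeff p) (\<Prod>z | poly p z = 0. [:-z, 1:]) = p"
    by (rule complex_poly_decompose_rsquarefree)
  then have "degree p = degree (\<Prod>z | poly p z = 0. [:-z, 1:])"
    using assms(1) by (metis degree_smult_eq leading_coeff_0_iff)
  also have "\<dots> = (\<Sum>z | poly p z = 0. degree [:-z, 1:])" by (rule degree_prod_eq_sum_degree) simp
  finally show ?thesis by simp
qed

text \<open>A double root could be divided out once without losing any root, leaving too small a
  degree.\<close>

lemma separable_if_card_roots:
  fixes p :: "complex poly"
  assumes "p \<noteq> 0" "card {x. poly p x = 0} = degree p" "poly p a = 0"
  shows "poly (pderiv p) a \<noteq> 0"
proof
  assume d: "poly (pderiv p) a = 0"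
  obtain q where q: "p = [:-a, 1:] * q" using assms(3) poly_eq_0_iff_dvd by (metis dvdE)
  have "q \<noteq> 0" using assms(1) q by auto
  have deg: "degree p = Suc (degree q)" using \<open>q \<noteq> 0\<close> by (simp add: q degree_mult_eq del: mult_pCons_left)
  have "poly q a = 0" using d by (simp add: q pderiv_mult pderiv_pCons del: mult_pCons_left)
  then have "{x. poly p x = 0} = {x. poly q x = 0}" by (auto simp: q)
  then show False using poly_roots_degree[OF \<open>q \<noteq> 0\<close>] assms(2) deg by simp
qed

lemma coeff_prod_linear_factors:
  fixes Z :: "complex set"
  assumes "finite Z"
  shows "coeff (\<Prod>z\<in>Z. [:-z, 1:]) (card Z) = 1 \<and>
    (Z \<noteq> {} \<longrightarrow> coeff (\<Prod>z\<in>Z. [:-z, 1:]) (card Z - 1) = - (\<Sum>z\<in>Z. z))"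
  using assms
proof (induction Z rule: finite_induct)
  case (insert z Z)
  let ?q = "\<Prod>z\<in>Z. [:-z, 1:]"
  have "degree ?q = card Z" by (subst degree_prod_eq_sum_degree) auto
  then have "coeff ?q (Suc (card Z)) = 0" by (simp add: coeff_eq_0)
  then show ?case using insert by (cases "card Z") auto
qed simp

lemma sum_roots:
  fixes p :: "complex poly"
  assumes "lead_coeff p = 1" "card {x. poly p x = 0} = degree p" "degree p > 0"
  shows "(\<Sum>x | poly p x = 0. x) = - coeff p (degree p - 1)"
proof -
  let ?Z = "{x. poly p x = 0}"
  have "p \<noteq> 0" using assms(1) by auto
  then have fin: "finite ?Z" by (rule poly_roots_finite)
  have "rsquarefree p"
    using separable_if_card_roots[OF \<open>p \<noteq> 0\<close> assms(2)] by (auto simp: rsquarefree_roots)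
  then have "smult (lead_coeff p) (\<Prod>z\<in>?Z. [:-z, 1:]) = p" by (rule complex_poly_decompose_rsquarefree)
  then have "(\<Prod>z\<in>?Z. [:-z, 1:]) = p" using assms(1) by simp
  moreover have "?Z \<noteq> {}"
  proof
    assume "?Z = {}"
    then have "card ?Z = 0" by (simp only: card.empty)
    then show False using assms(2,3) by simp
  qed
  ultimately show ?thesis using coeff_prod_linear_factors[OF fin] assms(2) by simp
qed

text \<open>\<open>support\<close> pins down the irrelevant entries, so that counting sequences
  counts points. The number \<open>d\<close> is prescribed only over a nonempty open set; that no
  fibre is larger is derived below.\<close>

locale noether_position_degree = noether_position +
  fixes d :: nat
  assumes support: "s \<in> V \<Longrightarrow> n \<le> i \<Longrightarrow> s i = 0"
    and generic_fibre: "\<exists>\<delta>\<in>poly_funs (coords {..<m}). (\<exists>s. \<delta> s \<noteq> 0) \<and>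
      (\<forall>s. \<delta> s \<noteq> 0 \<longrightarrow> finite {z \<in> V. \<forall>i<m. z i = s i} \<and> card {z \<in> V. \<forall>i<m. z i = s i} = d)"
begin

definition fibre :: "(nat \<Rightarrow> complex) \<Rightarrow> (nat \<Rightarrow> complex) set" where
  "fibre s = {z \<in> V. \<forall>i<m. z i = s i}"

definition ramified :: "(nat \<Rightarrow> complex) \<Rightarrow> bool" where
  "ramified s \<longleftrightarrow> \<not> (finite (fibre s) \<and> card (fibre s) = d)"

text \<open>The coefficients run along the moment curve, so a statement for infinitely many
  \<open>c\<close> is a polynomial identity in \<open>c\<close> and can be read off for each
  coordinate.\<close>

definition linear_form :: "complex \<Rightarrow> (nat \<Rightarrow> complex) \<Rightarrow> complex" where
  "linear_form c s = (\<Sum>i<n - m. c ^ i * s (m + i))"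

lemma linear_form_poly: "linear_form c \<in> poly_funs (coords {..<n})"
  unfolding linear_form_def[abs_def]
  by (intro poly_funs_sum poly_funs.mult poly_funs.const poly_funs_coord) auto

definition fibre_poly :: "complex \<Rightarrow> nat \<Rightarrow> ((nat \<Rightarrow> complex) \<Rightarrow> complex poly) \<Rightarrow> bool" where
  "fibre_poly c e P \<longleftrightarrow> P \<in> families \<and> 0 < e \<and> e \<le> d \<and> (\<forall>s. degree (P s) = e \<and> lead_coeff (P s) = 1) \<and>
     (\<forall>s. {x. poly (P s) x = 0} = linear_form c ` fibre s) \<and>
     (\<exists>B\<ge>0. \<forall>s. norm (coeff (P s) (e - 1)) \<le> B * (1 + (\<Sum>j<m. norm (s j))))"

lemma fibre_poly_exists: "\<exists>e P. fibre_poly c e P"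
proof -
  let ?l = "linear_form c"
  define M where "M s = 1 + (\<Sum>j<m. norm (s j))" for s :: "nat \<Rightarrow> complex"
  have M: "M s \<ge> 0" for s by (simp add: M_def sum_nonneg)
  obtain C0 where C0: "C0 \<ge> 0" "\<And>s i. s \<in> V \<Longrightarrow> i < n \<Longrightarrow> norm (s i) \<le> C0 * M s"
    using growth unfolding M_def by blast
  define C where "C = (\<Sum>i<n - m. norm c ^ i * C0)"
  have C: "C \<ge> 0" unfolding C_def using C0(1) by (intro sum_nonneg) auto
  have lC: "norm (?l s) \<le> C * M s" if "s \<in> V" for s
  proof -
    have "norm (?l s) \<le> (\<Sum>i<n - m. norm (c ^ i * s (m + i)))" unfolding linear_form_def by (rule norm_sum)
    also have "\<dots> \<le> (\<Sum>i<n - m. norm c ^ i * (C0 * M s))"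
      unfolding norm_mult norm_power using that by (intro sum_mono mult_left_mono C0(2)) auto
    finally show ?thesis by (simp add: C_def sum_distrib_right mult.assoc)
  qed
  obtain e P where P: "minimal_for ?l e P" "\<And>s. coeff (P s) e = 1"
    using monic_minimal_exists[OF linear_form_poly C lC[unfolded M_def]] by blast
  have P': "P \<in> families" "\<And>s j. j > e \<Longrightarrow> coeff (P s) j = 0" "vanishes ?l P"
    using P(1) unfolding minimal_for_def by auto
  have e: "e > 0" using minimal_pos[OF P(1)] .
  have deg: "degree (P s) = e" for s
    by (rule order_antisym[OF degree_le le_degree]) (use P'(2) P(2) in auto)
  have nz: "P s \<noteq> 0" for s using P(2)[of s] by auto
  have roots: "{x. poly (P s) x = 0} = ?l ` fibre s" for s
  proof (intro equalityI subsetI)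
    fix x assume "x \<in> {x. poly (P s) x = 0}"
    then have x: "poly (P s) x = 0" by simp
    have "poly (Q s) x = 0" if Q: "Q \<in> families" "vanishes ?l Q" for Q
    proof -
      obtain N H where "smult (coeff (P s) e ^ N) (Q s) = P s * H s"
        using minimal_divides[OF P(1) Q] by blast
      then have "Q s = P s * H s" by (simp add: P(2))
      then show ?thesis using x by simp
    qed
    then obtain z where "z \<in> V" "\<forall>i<m. z i = s i" "?l z = x" using root_attained[OF linear_form_poly] by blast
    then show "x \<in> ?l ` fibre s" by (auto simp: fibre_def)
  next
    fix x assume "x \<in> ?l ` fibre s"
    then obtain z where z: "z \<in> V" "\<forall>i<m. z i = s i" "x = ?l z" by (auto simp: fibre_def)
    have "P z = P s" by (rule poly_families_agree[OF P'(1)]) (use z in auto)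
    then show "x \<in> {x. poly (P s) x = 0}" using P'(3) z by (auto simp: vanishes_def)
  qed
  have "e \<le> d"
  proof -
    obtain \<mu> s1 where \<mu>: "\<mu> \<in> poly_funs (coords {..<m})" "\<mu> s1 \<noteq> 0"
      "\<forall>s x. \<mu> s \<noteq> 0 \<longrightarrow> poly (P s) x = 0 \<longrightarrow> poly (pderiv (P s)) x \<noteq> 0"
      using minimal_separable[OF P(1) linear_form_poly] by (elim bexE conjE exE) (rule that)
    obtain \<delta> s2 where \<delta>: "\<delta> \<in> poly_funs (coords {..<m})" "\<delta> s2 \<noteq> 0"
      "\<forall>s. \<delta> s \<noteq> 0 \<longrightarrow> finite (fibre s) \<and> card (fibre s) = d"
      using generic_fibre unfolding fibre_def[symmetric] by (elim bexE conjE exE) (rule that)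
    \<comment> \<open>At a point common to both open sets the \<open>e\<close> roots are simple, and
      they are values of the form at \<open>d\<close> points.\<close>
    obtain s where s: "\<mu> s \<noteq> 0" "\<delta> s \<noteq> 0"
      using poly_funs_common_nonzero[of \<mu> "{..<m}" \<delta> s1 s2, OF \<mu>(1) \<delta>(1) \<mu>(2) \<delta>(2)] by (elim exE conjE) (rule that)
    have "e = card {x. poly (P s) x = 0}"
      using card_roots_if_separable[OF nz, of s] \<mu>(3) s(1) deg by simp
    also have "\<dots> \<le> card (fibre s)" unfolding roots using \<delta>(3) s(2) by (intro card_image_le) auto
    finally show ?thesis using \<delta>(3) s(2) by simp
  qed
  moreover have "norm (coeff (P s) (e - 1)) \<le> (2 ^ e * C) * M s" for s
  proof -
    have "norm x \<le> C * M s" if "poly (P s) x = 0" for x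
    proof -
      have "x \<in> ?l ` fibre s" using that roots by blast
      then obtain z where z: "z \<in> V" "\<forall>i<m. z i = s i" "x = ?l z" by (auto simp: fibre_def)
      then have "M z = M s" by (simp add: M_def)
      then show ?thesis using lC[OF z(1)] z(3) by simp
    qed
    \<comment> \<open>The exponent \<open>e - (e - 1)\<close> is 1 because \<open>e > 0\<close>;
      hence the growth is linear.\<close>
    then have "norm (coeff (P s) (e - 1)) \<le> norm (lead_coeff (P s)) * 2 ^ e * (C * M s) ^ (e - (e - 1))"
      using deg C M[of s] by (intro poly_root_bound_imp_coeff_bound) auto
    then show ?thesis using deg P(2) e by (simp add: mult.assoc)
  qed
  ultimately show ?thesis
    unfolding fibre_poly_def M_def using P'(1) e deg P(2) roots C
    by (intro exI[of _ e] exI[of _ P] conjI allI exI[of _ "2 ^ e * C"]) auto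
qed

text \<open>Two points of one fibre agree in \<open>y\<close>, so they differ in some coordinate of
  \<open>x\<close>, and the difference of the forms is a nonzero polynomial in
  \<open>c\<close>.\<close>

lemma linear_form_separates:
  assumes "finite S" "S \<subseteq> fibre s"
  shows "finite {c. \<not> inj_on (linear_form c) S}"
proof -
  define D where "D z w = (\<Sum>i<n - m. monom (z (m + i) - w (m + i)) i)" for z w :: "nat \<Rightarrow> complex"
  have poly_D: "poly (D z w) c = linear_form c z - linear_form c w" for z w c
    by (simp add: D_def poly_sum poly_monom linear_form_def sum_subtractf algebra_simps)
  have D: "D z w \<noteq> 0" if zw: "z \<in> S" "w \<in> S" "z \<noteq> w" for z w
  proof
    assume "D z w = 0"
    have "z i = w i" for i
    proof -
      consider "i < m" | "m \<le> i" "i < n" | "n \<le> i" by linarith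
      then show ?thesis
      proof cases
        case 2
        then have "i - m < n - m" by arith
        then have "coeff (D z w) (i - m) = z i - w i" using 2 by (simp add: D_def coeff_sum)
        then show ?thesis using \<open>D z w = 0\<close> by simp
      next
        case 3
        moreover have "z \<in> V" "w \<in> V" using zw assms(2) by (auto simp: fibre_def)
        ultimately show ?thesis by (simp add: support)
      next
        case 1
        moreover have "z \<in> fibre s" "w \<in> fibre s" using zw assms(2) by auto
        ultimately show ?thesis by (simp add: fibre_def)
      qed
    qed
    then show False using zw(3) by auto
  qed
  have "{c. \<not> inj_on (linear_form c) S} \<subseteq> (\<Union>z\<in>S. \<Union>w\<in>S - {z}. {c. poly (D z w) c = 0})"
    unfolding inj_on_def poly_D by auto
  moreover have "finite (\<Union>z\<in>S. \<Union>w\<in>S - {z}. {c. poly (D z w) c = 0})"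
    using assms(1) D by (intro finite_UN_I poly_roots_finite) auto
  ultimately show ?thesis by (rule finite_subset)
qed

lemma fibre_poly_injective:
  assumes "fibre_poly c e P" "S \<subseteq> fibre s" "inj_on (linear_form c) S"
  shows "finite S \<and> card S \<le> e"
proof -
  have P: "degree (P s) = e" "lead_coeff (P s) = 1" "{x. poly (P s) x = 0} = linear_form c ` fibre s"
    using assms(1) unfolding fibre_poly_def by auto
  then have "P s \<noteq> 0" by auto
  have sub: "linear_form c ` S \<subseteq> {x. poly (P s) x = 0}" using P(3) assms(2) by auto
  have fin: "finite {x. poly (P s) x = 0}" using poly_roots_finite[OF \<open>P s \<noteq> 0\<close>] .
  have "finite S" using finite_imageD[OF finite_subset[OF sub fin] assms(3)] .
  moreover have "card S = card (linear_form c ` S)" by (rule card_image[OF assms(3), symmetric])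
  moreover have "card (linear_form c ` S) \<le> e"
    using card_mono[OF fin sub] poly_roots_degree[OF \<open>P s \<noteq> 0\<close>] P(1) by simp
  ultimately show ?thesis by simp
qed

text \<open>A finite part of the fibre is separated by some form and injects into the roots of a
  polynomial of degree at most \<open>d\<close>. An infinite fibre would contain
  \<open>d + 1\<close> points.\<close>

lemma fibre_card_le: "finite (fibre s) \<and> card (fibre s) \<le> d"
proof -
  have *: "card S \<le> d" if S: "finite S" "S \<subseteq> fibre s" for S
  proof -
    have "infinite (UNIV - {c. \<not> inj_on (linear_form c) S})"
      using linear_form_separates[OF S] infinite_UNIV_char_0 by (intro Diff_infinite_finite)
    then have "UNIV - {c. \<not> inj_on (linear_form c) S} \<noteq> {}" by (intro notI) simp
    then obtain c where c: "inj_on (linear_form c) S" by auto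
    obtain e P where P: "fibre_poly c e P" using fibre_poly_exists by blast
    then have "e \<le> d" unfolding fibre_poly_def by blast
    then show ?thesis using fibre_poly_injective[OF P S(2) c] by simp
  qed
  show ?thesis
  proof (cases "finite (fibre s)")
    case True
    then show ?thesis using * by blast
  next
    case False
    then obtain S where "finite S \<and> card S = Suc d \<and> S \<subseteq> fibre s"
      using infinite_arbitrarily_large by blast
    then show ?thesis using *[of S] by simp
  qed
qed

lemma fibre_poly_unramified:
  assumes "\<not> ramified s" "inj_on (linear_form c) (fibre s)" "fibre_poly c e P"
  shows "e = d" "card {x. poly (P s) x = 0} = degree (P s)"
    "(\<Sum>z\<in>fibre s. linear_form c z) = - coeff (P s) (d - 1)"
proof -
  have P: "degree (P s) = e" "lead_coeff (P s) = 1" "{x. poly (P s) x = 0} = linear_form c ` fibre s"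
    "0 < e" "e \<le> d"
    using assms(3) unfolding fibre_poly_def by auto
  have d: "finite (fibre s)" "card (fibre s) = d" using assms(1) by (auto simp: ramified_def)
  show e: "e = d" using fibre_poly_injective[OF assms(3) order_refl assms(2)] d P(5) by simp
  show card: "card {x. poly (P s) x = 0} = degree (P s)"
    unfolding P(3) using card_image[OF assms(2)] d P(1) e by simp
  have "(\<Sum>z\<in>fibre s. linear_form c z) = (\<Sum>x | poly (P s) x = 0. x)"
    unfolding P(3) by (simp add: sum.reindex[OF assms(2)])
  also have "\<dots> = - coeff (P s) (degree (P s) - 1)"
    using sum_roots[OF P(2) card] P(1,4) by simp
  finally show "(\<Sum>z\<in>fibre s. linear_form c z) = - coeff (P s) (d - 1)" using P(1) e by simp
qed

text \<open>Only forms whose polynomial has full degree \<open>d\<close> enter \<open>F\<close>. A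
  nonzero discriminant gives \<open>d\<close> distinct values and so \<open>d\<close> points; over
  an unramified point a separating form has full degree and simple roots.\<close>

lemma ramified_closed:
  "\<exists>F\<subseteq>poly_funs (coords {..<m}). \<forall>s. ramified s \<longleftrightarrow> (\<forall>f\<in>F. f s = 0)"
proof -
  define F where "F = {f. \<exists>c P. fibre_poly c d P \<and> f = (\<lambda>s. resultant (P s) (pderiv (P s)))}"
  have "F \<subseteq> poly_funs (coords {..<m})"
  proof
    fix f assume "f \<in> F"
    then obtain c P where P: "fibre_poly c d P" "f = (\<lambda>s. resultant (P s) (pderiv (P s)))" unfolding F_def by blast
    then have "P \<in> families" "\<And>s. degree (P s) = d" unfolding fibre_poly_def by auto
    then show "f \<in> poly_funs (coords {..<m})"
      unfolding P(2) by (intro poly_families_resultant[where a = d and b = "d - 1"] poly_families_pderiv)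
        (auto simp: degree_pderiv)
  qed
  moreover have "ramified s \<longleftrightarrow> (\<forall>f\<in>F. f s = 0)" for s
  proof
    assume "ramified s"
    show "\<forall>f\<in>F. f s = 0"
    proof (rule ballI, rule ccontr)
      fix f assume "f \<in> F" "f s \<noteq> 0"
      then obtain c P where P: "fibre_poly c d P" "resultant (P s) (pderiv (P s)) \<noteq> 0" unfolding F_def by blast
      then have Ps: "degree (P s) = d" "lead_coeff (P s) = 1" "{x. poly (P s) x = 0} = linear_form c ` fibre s"
        unfolding fibre_poly_def by auto
      then have "P s \<noteq> 0" by auto
      then have "card {x. poly (P s) x = 0} = d"
        using card_roots_if_separable[of "P s"] P(2) Ps(1) by (auto simp: resultant_eq_0_iff_common_root)
      then have "d \<le> card (fibre s)" unfolding Ps(3) using card_image_le[of "fibre s" "linear_form c"] fibre_card_le by simp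
      then show False using \<open>ramified s\<close> fibre_card_le[of s] by (simp add: ramified_def)
    qed
  next
    assume F: "\<forall>f\<in>F. f s = 0"
    show "ramified s"
    proof (rule ccontr)
      assume s: "\<not> ramified s"
      then have "finite (fibre s)" by (simp add: ramified_def)
      then have "infinite (UNIV - {c. \<not> inj_on (linear_form c) (fibre s)})"
        using linear_form_separates[of "fibre s" s] infinite_UNIV_char_0 by (intro Diff_infinite_finite) auto
      then have "UNIV - {c. \<not> inj_on (linear_form c) (fibre s)} \<noteq> {}" by (intro notI) simp
      then obtain c where c: "inj_on (linear_form c) (fibre s)" by auto
      obtain e P where P: "fibre_poly c e P" using fibre_poly_exists by blast
      then have "lead_coeff (P s) = 1" unfolding fibre_poly_def by blast
      then have "P s \<noteq> 0" by auto
      then have "resultant (P s) (pderiv (P s)) \<noteq> 0"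
        using separable_if_card_roots[OF _ fibre_poly_unramified(2)[OF s c P]]
        by (auto simp: resultant_eq_0_iff_common_root)
      moreover have "(\<lambda>s. resultant (P s) (pderiv (P s))) \<in> F"
        using P fibre_poly_unramified(1)[OF s c P] unfolding F_def by blast
      ultimately show False using bspec[OF F, of "\<lambda>s. resultant (P s) (pderiv (P s))"] by simp
    qed
  qed
  ultimately show ?thesis by (intro exI[of _ F] conjI allI)
qed

lemma not_all_ramified: "\<exists>s. \<not> ramified s"
proof -
  obtain \<delta> s where "\<delta> \<in> poly_funs (coords {..<m})" "\<delta> s \<noteq> 0" "\<forall>s. \<delta> s \<noteq> 0 \<longrightarrow> finite (fibre s) \<and> card (fibre s) = d"
    using generic_fibre unfolding fibre_def[symmetric] by (elim bexE conjE exE) (rule that)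
  then have "\<not> ramified s" by (simp add: ramified_def)
  then show ?thesis by (intro exI[of _ s])
qed

text \<open>For all but finitely many \<open>c\<close> the sum of \<open>linear_form c\<close> over the fibre is minus the second
  coefficient of the fibre polynomial, which grows linearly; comparing the powers of \<open>c\<close> gives the
  statement for each coordinate.\<close>

lemma fibre_sum_on_line:
  fixes a b :: "nat \<Rightarrow> complex"
  defines "L \<equiv> \<lambda>t i. a i + t * b i"
  assumes "\<not> ramified (L t0)" "\<not> ramified (L t1)" "\<not> ramified (L t)" and i: "i < n - m"
  shows "(t1 - t0) * (\<Sum>z\<in>fibre (L t). z (m + i)) =
    (t1 - t) * (\<Sum>z\<in>fibre (L t0). z (m + i)) + (t - t0) * (\<Sum>z\<in>fibre (L t1). z (m + i))"
proof -
  define \<tau> where "\<tau> t i = (\<Sum>z\<in>fibre (L t). z (m + i))" for t i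
  \<comment> \<open>Comparing three parameters at a time keeps the set of bad \<open>c\<close>
    finite. Interpolation expresses affinity without naming constants, which would depend on
    \<open>c\<close>.\<close>
  define U where "U = {t0, t1, t}"
  have U: "\<not> ramified (L t)" if "t \<in> U" for t using assms that by (auto simp: U_def)
  define bad where "bad = (\<Union>t\<in>U. {c. \<not> inj_on (linear_form c) (fibre (L t))})"
  have bad: "finite bad" unfolding bad_def using U
    by (intro finite_UN_I linear_form_separates[OF _ order_refl]) (auto simp: U_def ramified_def)
  \<comment> \<open>The coefficients are the defects of the claim for the single coordinates; the
    value at \<open>c\<close> is the defect for \<open>linear_form c\<close>.\<close>
  define D where "D = (\<Sum>i<n - m. monom ((t1 - t0) * \<tau> t i - (t1 - t) * \<tau> t0 i - (t - t0) * \<tau> t1 i) i)"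
  have D0: "poly D c = 0" if c: "c \<notin> bad" for c
  proof -
    obtain e P where P: "fibre_poly c e P" using fibre_poly_exists by blast
    have inj: "inj_on (linear_form c) (fibre (L t))" if "t \<in> U" for t using c that by (auto simp: bad_def)
    have e: "e = d" using fibre_poly_unramified(1)[OF U inj P] by (auto simp: U_def)
    have "P \<in> families" using P by (simp add: fibre_poly_def)
    then obtain A where A: "\<And>t. coeff (P (L t)) (d - 1) = poly A t"
      using poly_funs_line[OF poly_families_coeff, of P "{..<m}" a "d - 1"] unfolding L_def by metis
    obtain B where B: "B \<ge> 0" "\<And>s. norm (coeff (P s) (d - 1)) \<le> B * (1 + (\<Sum>j<m. norm (s j)))"
      using P e unfolding fibre_poly_def by blast
    have "degree A \<le> 1"
    proof (rule degree_le_if_growth)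
      fix t :: complex assume t: "norm t \<ge> 1"
      have "(\<Sum>j<m. norm (a j + t * b j)) \<le> (\<Sum>j<m. (norm (a j) + norm (b j)) * norm t)"
      proof (rule sum_mono)
        fix j
        have "norm (a j) * 1 \<le> norm (a j) * norm t" using t by (intro mult_left_mono) auto
        then show "norm (a j + t * b j) \<le> (norm (a j) + norm (b j)) * norm t"
          using norm_triangle_ineq[of "a j" "t * b j"] by (simp add: norm_mult algebra_simps)
      qed
      then have "1 + (\<Sum>j<m. norm (L t j)) \<le> (1 + (\<Sum>j<m. norm (a j) + norm (b j))) * norm t"
        unfolding L_def using t by (simp add: sum_distrib_right distrib_right)
      then have "B * (1 + (\<Sum>j<m. norm (L t j))) \<le> B * ((1 + (\<Sum>j<m. norm (a j) + norm (b j))) * norm t)"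
        using B(1) by (rule mult_left_mono)
      then show "norm (poly A t) \<le> (B * (1 + (\<Sum>j<m. norm (a j) + norm (b j)))) * norm t ^ 1"
        using B(2)[of "L t"] A[of t] by (simp add: mult.assoc)
    qed
    then have "A = [:coeff A 0, coeff A 1:]"
      by (intro poly_eqI) (auto simp: coeff_pCons coeff_eq_0 split: nat.split)
    then obtain u v where "A = [:u, v:]" by blast
    then have affine: "(t1 - t0) * poly A t = (t1 - t) * poly A t0 + (t - t0) * poly A t1"
      by (simp add: algebra_simps)
    have sum: "(\<Sum>i<n - m. c ^ i * \<tau> t i) = - poly A t" if "t \<in> U" for t
    proof -
      have "(\<Sum>i<n - m. c ^ i * \<tau> t i) = (\<Sum>z\<in>fibre (L t). linear_form c z)"
        unfolding \<tau>_def linear_form_def sum_distrib_left by (rule sum.swap)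
      then show ?thesis using fibre_poly_unramified(3)[OF U inj P, OF that that] A by simp
    qed
    have "poly D c = (t1 - t0) * (\<Sum>i<n - m. c ^ i * \<tau> t i) - (t1 - t) * (\<Sum>i<n - m. c ^ i * \<tau> t0 i)
        - (t - t0) * (\<Sum>i<n - m. c ^ i * \<tau> t1 i)"
      unfolding D_def poly_sum poly_monom sum_distrib_left sum_subtractf[symmetric]
      by (intro sum.cong) (auto simp: algebra_simps)
    also have "\<dots> = 0"
      using affine by (simp add: sum U_def algebra_simps)
    finally show ?thesis .
  qed
  have "D = 0"
  proof (rule ccontr)
    assume "D \<noteq> 0"
    then have "finite (bad \<union> {c. poly D c = 0})" using bad poly_roots_finite by blast
    moreover have "bad \<union> {c. poly D c = 0} = UNIV" using D0 by auto
    ultimately show False using infinite_UNIV_char_0 by metis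
  qed
  then have "coeff D i = 0" by simp
  moreover have "coeff D i = (t1 - t0) * \<tau> t i - (t1 - t) * \<tau> t0 i - (t - t0) * \<tau> t1 i"
    using i by (simp add: D_def coeff_sum)
  ultimately show ?thesis by (simp add: \<tau>_def algebra_simps)
qed

end

section \<open>Generic coordinates\<close>

text \<open>For each \<open>i\<close> from \<open>k\<close> on, the generic equation for form
  \<open>i\<close> over the first \<open>k\<close> forms imposes one nonzero condition;
  \<open>Q\<close> is their product. All coordinates are then finite over the first \<open>k\<close>
  forms, and minimality of \<open>k\<close> makes these independent.\<close>

lemma generic_noether_normalization:
  fixes W :: "(nat \<Rightarrow> complex) set"
  assumes "W \<noteq> {}"
  shows "\<exists>k\<le>n. \<exists>Q\<in>poly_funs (coords ({..<n} \<times> {..n})). (\<exists>g. Q g \<noteq> 0) \<and>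
    (\<forall>r f. (\<forall>i<r. f i \<in> poly_funs (coords {..<n})) \<longrightarrow> alg_independent W r f \<longrightarrow> r \<le> k) \<and>
    (\<forall>g. Q g \<noteq> 0 \<longrightarrow> coords {..<n} \<subseteq> polys_upto (affine_form n g ` {..<n}) 1 \<longrightarrow>
      alg_independent W k (affine_form n g) \<and>
      (\<forall>i\<in>{k..<n}. weighted_integral W (affine_form n g ` {..<k}) (affine_form n g i)))"
proof -
  let ?X = "coords {..<n} :: ((nat \<Rightarrow> complex) \<Rightarrow> complex) set"
  define B where "B k \<longleftrightarrow> (\<exists>Y. finite Y \<and> card Y \<le> k \<and> finite_over W ?X Y)" for k
  define k where "k = (LEAST k. B k)"
  have "card ?X \<le> n" unfolding coords_def using card_image_le[of "{..<n}"] by fastforce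
  then have "B n" unfolding B_def by (intro exI[of _ ?X]) (auto simp: coords_def intro: finite_over_refl)
  then have "k \<le> n" "B k" unfolding k_def by (auto intro: Least_le LeastI)
  then obtain Y where Y: "finite Y" "card Y \<le> k" "finite_over W ?X Y" unfolding B_def by blast
  have minimal: "k \<le> card Z" if "finite Z" "finite_over W ?X Z" for Z
    unfolding k_def using that by (intro Least_le) (auto simp: B_def)
  obtain q g0 where q: "q \<in> poly_funs (coords ({..k} \<times> {..n}))" "q g0 \<noteq> 0"
    "\<forall>g. q g \<noteq> 0 \<longrightarrow> weighted_integral W (affine_form n g ` {1..k}) (affine_form n g 0)"
    using generic_weighted_integral[OF Y(3,1,2) assms] by (elim bexE conjE exE) (rule that)
  \<comment> \<open>Puts form \<open>i\<close> in slot 0 and shifts forms 0 to \<open>k - 1\<close>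
    to slots 1 to \<open>k\<close>.\<close>
  define sel where "sel i g = (\<lambda>(l, j). if l = 0 then g (i, j) else g (l - 1, j))"
    for i :: nat and g :: "nat \<times> nat \<Rightarrow> complex"
  define Q where "Q g = (\<Prod>i\<in>{k..<n}. q (sel i g))" for g
  have q_sel: "(\<lambda>g. q (sel i g)) \<in> poly_funs (coords ({..<n} \<times> {..n}))" if i: "i \<in> {k..<n}" for i
  proof (rule poly_funs_comp[OF q(1)])
    fix x :: "(nat \<times> nat \<Rightarrow> complex) \<Rightarrow> complex" assume "x \<in> coords ({..k} \<times> {..n})"
    then obtain l j where lj: "l \<le> k" "j \<le> n" "x = (\<lambda>s. s (l, j))" by (auto simp: coords_def)
    show "(\<lambda>g. x (sel i g)) \<in> poly_funs (coords ({..<n} \<times> {..n}))"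
      using lj i \<open>k \<le> n\<close> by (cases "l = 0") (auto simp: sel_def intro!: poly_funs_coord)
  qed
  have q_nz: "\<exists>g. q (sel i g) \<noteq> 0" if i: "i \<in> {k..<n}" for i
  proof -
    \<comment> \<open>Row \<open>i\<close> lies outside the first \<open>k\<close> rows, so the
      prescribed rows of \<open>g0\<close> can be placed without conflict.\<close>
    define g where "g = (\<lambda>(a, b). if a = i then g0 (0, b) else g0 (Suc a, b))"
    have "q (sel i g) = q g0"
      by (rule poly_funs_agree[OF q(1)]) (use i in \<open>auto simp: sel_def g_def\<close>)
    then show ?thesis using q(2) by (intro exI[of _ g]) simp
  qed
  have Q_nz: "\<exists>g. Q g \<noteq> 0"
    unfolding Q_def
  proof (rule poly_funs_prod_nonzero)
    show "(\<lambda>g. q (sel i g)) \<in> poly_funs (coords ({..<n} \<times> {..n}))" if "i \<in> {k..<n}" for i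
      using that by (rule q_sel)
  qed (use q_nz in auto)
  have Q: "Q \<in> poly_funs (coords ({..<n} \<times> {..n}))"
    unfolding Q_def[abs_def] by (intro poly_funs_prod q_sel) auto
  have bound: "r \<le> k" if "\<forall>i<r. f i \<in> poly_funs ?X" "alg_independent W r f" for r f
    using finite_over_card_ge[OF Y(3,1) _ that(2)] that(1) Y(2) by fastforce
  have good: "alg_independent W k (affine_form n g) \<and>
      (\<forall>i\<in>{k..<n}. weighted_integral W (affine_form n g ` {..<k}) (affine_form n g i))"
    if g: "Q g \<noteq> 0" "?X \<subseteq> polys_upto (affine_form n g ` {..<n}) 1" for g
  proof
    show wi: "\<forall>i\<in>{k..<n}. weighted_integral W (affine_form n g ` {..<k}) (affine_form n g i)"
    proof
      fix i assume i: "i \<in> {k..<n}"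
      have "q (sel i g) \<noteq> 0" using g(1) i unfolding Q_def by auto
      then have "weighted_integral W (affine_form n (sel i g) ` {1..k}) (affine_form n (sel i g) 0)" using q(3) by blast
      moreover have "affine_form n (sel i g) 0 = affine_form n g i"
        by (simp add: affine_form_def sel_def fun_eq_iff)
      moreover have "affine_form n (sel i g) l = affine_form n g (l - 1)" if "l \<ge> 1" for l
        using that by (simp add: affine_form_def sel_def fun_eq_iff)
      then have "affine_form n (sel i g) ` {1..k} = (\<lambda>l. affine_form n g (l - 1)) ` {1..k}" by auto
      moreover have "(\<lambda>l. affine_form n g (l - 1)) ` {1..k} = affine_form n g ` {..<k}"
        unfolding image_Suc_lessThan[symmetric] image_image by simp
      ultimately show "weighted_integral W (affine_form n g ` {..<k}) (affine_form n g i)" by simp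
    qed
    have "finite_over W (affine_form n g ` {k..<n} \<union> affine_form n g ` {..<k}) (affine_form n g ` {..<k})"
      using wi by (intro finite_over_weighted_integral) auto
    also have "affine_form n g ` {k..<n} \<union> affine_form n g ` {..<k} = affine_form n g ` {..<n}"
      using \<open>k \<le> n\<close> by (auto simp: image_Un[symmetric])
    \<comment> \<open>The second part of \<open>g\<close> expresses invertibility: the old
      coordinates are affine in the new ones.\<close>
    finally have "finite_over W ?X (affine_form n g ` {..<k})" using g(2) by (rule finite_over_generators)
    then show "alg_independent W k (affine_form n g)" using assms minimal by (rule alg_independent_if_minimal)
  qed
  show ?thesis
    using \<open>k \<le> n\<close> Q Q_nz bound good by (intro exI[of _ k] conjI bexI[of _ Q]) auto
qed

definition affine_image :: "nat \<Rightarrow> (nat \<times> nat \<Rightarrow> complex) \<Rightarrow> (nat \<Rightarrow> complex) \<Rightarrow> nat \<Rightarrow> complex" where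
  "affine_image n g s i = (if i < n then affine_form n g i s else 0)"

lemma affine_image_poly:
  assumes "f \<in> poly_funs (coords {..<n})"
  shows "(\<lambda>s. f (affine_image n g s)) \<in> poly_funs (coords {..<n})"
proof (rule poly_funs_comp[OF assms])
  fix x :: "(nat \<Rightarrow> complex) \<Rightarrow> complex" assume "x \<in> coords {..<n}"
  then obtain i where i: "i < n" "x = (\<lambda>s. s i)" by (auto simp: coords_def)
  have "affine_form n g i \<in> poly_funs (coords {..<n})"
    using affine_form_upto by (rule polys_upto_imp_poly_funs)
  then show "(\<lambda>s. x (affine_image n g s)) \<in> poly_funs (coords {..<n})" using i by (simp add: affine_image_def)
qed

text \<open>Conditions are pulled back along the affine map or pushed through its inverse
  \<open>S\<close>. The bound \<open>k\<close> on the size of independent families makes every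
  \<open>l\<close> depend on the first \<open>k\<close> coordinates.\<close>

lemma noether_position_affine_image:
  fixes W :: "(nat \<Rightarrow> complex) set"
  assumes "k \<le> n"
    and irreducible: "\<And>f g. f \<in> poly_funs (coords {..<n}) \<Longrightarrow> g \<in> poly_funs (coords {..<n}) \<Longrightarrow>
      (\<And>s. s \<in> W \<Longrightarrow> f s * g s = 0) \<Longrightarrow> (\<forall>s\<in>W. f s = 0) \<or> (\<forall>s\<in>W. g s = 0)"
    and closed: "\<And>p. closure_point W (\<lambda>s. s) n p \<Longrightarrow> \<exists>s\<in>W. \<forall>i<n. s i = p i"
    and bound: "\<And>r f. (\<And>i. i < r \<Longrightarrow> f i \<in> poly_funs (coords {..<n})) \<Longrightarrow> alg_independent W r f \<Longrightarrow> r \<le> k"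
    and indep: "alg_independent W k (affine_form n g)"
    and integral: "\<And>i. k \<le> i \<Longrightarrow> i < n \<Longrightarrow> weighted_integral W (affine_form n g ` {..<k}) (affine_form n g i)"
    and inverse: "\<And>i. i < n \<Longrightarrow> (\<lambda>s. S s i) \<in> poly_funs (coords {..<n})"
      "\<And>s i. s \<in> W \<Longrightarrow> i < n \<Longrightarrow> S (affine_image n g s) i = s i"
      "\<And>s i. i < n \<Longrightarrow> affine_image n g (S s) i = s i"
  shows "noether_position (affine_image n g ` W) n k"
proof
  show "k \<le> n" by fact
next
  fix f h assume fh: "f \<in> poly_funs (coords {..<n})" "h \<in> poly_funs (coords {..<n})"
    and zero: "\<And>s. s \<in> affine_image n g ` W \<Longrightarrow> f s * h s = 0"
  have "(\<forall>s\<in>W. f (affine_image n g s) = 0) \<or> (\<forall>s\<in>W. h (affine_image n g s) = 0)"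
    by (rule irreducible[OF affine_image_poly[OF fh(1)] affine_image_poly[OF fh(2)]]) (use zero in auto)
  then show "(\<forall>s\<in>affine_image n g ` W. f s = 0) \<or> (\<forall>s\<in>affine_image n g ` W. h s = 0)" by simp
next
  fix p assume p: "closure_point (affine_image n g ` W) (\<lambda>s. s) n p"
  have "closure_point W (\<lambda>s. s) n (S p)"
    unfolding closure_point_def
  proof (intro ballI impI)
    fix G assume G: "G \<in> poly_funs (coords {..<n})" "\<forall>s\<in>W. G s = 0"
    have "(\<lambda>s. G (S s)) \<in> poly_funs (coords {..<n})"
      by (rule poly_funs_comp[OF G(1)]) (use inverse(1) in \<open>auto simp: coords_def\<close>)
    moreover have "G (S (affine_image n g s)) = 0" if "s \<in> W" for s
      using poly_funs_agree[OF G(1), of "S (affine_image n g s)" s] inverse(2)[OF that] G(2) that by simp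
    ultimately show "G (S p) = 0"
      using p[unfolded closure_point_def, THEN bspec[of _ _ "\<lambda>s. G (S s)"]] by simp
  qed
  then obtain s where s: "s \<in> W" "\<forall>i<n. s i = S p i" using closed by blast
  have "affine_image n g s i = p i" if "i < n" for i
  proof -
    have "affine_image n g s i = affine_image n g (S p) i" using s(2) that by (simp add: affine_image_def affine_form_def)
    then show ?thesis using inverse(3) that by simp
  qed
  then show "\<exists>s\<in>affine_image n g ` W. \<forall>i<n. s i = p i" using s(1) by auto
next
  show "alg_independent (affine_image n g ` W) k (\<lambda>i s. s i)"
    unfolding alg_independent_def
  proof (intro ballI impI allI)
    fix G s assume G: "G \<in> poly_funs (coords {..<k})" "\<forall>s\<in>affine_image n g ` W. G (\<lambda>i. s i) = 0"
    have "G (\<lambda>i. affine_form n g i s) = 0" if "s \<in> W" for s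
      using poly_funs_agree[OF G(1), of "\<lambda>i. affine_form n g i s" "affine_image n g s"] G(2) that \<open>k \<le> n\<close>
      by (simp add: affine_image_def)
    then show "G s = 0" using indep G(1) unfolding alg_independent_def by blast
  qed
next
  fix i assume i: "k \<le> i" "i < n"
  have "integral_over W (affine_image n g) k (affine_form n g i)"
    by (rule weighted_integral_imp_integral_over[OF integral[OF i]])
      (use \<open>k \<le> n\<close> in \<open>auto simp: affine_image_def\<close>)
  then show "integral_over (affine_image n g ` W) (\<lambda>s. s) k (\<lambda>s. s i)"
    unfolding integral_over_def using i by (simp add: affine_image_def)
next
  have "\<forall>i\<in>{k..<n}. \<exists>C. C \<ge> 0 \<and> (\<forall>s\<in>W. norm (affine_form n g i s) \<le> C * (1 + (\<Sum>j<k. norm (affine_form n g j s))))"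
  proof
    fix i assume i: "i \<in> {k..<n}"
    then obtain C where C: "C \<ge> 0" "\<forall>s\<in>W. norm (affine_form n g i s) \<le> C * (1 + (\<Sum>y\<in>affine_form n g ` {..<k}. norm (y s)))"
      using weighted_integral_growth[OF integral[of i]] by auto
    have "(\<Sum>y\<in>affine_form n g ` {..<k}. norm (y s)) \<le> (\<Sum>j<k. norm (affine_form n g j s))" for s
      using sum_image_le[of "{..<k}" "\<lambda>y. norm (y s)" "affine_form n g"] by (simp add: o_def)
    then have "C * (1 + (\<Sum>y\<in>affine_form n g ` {..<k}. norm (y s))) \<le> C * (1 + (\<Sum>j<k. norm (affine_form n g j s)))" for s
      using C(1) by (intro mult_left_mono add_left_mono) auto
    then show "\<exists>C. C \<ge> 0 \<and> (\<forall>s\<in>W. norm (affine_form n g i s) \<le> C * (1 + (\<Sum>j<k. norm (affine_form n g j s))))"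
      using C by (intro exI[of _ C]) (meson order_trans)
  qed
  then obtain C where C: "\<And>i. i \<in> {k..<n} \<Longrightarrow> C i \<ge> 0"
    "\<And>i s. i \<in> {k..<n} \<Longrightarrow> s \<in> W \<Longrightarrow> norm (affine_form n g i s) \<le> C i * (1 + (\<Sum>j<k. norm (affine_form n g j s)))"
    unfolding bchoice_iff by blast
  \<comment> \<open>The summand 1 covers the coordinates below \<open>k\<close>, which are bounded
    by the sum itself.\<close>
  define D where "D = 1 + (\<Sum>i\<in>{k..<n}. C i)"
  have D: "D \<ge> 1" unfolding D_def using C(1) by (auto intro: sum_nonneg)
  have "norm (affine_form n g i s) \<le> D * (1 + (\<Sum>j<k. norm (affine_form n g j s)))" if s: "s \<in> W" and i: "i < n" for s i
  proof (cases "i < k")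
    case True
    then have "norm (affine_form n g i s) \<le> (\<Sum>j<k. norm (affine_form n g j s))"
      by (intro member_le_sum) auto
    also have "\<dots> \<le> 1 * (1 + (\<Sum>j<k. norm (affine_form n g j s)))" by simp
    also have "\<dots> \<le> D * (1 + (\<Sum>j<k. norm (affine_form n g j s)))"
      using D by (intro mult_right_mono) (auto simp: sum_nonneg)
    finally show ?thesis .
  next
    case False
    then have "i \<in> {k..<n}" using i by simp
    then have "C i \<le> D" unfolding D_def using C(1) member_le_sum[of i "{k..<n}" C] by force
    then have "C i * (1 + (\<Sum>j<k. norm (affine_form n g j s))) \<le> D * (1 + (\<Sum>j<k. norm (affine_form n g j s)))"
      by (intro mult_right_mono) (auto simp: sum_nonneg)
    then show ?thesis using C(2)[OF \<open>i \<in> {k..<n}\<close> s] by simp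
  qed
  then show "\<exists>C\<ge>0. \<forall>s\<in>affine_image n g ` W. \<forall>i<n. norm (s i) \<le> C * (1 + (\<Sum>j<k. norm (s j)))"
    using D \<open>k \<le> n\<close> by (intro exI[of _ D]) (auto simp: affine_image_def)
next
  fix l assume l: "l \<in> poly_funs (coords {..<n})"
  define f where "f i = (if i < k then affine_form n g i else (\<lambda>s. l (affine_image n g s)))" for i
  have "f i \<in> poly_funs (coords {..<n})" for i
    unfolding f_def using affine_image_poly[OF l] polys_upto_imp_poly_funs[OF affine_form_upto] by simp
  then have "\<not> alg_independent W (Suc k) f" using bound[of "Suc k" f] by auto
  then obtain G s0 where G: "G \<in> poly_funs (coords {..<Suc k})" "\<forall>s\<in>W. G (\<lambda>i. f i s) = 0" "G s0 \<noteq> 0"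
    unfolding alg_independent_def by blast
  have "G ((affine_image n g s)(k := l (affine_image n g s))) = 0" if "s \<in> W" for s
  proof -
    have "((affine_image n g s)(k := l (affine_image n g s))) i = f i s" if "i < Suc k" for i
      using that \<open>k \<le> n\<close> by (cases "i = k") (auto simp: f_def affine_image_def)
    then have "G ((affine_image n g s)(k := l (affine_image n g s))) = G (\<lambda>i. f i s)"
      by (intro poly_funs_agree[OF G(1)]) (simp del: fun_upd_apply)
    then show ?thesis using G(2) that by simp
  qed
  then show "\<exists>G\<in>poly_funs (coords {..<Suc k}). (\<exists>s. G s \<noteq> 0) \<and> (\<forall>s\<in>affine_image n g ` W. G (s(k := l s)) = 0)"
    using G(1,3) by (intro bexI[of _ G]) auto
qed

text \<open>By independence every point lies in the closure of the projection, and lying over makes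
  it an actual image. This will exclude \<open>k > m\<close>.\<close>

lemma (in noether_position) projection_surjective: "\<exists>s\<in>V. \<forall>i<m. s i = p i"
proof -
  have "closure_point V (\<lambda>s. s) m p"
    unfolding closure_point_def using zero_if_zero_on_V by blast
  then obtain p' where p': "\<forall>i<m. p' i = p i" "closure_point V (\<lambda>s. s) n p'"
    using lying_over[of V "\<lambda>s. s" m p n] m_le integral by blast
  then obtain s where "s \<in> V" "\<forall>i<n. s i = p' i" using closed by blast
  then show ?thesis using p'(1) m_le by (intro bexI[of _ s]) auto
qed

section \<open>Vectors and affine maps\<close>

lemma irreducible_variety_mult:
  assumes "irreducible_variety n V" "f \<in> poly_funs (vec_coords n)" "g \<in> poly_funs (vec_coords n)"
    and "\<And>z. z \<in> V \<Longrightarrow> f z * g z = 0"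
  shows "(\<forall>z\<in>V. f z = 0) \<or> (\<forall>z\<in>V. g z = 0)"
proof -
  obtain F where F: "F \<subseteq> poly_funs (vec_coords n)" "V = {z \<in> carrier_vec n. \<forall>f\<in>F. f z = 0}"
    using assms(1) unfolding irreducible_variety_def zariski_closed_def by auto
  have closed: "zariski_closed (carrier_vec n) (vec_coords n) {z \<in> V. h z = 0}" if "h \<in> poly_funs (vec_coords n)" for h
    unfolding zariski_closed_def using F that by (intro exI[of _ "insert h F"]) auto
  have "V = {z \<in> V. f z = 0} \<union> {z \<in> V. g z = 0}" using assms(4) by auto
  then have "V = {z \<in> V. f z = 0} \<or> V = {z \<in> V. g z = 0}"
    using assms(1) closed[OF assms(2)] closed[OF assms(3)] unfolding irreducible_variety_def by blast
  then show ?thesis by auto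
qed

lemma irreducible_variety_carrier: "irreducible_variety n V \<Longrightarrow> V \<subseteq> carrier_vec n"
  unfolding irreducible_variety_def zariski_closed_def by auto

lemma irreducible_variety_separate:
  assumes "irreducible_variety n Z" "z \<in> carrier_vec n" "z \<notin> Z"
  shows "\<exists>h\<in>poly_funs (vec_coords n). (\<forall>w\<in>Z. h w = 0) \<and> h z \<noteq> 0"
proof -
  obtain F where F: "F \<subseteq> poly_funs (vec_coords n)" "Z = {z \<in> carrier_vec n. \<forall>f\<in>F. f z = 0}"
    using assms(1) unfolding irreducible_variety_def zariski_closed_def by auto
  then have "\<exists>h\<in>F. h z \<noteq> 0" using assms(2,3) by simp
  then obtain h where "h \<in> F" "h z \<noteq> 0" by (elim bexE) (rule that)
  then show ?thesis using F by (intro bexI[of _ h]) auto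
qed

text \<open>The constant term in \<open>h\<close> of a relation restricts to a relation on \<open>Z\<close>, hence vanishes; dividing by
  \<open>h\<close> gives a relation of lower degree on \<open>Z'\<close>.\<close>

lemma alg_independent_extend:
  assumes Z': "irreducible_variety n Z'" and f: "\<And>i. i < k \<Longrightarrow> f i \<in> poly_funs (vec_coords n)"
    and indep: "alg_independent Z k f" and "Z \<subseteq> Z'"
    and h: "h \<in> poly_funs (vec_coords n)" "\<And>w. w \<in> Z \<Longrightarrow> h w = 0" "z0 \<in> Z'" "h z0 \<noteq> 0"
  shows "alg_independent Z' (Suc k) (f(k := h))"
proof -
  have *: "p s = 0"
    if "p \<in> poly_families (coords {..<k})" "\<forall>s j. j \<ge> N \<longrightarrow> coeff (p s) j = 0"
      "\<forall>z\<in>Z'. poly (p (\<lambda>i. f i z)) (h z) = 0" for p s N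
    using that
  proof (induction N arbitrary: p s)
    case 0
    then show ?case by (intro poly_eqI) simp
  next
    case (Suc N)
    have "coeff (p s) 0 = 0" for s
    proof -
      have "coeff (p (\<lambda>i. f i z)) 0 = 0" if "z \<in> Z" for z
        using Suc.prems(3) h(2)[OF that] that \<open>Z \<subseteq> Z'\<close> by (force simp: poly_0_coeff_0)
      then show ?thesis
        using indep[unfolded alg_independent_def, THEN bspec, OF poly_families_coeff[OF Suc.prems(1), of 0]] by blast
    qed
    moreover define q where "q s = poly_shift 1 (p s)" for s
    ultimately have pq: "p s = pCons 0 (q s)" for s
      by (intro poly_eqI) (simp add: coeff_pCons coeff_poly_shift split: nat.split)
    obtain M where M: "\<And>s. degree (p s) \<le> M" using poly_families_bound[OF Suc.prems(1)] by blast
    have "degree (q s) \<le> M" for s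
      by (rule degree_le) (use le_less_trans[OF M] in \<open>auto simp: q_def coeff_poly_shift intro!: coeff_eq_0\<close>)
    moreover have "(\<lambda>s. coeff (q s) j) \<in> poly_funs (coords {..<k})" for j
      using poly_families_coeff[OF Suc.prems(1), of "j + 1"] by (simp add: q_def coeff_poly_shift)
    ultimately have q: "q \<in> poly_families (coords {..<k})" unfolding poly_families_def by auto
    have "(\<lambda>z. q (\<lambda>i. f i z)) \<in> poly_families (vec_coords n)"
      by (rule poly_families_comp[OF q]) (use f in \<open>auto simp: coords_def\<close>)
    then have "(\<lambda>z. poly (q (\<lambda>i. f i z)) (h z)) \<in> poly_funs (vec_coords n)"
      using h(1) by (rule poly_families_eval)
    moreover have "h z * poly (q (\<lambda>i. f i z)) (h z) = 0" if "z \<in> Z'" for z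
      using Suc.prems(3) that by (simp add: pq)
    ultimately have "(\<forall>z\<in>Z'. h z = 0) \<or> (\<forall>z\<in>Z'. poly (q (\<lambda>i. f i z)) (h z) = 0)"
      by (intro irreducible_variety_mult[OF Z' h(1)])
    then have "\<forall>z\<in>Z'. poly (q (\<lambda>i. f i z)) (h z) = 0" using h(3,4) by blast
    moreover have "\<forall>s j. j \<ge> N \<longrightarrow> coeff (q s) j = 0" using Suc.prems(2) by (simp add: q_def coeff_poly_shift)
    ultimately have "q s = 0" using Suc.IH[OF q] by blast
    then show ?case by (simp add: pq)
  qed
  show ?thesis
    unfolding alg_independent_def
  proof (intro ballI impI allI)
    fix G s assume G: "G \<in> poly_funs (coords {..<Suc k})" "\<forall>z\<in>Z'. G (\<lambda>i. (f(k := h)) i z) = 0"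
    obtain p where p: "p \<in> poly_families (coords {..<k})" "\<And>s t. G (s(k := t)) = poly (p s) t"
      using poly_funs_split_last[OF G(1)] by blast
    obtain M where M: "\<And>s. degree (p s) \<le> M" using poly_families_bound[OF p(1)] by blast
    have "p t = 0" for t
    proof (rule *[OF p(1), of "Suc M"])
      show "\<forall>s j. j \<ge> Suc M \<longrightarrow> coeff (p s) j = 0" using M by (auto intro!: coeff_eq_0 intro: le_less_trans[OF M] simp: Suc_le_eq)
      have "(\<lambda>i. (f(k := h)) i z) = (\<lambda>i. f i z)(k := h z)" for z by auto
      then show "\<forall>z\<in>Z'. poly (p (\<lambda>i. f i z)) (h z) = 0" using G(2) p(2) by simp
    qed
    then have "poly (p s) (s k) = 0" by simp
    then show "G s = 0" unfolding p(2)[symmetric] by (simp only: fun_upd_triv)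
  qed
qed

text \<open>Each proper inclusion supplies a function vanishing on the smaller variety but not on
  the larger one, hence one more independent function.\<close>

lemma chain_alg_independent:
  assumes "\<forall>i\<le>k. irreducible_variety n (Z i)" "\<forall>i<k. Z i \<subset> Z (Suc i)"
  shows "\<exists>f. (\<forall>i<k. f i \<in> poly_funs (vec_coords n)) \<and> alg_independent (Z k) k f"
  using assms
proof (induction k)
  case 0
  then obtain z where z: "z \<in> Z 0" unfolding irreducible_variety_def by auto
  have "alg_independent (Z 0) 0 (\<lambda>_ _. 0)"
    unfolding alg_independent_def
  proof (intro ballI impI allI)
    fix G and s :: "nat \<Rightarrow> complex"
    assume G: "G \<in> poly_funs (coords {..<0::nat})" "\<forall>z\<in>Z 0. G (\<lambda>i. 0) = 0"
    then show "G s = 0" using poly_funs_agree[OF G(1), of s "\<lambda>i. 0"] z by auto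
  qed
  then show ?case by auto
next
  case (Suc k)
  then obtain f where f: "\<forall>i<k. f i \<in> poly_funs (vec_coords n)" "alg_independent (Z k) k f" by auto
  have Z: "irreducible_variety n (Z k)" "irreducible_variety n (Z (Suc k))" "Z k \<subset> Z (Suc k)"
    using Suc.prems by auto
  then obtain z0 where z0: "z0 \<in> Z (Suc k)" "z0 \<notin> Z k" by auto
  then obtain h where h: "h \<in> poly_funs (vec_coords n)" "\<forall>w\<in>Z k. h w = 0" "h z0 \<noteq> 0"
    using irreducible_variety_separate[OF Z(1)] irreducible_variety_carrier[OF Z(2)] by blast
  have "alg_independent (Z (Suc k)) (Suc k) (f(k := h))"
    using f h z0 Z by (intro alg_independent_extend[of n _ k f "Z k" h z0]) auto
  moreover have "\<forall>i<Suc k. (f(k := h)) i \<in> poly_funs (vec_coords n)" using f h by (auto simp: less_Suc_eq)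
  ultimately show ?case by (intro exI[of _ "f(k := h)"] conjI)
qed

text \<open>If all chains were shorter, the supremum would be at most \<open>m - 1\<close>, which is
  smaller because \<open>m > 0\<close>.\<close>

lemma variety_dim_chain:
  assumes "variety_dim n V = enat m" "m > 0"
  shows "\<exists>k\<ge>m. \<exists>Z :: nat \<Rightarrow> complex vec set.
    (\<forall>i\<le>k. irreducible_variety n (Z i) \<and> Z i \<subseteq> V) \<and> (\<forall>i<k. Z i \<subset> Z (Suc i))"
proof (rule ccontr)
  assume *: "\<not> ?thesis"
  have "variety_dim n V \<le> enat (m - 1)"
    unfolding variety_dim_def
  proof (rule Sup_least, clarify)
    fix k and Z :: "nat \<Rightarrow> complex vec set"
    assume "\<forall>i\<le>k. irreducible_variety n (Z i) \<and> Z i \<subseteq> V" "\<forall>i<k. Z i \<subset> Z (Suc i)"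
    then have "\<not> k \<ge> m" using * by blast
    then show "enat k \<le> enat (m - 1)" by simp
  qed
  then show False using assms by simp
qed

definition point :: "nat \<Rightarrow> complex vec \<Rightarrow> nat \<Rightarrow> complex" where
  "point n z i = (if i < n then z $ i else 0)"

lemma vec_point: "z \<in> carrier_vec n \<Longrightarrow> vec n (point n z) = z"
  by (auto simp: point_def)

lemma poly_funs_point: "f \<in> poly_funs (coords {..<n}) \<Longrightarrow> (\<lambda>z. f (point n z)) \<in> poly_funs (vec_coords n)"
  by (erule poly_funs_comp) (auto simp: coords_def vec_coords_def point_def intro!: poly_funs.coord)

lemma poly_funs_vec:
  assumes "f \<in> poly_funs (vec_coords n)"
  shows "(\<lambda>s. f (vec n s)) \<in> poly_funs (coords {..<n})"
  by (rule poly_funs_comp[OF assms]) (auto simp: vec_coords_def intro!: poly_funs_coord)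

lemma irreducible_variety_point_mult:
  assumes "irreducible_variety n V" "f \<in> poly_funs (coords {..<n})" "g \<in> poly_funs (coords {..<n})"
    and "\<And>s. s \<in> point n ` V \<Longrightarrow> f s * g s = 0"
  shows "(\<forall>s\<in>point n ` V. f s = 0) \<or> (\<forall>s\<in>point n ` V. g s = 0)"
proof -
  have "(\<forall>z\<in>V. f (point n z) = 0) \<or> (\<forall>z\<in>V. g (point n z) = 0)"
    by (rule irreducible_variety_mult[OF assms(1) poly_funs_point[OF assms(2)] poly_funs_point[OF assms(3)]])
      (use assms(4) in auto)
  then show ?thesis by simp
qed

lemma irreducible_variety_closure_point:
  assumes V: "irreducible_variety n V" and p: "closure_point (point n ` V) (\<lambda>s. s) n p"
  shows "\<exists>s\<in>point n ` V. \<forall>i<n. s i = p i"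
proof -
  have "vec n p \<in> V"
  proof (rule ccontr)
    assume "vec n p \<notin> V"
    then obtain h where h: "h \<in> poly_funs (vec_coords n)" "\<forall>w\<in>V. h w = 0" "h (vec n p) \<noteq> 0"
      using irreducible_variety_separate[OF V, of "vec n p"] by auto
    have "h (vec n s) = 0" if "s \<in> point n ` V" for s
      using that h(2) vec_point irreducible_variety_carrier[OF V] by auto
    then show False
      using p[unfolded closure_point_def, THEN bspec, OF poly_funs_vec[OF h(1)]] h(3) by simp
  qed
  then show ?thesis by (intro bexI[of _ "point n (vec n p)"]) (auto simp: point_def)
qed

section \<open>Coordinates on the space of affine maps\<close>

lemma affine_coords_fst: "i < r \<Longrightarrow> j < c \<Longrightarrow> (\<lambda>g. fst g $$ (i, j)) \<in> poly_funs (affine_coords r c)"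
  unfolding affine_coords_def case_prod_unfold
  by (intro poly_funs.coord UnI1 CollectI exI[of _ i] exI[of _ j] conjI refl)

lemma affine_coords_snd: "i < r \<Longrightarrow> (\<lambda>g. snd g $ i) \<in> poly_funs (affine_coords r c)"
  unfolding affine_coords_def case_prod_unfold
  by (intro poly_funs.coord UnI2 CollectI exI[of _ i] conjI refl)

lemma affine_coords_cases:
  assumes "x \<in> affine_coords r c"
  obtains i j where "i < r" "j < c" "x = (\<lambda>g. fst g $$ (i, j))" | i where "i < r" "x = (\<lambda>g. snd g $ i)"
proof -
  from assms consider i j where "x = (\<lambda>g. fst g $$ (i, j)) \<and> i < r \<and> j < c" | i where "x = (\<lambda>g. snd g $ i) \<and> i < r"
    unfolding affine_coords_def case_prod_unfold Un_iff mem_Collect_eq by (elim disjE exE) (rule that, assumption)+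
  then show thesis by cases (use that in auto)
qed

text \<open>Irreducibility of the space of affine maps, transported from functions on pairs with the
  translation part in column \<open>c\<close>.\<close>

lemma affine_common_nonzero:
  assumes F: "F \<in> poly_funs (affine_coords r c)" "G \<in> poly_funs (affine_coords r c)"
    and g: "g1 \<in> affine_maps r c" "g2 \<in> affine_maps r c" "F g1 \<noteq> 0" "G g2 \<noteq> 0"
  shows "\<exists>g\<in>affine_maps r c. F g \<noteq> 0 \<and> G g \<noteq> 0"
proof -
  define D where "D s = (mat r c (\<lambda>(i, j). s (i, j)), vec r (\<lambda>i. s (i, c)))" for s :: "nat \<times> nat \<Rightarrow> complex"
  define E where "E g = (\<lambda>(i, j). if j < c then fst g $$ (i, j) else snd g $ i)" for g :: "complex mat \<times> complex vec"
  have DE: "D (E g) = g" if "g \<in> affine_maps r c" for g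
    using that by (cases g) (auto simp: D_def E_def affine_maps_def)
  have D: "(\<lambda>s. H (D s)) \<in> poly_funs (coords UNIV)" if "H \<in> poly_funs (affine_coords r c)" for H
  proof (rule poly_funs_comp[OF that])
    fix x assume "x \<in> affine_coords r c"
    then show "(\<lambda>s. x (D s)) \<in> poly_funs (coords UNIV)"
      by (cases rule: affine_coords_cases) (auto simp: D_def intro!: poly_funs_coord)
  qed
  have "\<exists>s. F (D s) \<noteq> 0 \<and> G (D s) \<noteq> 0"
    using g DE by (intro poly_funs_common_nonzero[of "\<lambda>s. F (D s)" UNIV "\<lambda>s. G (D s)" "E g1" "E g2"] D F) auto
  then obtain s where "F (D s) \<noteq> 0" "G (D s) \<noteq> 0" by (elim exE conjE) (rule that)
  then show ?thesis by (intro bexI[of _ "D s"]) (auto simp: D_def affine_maps_def)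
qed

lemma zariski_open_witness:
  assumes "zariski_open S X U" "U \<noteq> {}"
  shows "\<exists>f\<in>poly_funs X. \<exists>p\<in>S. f p \<noteq> 0 \<and> {p \<in> S. f p \<noteq> 0} \<subseteq> U"
proof -
  obtain F where F: "F \<subseteq> poly_funs X" "S - U = {p \<in> S. \<forall>f\<in>F. f p = 0}" "U \<subseteq> S"
    using assms(1) unfolding zariski_open_def zariski_closed_def by auto
  obtain p where p: "p \<in> U" using assms(2) by auto
  then have "p \<notin> {p \<in> S. \<forall>f\<in>F. f p = 0}" using F(2) by blast
  then have "\<exists>f\<in>F. f p \<noteq> 0" using p F(3) by auto
  then obtain f where f: "f \<in> F" "f p \<noteq> 0" by (elim bexE) (rule that)
  have "{p \<in> S. f p \<noteq> 0} \<subseteq> U"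
  proof
    fix q assume q: "q \<in> {p \<in> S. f p \<noteq> 0}"
    then have "q \<notin> {p \<in> S. \<forall>f\<in>F. f p = 0}" using f(1) by auto
    then show "q \<in> U" using F(2) q by blast
  qed
  then show ?thesis using F f p by (intro bexI[of _ f] bexI[of _ p]) auto
qed

lemma affine_apply_index:
  assumes "g \<in> affine_maps r c" "z \<in> carrier_vec c" "i < r"
  shows "affine_apply g z $ i = (\<Sum>j<c. fst g $$ (i, j) * z $ j) + snd g $ i"
proof -
  have "fst g \<in> carrier_mat r c" "snd g \<in> carrier_vec r" using assms(1) by (auto simp: affine_maps_def)
  then show ?thesis using assms(2,3) by (auto simp: affine_apply_def scalar_prod_def atLeast0LessThan)
qed

lemma affine_apply_carrier: "g \<in> affine_maps r c \<Longrightarrow> affine_apply g z \<in> carrier_vec r"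
  by (rule carrier_vecI) (auto simp: affine_maps_def affine_apply_def)

text \<open>The coordinates \<open>y\<close>, which come last in a vector \<open>(x, y)\<close>, are moved to the front:
  \<open>vec_pos\<close> and \<open>point_pos\<close> translate between the two orders.\<close>

definition vec_pos :: "nat \<Rightarrow> nat \<Rightarrow> nat \<Rightarrow> nat" where
  "vec_pos n m i = (if i < m then n - m + i else i - m)"

definition point_pos :: "nat \<Rightarrow> nat \<Rightarrow> nat \<Rightarrow> nat" where
  "point_pos n m r = (if r < n - m then m + r else r - (n - m))"

lemma vec_pos: "m \<le> n \<Longrightarrow> i < n \<Longrightarrow> vec_pos n m i < n \<and> point_pos n m (vec_pos n m i) = i"
  unfolding vec_pos_def point_pos_def by (cases "i < m") (simp; arith)+

lemma point_pos: "m \<le> n \<Longrightarrow> r < n \<Longrightarrow> point_pos n m r < n \<and> vec_pos n m (point_pos n m r) = r"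
  unfolding vec_pos_def point_pos_def by (cases "r < n - m") (simp; arith)+

definition swapped_point :: "nat \<Rightarrow> nat \<Rightarrow> complex vec \<Rightarrow> nat \<Rightarrow> complex" where
  "swapped_point n m z i = (if i < n then z $ vec_pos n m i else 0)"

definition swapped_param :: "nat \<Rightarrow> nat \<Rightarrow> complex mat \<times> complex vec \<Rightarrow> nat \<times> nat \<Rightarrow> complex" where
  "swapped_param n m g = (\<lambda>(i, j). if j < n then fst g $$ (vec_pos n m i, j) else snd g $ vec_pos n m i)"

lemma affine_form_swapped_param:
  assumes "g \<in> affine_maps n n" "m \<le> n" "i < n"
  shows "affine_form n (swapped_param n m g) i s = affine_apply g (vec n s) $ vec_pos n m i"
proof -
  have "vec_pos n m i < n" using vec_pos[OF assms(2,3)] by blast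
  then have "affine_apply g (vec n s) $ vec_pos n m i
      = (\<Sum>j<n. fst g $$ (vec_pos n m i, j) * vec n s $ j) + snd g $ vec_pos n m i"
    by (intro affine_apply_index[OF assms(1)]) simp_all
  also have "\<dots> = (\<Sum>j<n. fst g $$ (vec_pos n m i, j) * s j) + snd g $ vec_pos n m i"
    by (intro arg_cong2[of _ _ _ _ "(+)"] sum.cong refl) simp
  finally show ?thesis by (simp add: affine_form_def swapped_param_def)
qed

lemma affine_image_point:
  assumes "g \<in> affine_maps n n" "m \<le> n" "z \<in> carrier_vec n"
  shows "affine_image n (swapped_param n m g) (point n z) = swapped_point n m (affine_apply g z)"
proof
  fix i
  show "affine_image n (swapped_param n m g) (point n z) i = swapped_point n m (affine_apply g z) i"
  proof (cases "i < n")
    case True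
    then show ?thesis
      unfolding affine_image_def swapped_point_def affine_form_swapped_param[OF assms(1,2) True] vec_point[OF assms(3)]
      by simp
  qed (simp add: affine_image_def swapped_point_def)
qed

lemma inj_on_swapped_point:
  assumes "m \<le> n"
  shows "inj_on (swapped_point n m) (carrier_vec n)"
proof (rule inj_onI)
  fix v w assume vw: "v \<in> carrier_vec n" "w \<in> carrier_vec n" "swapped_point n m v = swapped_point n m w"
  have "v $ r = w $ r" if "r < n" for r
    using fun_cong[OF vw(3), of "point_pos n m r"] point_pos[OF assms that] by (simp add: swapped_point_def)
  then show "v = w" using vw by auto
qed

lemma affine_group_inverse:
  assumes "g \<in> affine_group n"
  shows "\<exists>B\<in>carrier_mat n n. fst g * B = 1\<^sub>m n \<and> B * fst g = 1\<^sub>m n"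
proof -
  have A: "fst g \<in> carrier_mat n n" "invertible_mat (fst g)"
    using assms by (auto simp: affine_group_def affine_maps_def)
  then obtain B where B: "fst g * B = 1\<^sub>m n" "B * fst g = 1\<^sub>m (dim_row B)"
    unfolding invertible_mat_def inverts_mat_def by auto
  have "dim_row B = n" using arg_cong[OF B(2), of dim_col] A(1) by simp
  moreover have "dim_col B = n" using arg_cong[OF B(1), of dim_col] by simp
  ultimately show ?thesis using B by (intro bexI[of _ B]) auto
qed

lemma affine_group_if_det:
  assumes "g \<in> affine_maps n n" "det (fst g) \<noteq> 0"
  shows "g \<in> affine_group n"
proof -
  have A: "fst g \<in> carrier_mat n n" using assms(1) by (auto simp: affine_maps_def)
  then have "fst g \<in> Units (ring_mat TYPE(complex) n undefined)"
    using assms(2) by (intro det_non_zero_imp_unit)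
  then obtain B where "B \<in> carrier_mat n n" "B * fst g = 1\<^sub>m n" "fst g * B = 1\<^sub>m n"
    unfolding Units_def ring_mat_def by auto
  then have "invertible_mat (fst g)" unfolding invertible_mat_def inverts_mat_def using A by auto
  then show ?thesis using assms(1) by (auto simp: affine_group_def)
qed

lemma affine_apply_inj_on:
  assumes "g \<in> affine_group n"
  shows "inj_on (affine_apply g) (carrier_vec n)"
proof (rule inj_onI)
  fix v w assume vw: "v \<in> carrier_vec n" "w \<in> carrier_vec n" "affine_apply g v = affine_apply g w"
  obtain B where B: "B \<in> carrier_mat n n" "B * fst g = 1\<^sub>m n" using affine_group_inverse[OF assms] by blast
  have g: "fst g \<in> carrier_mat n n" "snd g \<in> carrier_vec n"
    using assms by (auto simp: affine_group_def affine_maps_def)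
  have eq: "B *\<^sub>v (affine_apply g z - snd g) = z" if "z \<in> carrier_vec n" for z
  proof -
    have "affine_apply g z - snd g = fst g *\<^sub>v z" using g that by (auto simp: affine_apply_def)
    then have "B *\<^sub>v (affine_apply g z - snd g) = (B * fst g) *\<^sub>v z"
      using assoc_mult_mat_vec[OF B(1) g(1) that] by simp
    then show ?thesis using B(2) that by simp
  qed
  have "B *\<^sub>v (affine_apply g v - snd g) = B *\<^sub>v (affine_apply g w - snd g)" by (simp only: vw(3))
  then show "v = w" by (simp only: eq vw(1,2))
qed

lemma swapped_param_inverse:
  assumes g: "g \<in> affine_group n" and m: "m \<le> n"
  shows "\<exists>S. (\<forall>i<n. (\<lambda>s. S s i) \<in> poly_funs (coords {..<n})) \<and>
      (\<forall>i<n. \<forall>s. S (affine_image n (swapped_param n m g) s) i = s i) \<and>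
      (\<forall>i<n. \<forall>s. affine_image n (swapped_param n m g) (S s) i = s i) \<and>
      coords {..<n} \<subseteq> polys_upto (affine_form n (swapped_param n m g) ` {..<n}) 1"
proof -
  let ?p = "swapped_param n m g"
  obtain B where B: "B \<in> carrier_mat n n" "fst g * B = 1\<^sub>m n" "B * fst g = 1\<^sub>m n"
    using affine_group_inverse[OF g] by blast
  have gm: "g \<in> affine_maps n n" using g by (auto simp: affine_group_def)
  then have A: "fst g \<in> carrier_mat n n" "snd g \<in> carrier_vec n" by (auto simp: affine_maps_def)
  \<comment> \<open>The inverse map: restore the order of the coordinates, subtract the translation,
    apply \<open>B\<close>.\<close>
  define S where "S s j = (\<Sum>r<n. B $$ (j, r) * (s (point_pos n m r) + - snd g $ r))" for s :: "nat \<Rightarrow> complex" and j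
  have S_vec: "vec n (S s) = B *\<^sub>v (vec n (\<lambda>r. s (point_pos n m r)) - snd g)" for s
    using B(1) A(2) by (intro eq_vecI) (auto simp: S_def scalar_prod_def atLeast0LessThan)
  have "(\<lambda>s. S s i) \<in> poly_funs (coords {..<n})" if "i < n" for i
    unfolding S_def using point_pos[OF m]
    by (intro poly_funs_sum poly_funs.mult poly_funs.add poly_funs.const poly_funs_coord) auto
  moreover have left: "S (affine_image n ?p s) i = s i" if i: "i < n" for i s
  proof -
    have "vec n (\<lambda>r. affine_image n ?p s (point_pos n m r)) = affine_apply g (vec n s)"
      using point_pos[OF m] affine_apply_carrier[OF gm, of "vec n s"] m gm
      by (intro eq_vecI) (auto simp: affine_image_def affine_form_swapped_param)
    then have "vec n (S (affine_image n ?p s)) = B *\<^sub>v (affine_apply g (vec n s) - snd g)" by (simp add: S_vec)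
    also have "affine_apply g (vec n s) - snd g = fst g *\<^sub>v vec n s"
      using A by (auto simp: affine_apply_def)
    also have "B *\<^sub>v (fst g *\<^sub>v vec n s) = (B * fst g) *\<^sub>v vec n s"
      using assoc_mult_mat_vec[OF B(1) A(1)] by simp
    also have "\<dots> = vec n s" using B(3) by simp
    finally have "vec n (S (affine_image n ?p s)) $ i = vec n s $ i" by simp
    then show ?thesis using i by simp
  qed
  moreover have "affine_image n ?p (S s) i = s i" if i: "i < n" for i s
  proof -
    let ?w = "vec n (\<lambda>r. s (point_pos n m r))"
    have "fst g *\<^sub>v (B *\<^sub>v (?w - snd g)) = (fst g * B) *\<^sub>v (?w - snd g)"
      using assoc_mult_mat_vec[OF A(1) B(1)] A(2) by simp
    then have "affine_apply g (vec n (S s)) = ?w"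
      unfolding affine_apply_def S_vec using B(2) A(2) by auto
    then show ?thesis
      using i m gm vec_pos[OF m i] by (simp add: affine_image_def affine_form_swapped_param)
  qed
  moreover have "coords {..<n} \<subseteq> polys_upto (affine_form n ?p ` {..<n}) 1"
  proof
    fix x :: "(nat \<Rightarrow> complex) \<Rightarrow> complex" assume "x \<in> coords {..<n}"
    then obtain i where i: "i < n" "x = (\<lambda>s. s i)" by (auto simp: coords_def)
    have "x = (\<lambda>s. \<Sum>r<n. B $$ (i, r) * (affine_form n ?p (point_pos n m r) s + - snd g $ r))"
    proof
      fix s
      have "x s = S (affine_image n ?p s) i" using left i by simp
      also have "\<dots> = (\<Sum>r<n. B $$ (i, r) * (affine_form n ?p (point_pos n m r) s + - snd g $ r))"
        unfolding S_def using point_pos[OF m] by (intro sum.cong) (auto simp: affine_image_def)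
      finally show "x s = (\<Sum>r<n. B $$ (i, r) * (affine_form n ?p (point_pos n m r) s + - snd g $ r))" .
    qed
    also have "\<dots> \<in> polys_upto (affine_form n ?p ` {..<n}) 1"
      using point_pos[OF m]
      by (intro polys_upto_sum polys_upto_scale polys_upto_add polys_upto_const polys_upto_coord imageI) auto
    finally show "x \<in> polys_upto (affine_form n ?p ` {..<n}) 1" .
  qed
  ultimately show ?thesis by (intro exI[of _ S]) auto
qed

text \<open>These rows compute \<open>y\<close> after the change of coordinates, so the zero set of
  this map on \<open>V0\<close> is the fibre over the origin, a section of the kind that
  \<open>has_degree\<close> counts.\<close>

definition last_rows :: "nat \<Rightarrow> nat \<Rightarrow> complex mat \<times> complex vec \<Rightarrow> complex mat \<times> complex vec" where
  "last_rows n m g = (mat m n (\<lambda>(i, j). fst g $$ (n - m + i, j)), vec m (\<lambda>i. snd g $ (n - m + i)))"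

lemma last_rows_maps: "last_rows n m g \<in> affine_maps m n"
  by (simp add: last_rows_def affine_maps_def)

lemma affine_apply_last_rows:
  assumes "g \<in> affine_maps n n" "m \<le> n" "z \<in> carrier_vec n" "i < m"
  shows "affine_apply (last_rows n m g) z $ i = affine_apply g z $ (n - m + i)"
proof -
  have "affine_apply (last_rows n m g) z $ i = (\<Sum>j<n. fst g $$ (n - m + i, j) * z $ j) + snd g $ (n - m + i)"
    unfolding affine_apply_index[OF last_rows_maps assms(3,4)] using assms(4) by (simp add: last_rows_def)
  then show ?thesis using affine_apply_index[OF assms(1,3), of "n - m + i"] assms(2,4) by simp
qed

section \<open>The fibre sums\<close>

lemma fiber_swapped_point:
  assumes "m \<le> n" "V \<subseteq> carrier_vec n" "y \<in> carrier_vec m"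
  shows "{z \<in> swapped_point n m ` V. \<forall>i<m. z i = y $ i} = swapped_point n m ` fiber m V y"
proof -
  have "(\<forall>i<m. swapped_point n m v i = y $ i) \<longleftrightarrow> vec_last v m = y" if "v \<in> V" for v
  proof -
    have v: "dim_vec v = n" using that assms(2) by auto
    have "(\<forall>i<m. swapped_point n m v i = y $ i) \<longleftrightarrow> (\<forall>i<m. vec_last v m $ i = y $ i)"
      using assms(1) v by (auto simp: swapped_point_def vec_pos_def vec_last_def)
    also have "\<dots> \<longleftrightarrow> vec_last v m = y" using assms(3) by auto
    finally show ?thesis .
  qed
  then show ?thesis by (auto simp: fiber_def)
qed

lemma line_point_carrier: "(a, b) \<in> line_params m \<Longrightarrow> line_point a b t \<in> carrier_vec m"
  by (auto simp: line_params_def line_point_def)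

text \<open>For fixed \<open>t\<close> the equations of \<open>\<Delta>\<close> at
  \<open>line_point a b t\<close> are polynomial in \<open>(a, b)\<close>, and containment is their
  conjunction over all \<open>t\<close>. Containment depends on the line alone, so it passes to the
  quotient.\<close>

lemma zariski_open_lines_not_contained:
  assumes "zariski_closed (carrier_vec m) (vec_coords m) \<Delta>"
  shows "zariski_open_lines m {affine_line a b | a b. (a, b) \<in> line_params m \<and> \<not> affine_line a b \<subseteq> \<Delta>}"
proof -
  define W where "W = {affine_line a b | a b. (a, b) \<in> line_params m \<and> \<not> affine_line a b \<subseteq> \<Delta>}"
  obtain F where F: "F \<subseteq> poly_funs (vec_coords m)" "\<Delta> = {y \<in> carrier_vec m. \<forall>f\<in>F. f y = 0}"
    using assms unfolding zariski_closed_def by auto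
  define L where "L t p = vec m (\<lambda>i. fst p $ i + t * snd p $ i)" for t :: complex and p :: "complex vec \<times> complex vec"
  have L: "L t (a, b) = line_point a b t" if "(a, b) \<in> line_params m" for a b t
    using that by (auto simp: L_def line_point_def line_params_def)
  define H where "H = (\<lambda>(t, f) p. f (L t p)) ` (UNIV \<times> F)"
  have fst: "(\<lambda>p. fst p $ i) \<in> poly_funs (line_coords m)" if "i < m" for i
    unfolding line_coords_def case_prod_unfold
    by (intro poly_funs.coord UnI1 CollectI exI[of _ i] conjI refl that)
  have snd: "(\<lambda>p. snd p $ i) \<in> poly_funs (line_coords m)" if "i < m" for i
    unfolding line_coords_def case_prod_unfold
    by (intro poly_funs.coord UnI2 CollectI exI[of _ i] conjI refl that)
  have comp: "(\<lambda>p. f (L t p)) \<in> poly_funs (line_coords m)" if "f \<in> F" for f t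
  proof (rule poly_funs_comp[where f = f and X = "vec_coords m" and \<phi> = "L t"])
    show "f \<in> poly_funs (vec_coords m)" using F(1) that by auto
    fix x :: "complex vec \<Rightarrow> complex" assume "x \<in> vec_coords m"
    then obtain i where "i < m" "x = (\<lambda>v. v $ i)" by (auto simp: vec_coords_def)
    then show "(\<lambda>p. x (L t p)) \<in> poly_funs (line_coords m)"
      using fst snd by (auto simp: L_def intro!: poly_funs.add poly_funs.mult poly_funs.const)
  qed
  then have H: "H \<subseteq> poly_funs (line_coords m)" by (auto simp: H_def)
  have "affine_line a b \<subseteq> \<Delta> \<longleftrightarrow> (\<forall>h\<in>H. h (a, b) = 0)" if ab: "(a, b) \<in> line_params m" for a b
  proof -
    have "affine_line a b \<subseteq> \<Delta> \<longleftrightarrow> (\<forall>t. \<forall>f\<in>F. f (line_point a b t) = 0)"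
      using line_point_carrier[OF ab] by (auto simp: affine_line_def F(2))
    also have "\<dots> \<longleftrightarrow> (\<forall>h\<in>H. h (a, b) = 0)" by (auto simp: H_def L[OF ab])
    finally show ?thesis .
  qed
  moreover have "affine_line a b \<in> W \<longleftrightarrow> \<not> affine_line a b \<subseteq> \<Delta>" if "(a, b) \<in> line_params m" for a b
  proof
    assume "affine_line a b \<in> W"
    then obtain a' b' where "affine_line a b = affine_line a' b'" "\<not> affine_line a' b' \<subseteq> \<Delta>" unfolding W_def by blast
    then show "\<not> affine_line a b \<subseteq> \<Delta>" by simp
  qed (use that in \<open>unfold W_def, blast\<close>)
  ultimately have "affine_line a b \<in> W \<longleftrightarrow> \<not> (\<forall>h\<in>H. h (a, b) = 0)" if "(a, b) \<in> line_params m" for a b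
    using that by (simp only: not_not)
  then have eq: "line_params m - {(a, b) \<in> line_params m. affine_line a b \<in> W}
      = {p \<in> line_params m. \<forall>h\<in>H. h p = 0}" by auto
  have "zariski_closed (line_params m) (line_coords m) (line_params m - {(a, b) \<in> line_params m. affine_line a b \<in> W})"
    unfolding zariski_closed_def using eq H by (intro exI[of _ H] conjI)
  moreover have "W \<subseteq> {affine_line a b | a b. (a, b) \<in> line_params m}" unfolding W_def by blast
  ultimately have "zariski_open_lines m W" unfolding zariski_open_lines_def zariski_open_def by auto
  then show ?thesis by (simp only: W_def)
qed

lemma fiber_section_over:
  assumes "m \<le> n" "V \<subseteq> carrier_vec n" "y \<in> L"
  shows "fiber m (section_over n m V L) y = fiber m V y"
proof -
  have "v \<in> {x @\<^sub>v y | x y. x \<in> carrier_vec (n - m) \<and> y \<in> L}" if v: "v \<in> V" "vec_last v m = y" for v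
  proof -
    have "v \<in> carrier_vec ((n - m) + m)" using v(1) assms(1,2) by auto
    then have "v = vec_first v (n - m) @\<^sub>v y" using v(2) vec_first_last_append by metis
    then show ?thesis using assms(3) by (intro CollectI exI[of _ "vec_first v (n - m)"] exI[of _ y]) simp
  qed
  then show ?thesis unfolding fiber_def section_over_def by auto
qed

lemma fibre_sums_affine:
  assumes m: "0 < m" "m \<le> n" and V: "V \<subseteq> carrier_vec n"
    and noether: "noether_position_degree (swapped_point n m ` V) n m d"
  defines "\<Delta> \<equiv> ramification_locus m V d"
  shows "zariski_closed (carrier_vec m) (vec_coords m) \<Delta> \<and> \<Delta> \<noteq> carrier_vec m \<and>
    (\<exists>W. zariski_open_lines m W \<and> W \<noteq> {} \<and>
      (\<forall>L\<in>W. \<not> L \<subseteq> \<Delta> \<and>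
        (\<forall>(a, b) \<in> line_params m. L = affine_line a b \<longrightarrow>
          (let C = section_over n m V L in
            \<exists>c0 \<in> carrier_vec (n - m). \<exists>c1 \<in> carrier_vec (n - m).
              \<forall>t. line_point a b t \<notin> \<Delta> \<longrightarrow>
                fiber_sum n m C (line_point a b t) = t \<cdot>\<^sub>v c0 + c1))))"
proof -
  interpret noether_position_degree "swapped_point n m ` V" n m d by (rule noether)
  have inj: "inj_on (swapped_point n m) (fiber m V y)" for y
    by (rule inj_on_subset[OF inj_on_swapped_point[OF m(2)]]) (use V in \<open>auto simp: fiber_def\<close>)
  have fib: "fibre s = swapped_point n m ` fiber m V (vec m s)" for s
    using fiber_swapped_point[OF m(2) V, of "vec m s"] by (simp add: fibre_def)
  have ram: "ramified s \<longleftrightarrow> vec m s \<in> \<Delta>" for s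
    unfolding ramified_def fib \<Delta>_def ramification_locus_def
    using finite_image_iff[OF inj] card_image[OF inj] by auto
  have \<Delta>_carrier: "\<Delta> \<subseteq> carrier_vec m" by (auto simp: \<Delta>_def ramification_locus_def)
  have closed: "zariski_closed (carrier_vec m) (vec_coords m) \<Delta>"
  proof -
    obtain F where F: "F \<subseteq> poly_funs (coords {..<m})" "\<forall>s. ramified s \<longleftrightarrow> (\<forall>f\<in>F. f s = 0)"
      using ramified_closed by (elim exE conjE) (rule that)
    have "\<Delta> = {y \<in> carrier_vec m. \<forall>f\<in>(\<lambda>f y. f (point m y)) ` F. f y = 0}"
    proof (rule Set.set_eqI)
      fix y
      show "y \<in> \<Delta> \<longleftrightarrow> y \<in> {y \<in> carrier_vec m. \<forall>f\<in>(\<lambda>f y. f (point m y)) ` F. f y = 0}"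
      proof (cases "y \<in> carrier_vec m")
        case True
        have "y \<in> \<Delta> \<longleftrightarrow> ramified (point m y)" unfolding ram vec_point[OF True] ..
        then show ?thesis using F(2) True by simp
      next
        case False
        then show ?thesis using \<Delta>_carrier by auto
      qed
    qed
    moreover have "(\<lambda>f y. f (point m y)) ` F \<subseteq> poly_funs (vec_coords m)" using F(1) poly_funs_point by blast
    ultimately show ?thesis unfolding zariski_closed_def by blast
  qed
  obtain s0 where "\<not> ramified s0" using not_all_ramified by blast
  then have s0: "vec m s0 \<in> carrier_vec m" "vec m s0 \<notin> \<Delta>" by (auto simp: ram)
  define W where "W = {affine_line a b | a b. (a, b) \<in> line_params m \<and> \<not> affine_line a b \<subseteq> \<Delta>}"
  have "zariski_open_lines m W" unfolding W_def by (rule zariski_open_lines_not_contained[OF closed])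
  moreover have "W \<noteq> {}"
  proof -
    \<comment> \<open>Any nonzero direction through an unramified point will do;
      \<open>m > 0\<close> makes this vector nonzero.\<close>
    define b :: "complex vec" where "b = vec m (\<lambda>_. 1)"
    have "b $ 0 \<noteq> 0\<^sub>v m $ 0" using m(1) by (simp add: b_def)
    then have "b \<noteq> 0\<^sub>v m" by auto
    then have "(vec m s0, b) \<in> line_params m" by (simp add: line_params_def b_def)
    moreover have "line_point (vec m s0) b 0 = vec m s0" by (auto simp: line_point_def b_def)
    then have "\<not> affine_line (vec m s0) b \<subseteq> \<Delta>" using s0(2) unfolding affine_line_def by (metis rangeI subsetD)
    ultimately show ?thesis unfolding W_def by blast
  qed
  moreover have "\<exists>c0 \<in> carrier_vec (n - m). \<exists>c1 \<in> carrier_vec (n - m). \<forall>t. line_point a b t \<notin> \<Delta> \<longrightarrow>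
      fiber_sum n m (section_over n m V (affine_line a b)) (line_point a b t) = t \<cdot>\<^sub>v c0 + c1"
    if ab: "(a, b) \<in> line_params m" for a b
  proof -
    let ?S = "\<lambda>t. fiber_sum n m (section_over n m V (affine_line a b)) (line_point a b t)"
    define P where "P t i = point m a i + t * point m b i" for t i
    have P: "vec m (P t) = line_point a b t" for t
      using ab by (auto simp: P_def point_def line_point_def line_params_def)
    have sum_carrier: "?S t \<in> carrier_vec (n - m)" for t
      unfolding fiber_sum_def by (intro finsum_vec_closed) auto
    have sum_index: "?S t $ i = (\<Sum>z\<in>fibre (P t). z (m + i))"
      if t: "line_point a b t \<notin> \<Delta>" and i: "i < n - m" for t i
    proof -
      have fin: "finite (fiber m V (line_point a b t))"
        using t line_point_carrier[OF ab] unfolding \<Delta>_def ramification_locus_def by blast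
      have "?S t $ i = (\<Sum>z\<in>fiber m V (line_point a b t). vec_first z (n - m) $ i)"
        unfolding fiber_sum_def fiber_section_over[OF m(2) V rangeI[of "line_point a b", folded affine_line_def]]
        using fin i by (intro index_finsum_vec) auto
      also have "\<dots> = (\<Sum>z\<in>fiber m V (line_point a b t). swapped_point n m z (m + i))"
        using i by (intro sum.cong) (auto simp: vec_first_def swapped_point_def vec_pos_def)
      also have "\<dots> = (\<Sum>z\<in>fibre (P t). z (m + i))"
        unfolding fib P by (simp add: sum.reindex[OF inj])
      finally show ?thesis .
    qed
    show ?thesis
    proof (cases "\<exists>t0 t1. t0 \<noteq> t1 \<and> line_point a b t0 \<notin> \<Delta> \<and> line_point a b t1 \<notin> \<Delta>")
      \<comment> \<open>With at most one unramified parameter a constant function suffices; if there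
        were none, \<open>t0\<close> would be arbitrary.\<close>
      case False
      obtain t0 where t0: "\<And>t. line_point a b t \<notin> \<Delta> \<Longrightarrow> t = t0" using False by metis
      show ?thesis
      proof (rule bexI[of _ "0\<^sub>v (n - m)"], rule bexI[of _ "?S t0"], intro allI impI)
        fix t assume "line_point a b t \<notin> \<Delta>"
        then have "t = t0" by (rule t0)
        moreover have "t0 \<cdot>\<^sub>v 0\<^sub>v (n - m) = (0\<^sub>v (n - m) :: complex vec)" by auto
        ultimately show "?S t = t \<cdot>\<^sub>v 0\<^sub>v (n - m) + ?S t0" using sum_carrier[of t0] by simp
      qed (use sum_carrier in simp_all)
    next
      case True
      then obtain t0 t1 where t01: "t0 \<noteq> t1" "line_point a b t0 \<notin> \<Delta>" "line_point a b t1 \<notin> \<Delta>" by blast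
      \<comment> \<open>\<open>c0\<close> and \<open>c1\<close> belong to the affine function
        through the values at \<open>t0\<close> and \<open>t1\<close>.\<close>
      define c0 where "c0 = vec (n - m) (\<lambda>i. (?S t1 $ i - ?S t0 $ i) / (t1 - t0))"
      define c1 where "c1 = vec (n - m) (\<lambda>i. (t1 * ?S t0 $ i - t0 * ?S t1 $ i) / (t1 - t0))"
      show ?thesis
      proof (rule bexI[of _ c0], rule bexI[of _ c1], intro allI impI)
        fix t assume t: "line_point a b t \<notin> \<Delta>"
        show "?S t = t \<cdot>\<^sub>v c0 + c1"
        proof (rule eq_vecI)
          show "dim_vec (?S t) = dim_vec (t \<cdot>\<^sub>v c0 + c1)" using sum_carrier[of t] by (simp add: c1_def)
          fix i assume "i < dim_vec (t \<cdot>\<^sub>v c0 + c1)"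
          then have i: "i < n - m" by (simp add: c1_def)
          have nram: "\<not> ramified (P t)" if "line_point a b t \<notin> \<Delta>" for t using that by (simp add: ram P)
          have "(t1 - t0) * ?S t $ i = (t1 - t) * ?S t0 $ i + (t - t0) * ?S t1 $ i"
            unfolding sum_index[OF t i] sum_index[OF t01(2) i] sum_index[OF t01(3) i]
            using fibre_sum_on_line[OF _ _ _ i, of "point m a" t0 "point m b" t1 t] nram t t01 unfolding P_def by blast
          then have "?S t $ i = ((t1 - t) * ?S t0 $ i + (t - t0) * ?S t1 $ i) / (t1 - t0)"
            using t01(1) by (simp add: eq_divide_eq mult.commute)
          also have "\<dots> = (t \<cdot>\<^sub>v c0 + c1) $ i"
            using i by (simp add: c0_def c1_def add_divide_distrib[symmetric] algebra_simps)
          finally show "?S t $ i = (t \<cdot>\<^sub>v c0 + c1) $ i" .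
        qed
      qed (auto simp: c0_def c1_def)
    qed
  qed
  ultimately show ?thesis
    using closed s0 unfolding Let_def
    by (intro conjI exI[of _ W]) (auto simp: W_def)
qed

section \<open>The choice of general coordinates\<close>

lemma det_param_poly: "(\<lambda>g. det (mat n n (\<lambda>(i, j). fst g $$ (i, j)))) \<in> poly_funs (affine_coords n n)"
  by (rule poly_funs_det[where k = n]) (auto intro: affine_coords_fst)

lemma swapped_param_poly:
  assumes "Q \<in> poly_funs (coords ({..<n} \<times> {..n}))" "m \<le> n"
  shows "(\<lambda>g. Q (swapped_param n m g)) \<in> poly_funs (affine_coords n n)"
proof (rule poly_funs_comp[OF assms(1)])
  fix x :: "(nat \<times> nat \<Rightarrow> complex) \<Rightarrow> complex" assume "x \<in> coords ({..<n} \<times> {..n})"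
  then obtain i j where ij: "i < n" "j \<le> n" "x = (\<lambda>s. s (i, j))" by (auto simp: coords_def)
  then show "(\<lambda>g. x (swapped_param n m g)) \<in> poly_funs (affine_coords n n)"
    using vec_pos[OF assms(2) ij(1)] affine_coords_fst[of "vec_pos n m i" n j n] affine_coords_snd[of "vec_pos n m i" n n]
    by (cases "j < n") (auto simp: swapped_param_def)
qed

lemma swapped_param_surj:
  assumes "m \<le> n"
  shows "\<exists>g\<in>affine_maps n n. \<forall>i<n. \<forall>j\<le>n. swapped_param n m g (i, j) = s (i, j)"
  by (rule bexI[of _ "(mat n n (\<lambda>(r, j). s (point_pos n m r, j)), vec n (\<lambda>r. s (point_pos n m r, n)))"])
    (use vec_pos[OF assms] in \<open>auto simp: swapped_param_def affine_maps_def\<close>)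

lemma last_rows_poly:
  assumes "f \<in> poly_funs (affine_coords m n)" "m \<le> n"
  shows "(\<lambda>g. f (last_rows n m g)) \<in> poly_funs (affine_coords n n)"
proof (rule poly_funs_comp[OF assms(1)])
  fix x assume "x \<in> affine_coords m n"
  then show "(\<lambda>g. x (last_rows n m g)) \<in> poly_funs (affine_coords n n)"
    using assms(2)
    by (cases rule: affine_coords_cases) (auto simp: last_rows_def intro!: affine_coords_fst affine_coords_snd)
qed

lemma last_rows_surj:
  assumes "h \<in> affine_maps m n" "m \<le> n"
  shows "\<exists>g\<in>affine_maps n n. last_rows n m g = h"
proof (rule bexI[of _ "(mat n n (\<lambda>(r, j). fst h $$ (r - (n - m), j)), vec n (\<lambda>r. snd h $ (r - (n - m))))"])
  show "last_rows n m (mat n n (\<lambda>(r, j). fst h $$ (r - (n - m), j)), vec n (\<lambda>r. snd h $ (r - (n - m)))) = h"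
  proof -
    obtain e where "n = m + e" using assms(2) le_Suc_ex by blast
    then show ?thesis using assms(1) by (cases h) (auto simp: last_rows_def affine_maps_def)
  qed
qed (simp add: affine_maps_def)

text \<open>Three polynomial conditions, each satisfied somewhere, hold together by irreducibility
  of the space of affine maps: the two given ones and a nonzero determinant.\<close>

lemma good_maps_exist:
  assumes Q: "Q \<in> poly_funs (coords ({..<n} \<times> {..n}))" "Q s \<noteq> 0"
    and f: "f \<in> poly_funs (affine_coords m n)" "h \<in> affine_maps m n" "f h \<noteq> 0" and m: "m \<le> n"
  shows "\<exists>g\<in>affine_group n. Q (swapped_param n m g) * f (last_rows n m g) \<noteq> 0"
proof -
  obtain g1 where g1: "g1 \<in> affine_maps n n" "\<forall>i<n. \<forall>j\<le>n. swapped_param n m g1 (i, j) = s (i, j)"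
    using swapped_param_surj[OF m] by blast
  have Q1: "Q (swapped_param n m g1) \<noteq> 0"
    using poly_funs_agree[OF Q(1), of "swapped_param n m g1" s] g1(2) Q(2) by auto
  obtain g2 where g2: "g2 \<in> affine_maps n n" "last_rows n m g2 = h" using last_rows_surj[OF f(2) m] by blast
  define R where "R g = Q (swapped_param n m g) * f (last_rows n m g)" for g
  have R: "R \<in> poly_funs (affine_coords n n)"
    unfolding R_def[abs_def] by (intro poly_funs.mult swapped_param_poly last_rows_poly Q f m)
  obtain g3 where g3: "g3 \<in> affine_maps n n" "R g3 \<noteq> 0"
    using affine_common_nonzero[OF swapped_param_poly[OF Q(1) m] last_rows_poly[OF f(1) m] g1(1) g2(1) Q1]
      g2(2) f(3) by (auto simp: R_def)
  define D where "D g = det (mat n n (\<lambda>(i, j). fst g $$ (i, j)))" for g :: "complex mat \<times> complex vec"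
  have "(1\<^sub>m n, 0\<^sub>v n) \<in> affine_maps n n" by (simp add: affine_maps_def)
  moreover have "D (1\<^sub>m n, 0\<^sub>v n) \<noteq> 0"
  proof -
    have "mat n n (\<lambda>(i, j). 1\<^sub>m n $$ (i, j)) = (1\<^sub>m n :: complex mat)" by auto
    then show ?thesis by (simp add: D_def)
  qed
  ultimately obtain g where g: "g \<in> affine_maps n n" "R g \<noteq> 0" "D g \<noteq> 0"
    using affine_common_nonzero[OF R det_param_poly g3(1) _ g3(2), of "(1\<^sub>m n, 0\<^sub>v n)"] by (auto simp: D_def)
  have "mat n n (\<lambda>(i, j). fst g $$ (i, j)) = fst g" using g(1) by (cases g) (auto simp: affine_maps_def)
  then have "g \<in> affine_group n" using affine_group_if_det[OF g(1)] g(3) by (simp add: D_def)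
  then show ?thesis using g(2) by (auto simp: R_def)
qed

text \<open>The fibre over \<open>s\<close> is cut out on \<open>V0\<close> by
  \<open>last_rows n m g\<close> translated by \<open>s\<close>. The translate is polynomial in
  \<open>s\<close>, and \<open>f\<close> is nonzero at \<open>s = 0\<close>, so the count in
  \<open>deg\<close> applies over a nonempty open set.\<close>

lemma degree_fibre:
  assumes g: "g \<in> affine_group n" and m: "m \<le> n" and V0: "V0 \<subseteq> carrier_vec n"
    and f: "f \<in> poly_funs (affine_coords m n)" "f (last_rows n m g) \<noteq> 0"
    and deg: "\<And>h. h \<in> affine_maps m n \<Longrightarrow> f h \<noteq> 0 \<Longrightarrow>
      finite {z \<in> V0. affine_apply h z = 0\<^sub>v m} \<and> card {z \<in> V0. affine_apply h z = 0\<^sub>v m} = d"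
  defines "U \<equiv> swapped_point n m ` affine_apply g ` V0"
  shows "\<exists>\<delta>\<in>poly_funs (coords {..<m}). (\<exists>s. \<delta> s \<noteq> 0) \<and>
      (\<forall>s. \<delta> s \<noteq> 0 \<longrightarrow> finite {z \<in> U. \<forall>i<m. z i = s i} \<and> card {z \<in> U. \<forall>i<m. z i = s i} = d)"
proof -
  define h where "h = last_rows n m g"
  have h: "h \<in> affine_maps m n" unfolding h_def by (rule last_rows_maps)
  define k where "k s = (fst h, snd h - vec m s)" for s
  define \<delta> where "\<delta> s = f (k s)" for s
  have k: "k s \<in> affine_maps m n" for s using h by (auto simp: k_def affine_maps_def)
  have gm: "g \<in> affine_maps n n" using g by (auto simp: affine_group_def)
  have "\<delta> \<in> poly_funs (coords {..<m})"
    unfolding \<delta>_def[abs_def]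
  proof (rule poly_funs_comp[OF f(1)])
    fix x assume "x \<in> affine_coords m n"
    then show "(\<lambda>s. x (k s)) \<in> poly_funs (coords {..<m})"
    proof (cases rule: affine_coords_cases)
      case (1 i j)
      then show ?thesis by (simp add: k_def poly_funs.const)
    next
      case (2 i)
      have "(\<lambda>s. snd h $ i - s i) \<in> poly_funs (coords {..<m})"
        using 2 by (intro poly_funs_diff poly_funs.const poly_funs_coord) auto
      then show ?thesis using 2 h by (simp add: k_def)
    qed
  qed
  moreover have "\<delta> (\<lambda>_. 0) \<noteq> 0"
  proof -
    have "snd h - vec m (\<lambda>_. 0) = snd h" using h by (cases h) (auto simp: affine_maps_def)
    then show ?thesis using f(2) by (simp add: \<delta>_def k_def h_def)
  qed
  moreover have "finite {z \<in> U. \<forall>i<m. z i = s i} \<and> card {z \<in> U. \<forall>i<m. z i = s i} = d" if "\<delta> s \<noteq> 0" for s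
  proof -
    let ?F = "{z \<in> V0. affine_apply (k s) z = 0\<^sub>v m}"
    have F: "finite ?F" "card ?F = d" using deg[OF k] that by (auto simp: \<delta>_def)
    have iff: "(\<forall>i<m. swapped_point n m (affine_apply g z) i = s i) \<longleftrightarrow> affine_apply (k s) z = 0\<^sub>v m" if "z \<in> V0" for z
    proof -
      have z: "z \<in> carrier_vec n" using that V0 by auto
      have "affine_apply (k s) z $ i = affine_apply h z $ i - s i" if "i < m" for i
        using that h affine_apply_index[OF k z that, of s] affine_apply_index[OF h z that] by (simp add: k_def)
      moreover have "swapped_point n m (affine_apply g z) i = affine_apply h z $ i" if "i < m" for i
        using affine_apply_last_rows[OF gm m z that] that m by (simp add: h_def swapped_point_def vec_pos_def)
      moreover have "affine_apply (k s) z = 0\<^sub>v m \<longleftrightarrow> (\<forall>i<m. affine_apply (k s) z $ i = 0)"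
        using affine_apply_carrier[OF k[of s], of z] by auto
      ultimately show ?thesis by simp
    qed
    define \<phi> where "\<phi> z = swapped_point n m (affine_apply g z)" for z
    have "{z \<in> U. \<forall>i<m. z i = s i} = \<phi> ` ?F" using iff by (auto simp: U_def \<phi>_def)
    moreover have "inj_on \<phi> V0"
    proof (rule inj_onI)
      fix v w assume vw: "v \<in> V0" "w \<in> V0" "\<phi> v = \<phi> w"
      have "affine_apply g v = affine_apply g w"
        using inj_onD[OF inj_on_swapped_point[OF m] vw(3)[unfolded \<phi>_def]] affine_apply_carrier[OF gm] by blast
      then show "v = w" using inj_onD[OF affine_apply_inj_on[OF g]] vw(1,2) V0 by blast
    qed
    then have "inj_on \<phi> ?F" by (rule inj_on_subset) auto
    ultimately show ?thesis using F by (simp add: card_image)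
  qed
  ultimately show ?thesis by (intro bexI[of _ \<delta>]) auto
qed

theorem proposition3:
  fixes n m d :: nat and V0 :: "complex Matrix.vec set"
  assumes "0 < m" and "m \<le> n"
    and "irreducible_variety n V0"
    and "variety_dim n V0 = enat m"
    and "has_degree n m V0 d"
  shows "\<exists>G. zariski_open (affine_group n) (affine_coords n n) G \<and> G \<noteq> {} \<and>
    (\<forall>g\<in>G.
      let V = affine_apply g ` V0; \<Delta> = ramification_locus m V d in
        zariski_closed (carrier_vec m) (vec_coords m) \<Delta> \<and> \<Delta> \<noteq> carrier_vec m \<and>
        (\<exists>W. zariski_open_lines m W \<and> W \<noteq> {} \<and>
          (\<forall>L\<in>W. \<not> L \<subseteq> \<Delta> \<and>
            (\<forall>(a, b) \<in> line_params m. L = affine_line a b \<longrightarrow>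
              (let C = section_over n m V L in
                \<exists>c0 \<in> carrier_vec (n - m). \<exists>c1 \<in> carrier_vec (n - m).
                  \<forall>t. line_point a b t \<notin> \<Delta> \<longrightarrow>
                    fiber_sum n m C (line_point a b t) = t \<cdot>\<^sub>v c0 + c1)))))"
proof -
  note m = assms(2) and V0 = assms(3)
  have V0_carrier: "V0 \<subseteq> carrier_vec n" using irreducible_variety_carrier[OF V0] .
  define X where "X = point n ` V0"
  have "X \<noteq> {}" using V0 by (auto simp: X_def irreducible_variety_def)
  obtain k Q q0 where k: "k \<le> n" "Q \<in> poly_funs (coords ({..<n} \<times> {..n}))" "Q q0 \<noteq> 0"
    "\<forall>r f. (\<forall>i<r. f i \<in> poly_funs (coords {..<n})) \<longrightarrow> alg_independent X r f \<longrightarrow> r \<le> k"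
    "\<forall>g. Q g \<noteq> 0 \<longrightarrow> coords {..<n} \<subseteq> polys_upto (affine_form n g ` {..<n}) 1 \<longrightarrow>
      alg_independent X k (affine_form n g) \<and>
      (\<forall>i\<in>{k..<n}. weighted_integral X (affine_form n g ` {..<k}) (affine_form n g i))"
    using generic_noether_normalization[OF \<open>X \<noteq> {}\<close>, of n] by (elim exE bexE conjE) (rule that)
  \<comment> \<open>A chain in \<open>V0\<close> of length at least \<open>m\<close> gives at least
    \<open>m\<close> functions that are independent on \<open>X\<close>.\<close>
  have "m \<le> k"
  proof -
    obtain r and Z :: "nat \<Rightarrow> complex vec set" where r: "m \<le> r"
      "\<forall>i\<le>r. irreducible_variety n (Z i) \<and> Z i \<subseteq> V0" "\<forall>i<r. Z i \<subset> Z (Suc i)"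
      using variety_dim_chain[OF assms(4,1)] by (elim exE conjE) (rule that)
    obtain f where f: "\<forall>i<r. f i \<in> poly_funs (vec_coords n)" "alg_independent (Z r) r f"
      using chain_alg_independent[of r n Z] r(2,3) by blast
    have "alg_independent X r (\<lambda>i s. f i (vec n s))"
      unfolding alg_independent_def
    proof (intro ballI impI)
      fix G assume G: "G \<in> poly_funs (coords {..<r})" "\<forall>s\<in>X. G (\<lambda>i. f i (vec n s)) = 0"
      have "G (\<lambda>i. f i z) = 0" if "z \<in> Z r" for z
      proof -
        have "z \<in> V0" using r(2) that by auto
        then show ?thesis using G(2) vec_point V0_carrier by (force simp: X_def)
      qed
      then show "\<forall>s. G s = 0" using f(2)[unfolded alg_independent_def, THEN bspec, OF G(1)] by blast
    qed
    moreover have "\<forall>i<r. (\<lambda>s. f i (vec n s)) \<in> poly_funs (coords {..<n})" using f(1) poly_funs_vec by blast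
    ultimately have "r \<le> k" using k(4)[rule_format, of r "\<lambda>i s. f i (vec n s)"] by blast
    then show ?thesis using r(1) by simp
  qed
  have noether: "noether_position (affine_image n (swapped_param n m g) ` X) n k"
    if g: "g \<in> affine_group n" "Q (swapped_param n m g) \<noteq> 0" for g
  proof -
    obtain S where S: "\<forall>i<n. (\<lambda>s. S s i) \<in> poly_funs (coords {..<n})"
      "\<forall>i<n. \<forall>s. S (affine_image n (swapped_param n m g) s) i = s i"
      "\<forall>i<n. \<forall>s. affine_image n (swapped_param n m g) (S s) i = s i"
      "coords {..<n} \<subseteq> polys_upto (affine_form n (swapped_param n m g) ` {..<n}) 1"
      using swapped_param_inverse[OF g(1) m] by (elim exE conjE) (rule that)
    have good: "alg_independent X k (affine_form n (swapped_param n m g))"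
      "\<forall>i\<in>{k..<n}. weighted_integral X (affine_form n (swapped_param n m g) ` {..<k}) (affine_form n (swapped_param n m g) i)"
      using k(5)[rule_format, OF g(2) S(4)] by blast+
    show ?thesis
    proof (rule noether_position_affine_image[where S = S])
      show "r \<le> k" if "\<And>i. i < r \<Longrightarrow> f i \<in> poly_funs (coords {..<n})" "alg_independent X r f" for r f
        using k(4)[rule_format, of r f] that by blast
    qed (use k(1) good S irreducible_variety_point_mult[OF V0, folded X_def]
        irreducible_variety_closure_point[OF V0, folded X_def] in auto)
  qed
  have image: "affine_image n (swapped_param n m g) ` X = swapped_point n m ` affine_apply g ` V0"
    if "g \<in> affine_group n" for g
    using affine_image_point[of g n m] that m V0_carrier unfolding X_def image_image
    by (intro image_cong) (auto simp: affine_group_def)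
  obtain U where U: "zariski_open (affine_maps m n) (affine_coords m n) U" "U \<noteq> {}"
    "\<forall>h\<in>U. finite {z \<in> V0. affine_apply h z = 0\<^sub>v m} \<and> card {z \<in> V0. affine_apply h z = 0\<^sub>v m} = d"
    using assms(5) unfolding has_degree_def by blast
  obtain f h0 where f: "f \<in> poly_funs (affine_coords m n)" "h0 \<in> affine_maps m n" "f h0 \<noteq> 0"
    "{h \<in> affine_maps m n. f h \<noteq> 0} \<subseteq> U"
    using zariski_open_witness[OF U(1,2)] by (elim bexE conjE) (rule that)
  have deg: "finite {z \<in> V0. affine_apply h z = 0\<^sub>v m} \<and> card {z \<in> V0. affine_apply h z = 0\<^sub>v m} = d"
    if "h \<in> affine_maps m n" "f h \<noteq> 0" for h
    using f(4) U(3) that by blast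
  \<comment> \<open>The first factor puts the image in Noether position, the second makes its fibre
    over the origin a general section.\<close>
  define R where "R g = Q (swapped_param n m g) * f (last_rows n m g)" for g
  have R: "R \<in> poly_funs (affine_coords n n)"
    unfolding R_def[abs_def] by (intro poly_funs.mult swapped_param_poly last_rows_poly k f m)
  obtain g0 where g0: "g0 \<in> affine_group n" "R g0 \<noteq> 0"
    unfolding R_def using good_maps_exist[OF k(2,3) f(1-3) m] by blast
  \<comment> \<open>If \<open>k\<close> were larger, entry \<open>m\<close> could be prescribed
    freely over the origin of \<open>y\<close>-space, and the finite section \<open>?F\<close> would
    map onto all complex numbers.\<close>
  have "k = m"
  proof (rule ccontr)
    assume "k \<noteq> m"
    then have "m < k" using \<open>m \<le> k\<close> by simp
    interpret noether_position "affine_image n (swapped_param n m g0) ` X" n k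
      using noether[OF g0(1)] g0(2) by (auto simp: R_def)
    have gm: "g0 \<in> affine_maps n n" using g0(1) by (auto simp: affine_group_def)
    let ?F = "{z \<in> V0. affine_apply (last_rows n m g0) z = 0\<^sub>v m}"
    have "finite ?F" using deg[OF last_rows_maps] g0(2) by (auto simp: R_def)
    moreover have "c \<in> (\<lambda>z. swapped_point n m (affine_apply g0 z) m) ` ?F" for c
    proof -
      obtain s where s: "s \<in> affine_image n (swapped_param n m g0) ` X" "\<forall>i<k. s i = (if i = m then c else 0)"
        using projection_surjective[of "\<lambda>i. if i = m then c else 0"] by blast
      then obtain z where z: "z \<in> V0" "s = swapped_point n m (affine_apply g0 z)" unfolding image[OF g0(1)] by blast
      have zc: "z \<in> carrier_vec n" using z(1) V0_carrier by auto
      have "affine_apply (last_rows n m g0) z $ i = 0" if "i < m" for i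
      proof -
        have "s i = 0" using s(2) that \<open>m < k\<close> by simp
        then show ?thesis using affine_apply_last_rows[OF gm m zc that] that m z(2)
          by (simp add: swapped_point_def vec_pos_def)
      qed
      then have "affine_apply (last_rows n m g0) z = 0\<^sub>v m"
        using affine_apply_carrier[OF last_rows_maps[of n m g0], of z] by auto
      moreover have "swapped_point n m (affine_apply g0 z) m = c" using s(2) z(2) \<open>m < k\<close> by simp
      ultimately show ?thesis using z(1) by blast
    qed
    then have "UNIV \<subseteq> (\<lambda>z. swapped_point n m (affine_apply g0 z) m) ` ?F" by blast
    ultimately have "finite (UNIV :: complex set)" using finite_surj by blast
    then show False using infinite_UNIV_char_0 by blast
  qed
  define G where "G = {g \<in> affine_group n. R g \<noteq> 0}"
  have "zariski_open (affine_group n) (affine_coords n n) G"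
    unfolding zariski_open_def zariski_closed_def
    using R by (auto simp: G_def intro!: exI[of _ "{R}"])
  moreover have "g0 \<in> G" using g0 unfolding G_def by blast
  then have "G \<noteq> {}" by blast
  moreover have "let V = affine_apply g ` V0; \<Delta> = ramification_locus m V d in
        zariski_closed (carrier_vec m) (vec_coords m) \<Delta> \<and> \<Delta> \<noteq> carrier_vec m \<and>
        (\<exists>W. zariski_open_lines m W \<and> W \<noteq> {} \<and>
          (\<forall>L\<in>W. \<not> L \<subseteq> \<Delta> \<and>
            (\<forall>(a, b) \<in> line_params m. L = affine_line a b \<longrightarrow>
              (let C = section_over n m V L in
                \<exists>c0 \<in> carrier_vec (n - m). \<exists>c1 \<in> carrier_vec (n - m).
                  \<forall>t. line_point a b t \<notin> \<Delta> \<longrightarrow>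
                    fiber_sum n m C (line_point a b t) = t \<cdot>\<^sub>v c0 + c1))))" if "g \<in> G" for g
  proof -
    have g: "g \<in> affine_group n" "Q (swapped_param n m g) \<noteq> 0" "f (last_rows n m g) \<noteq> 0"
      using that by (auto simp: G_def R_def)
    have "noether_position (swapped_point n m ` affine_apply g ` V0) n m"
      using noether[OF g(1,2)] unfolding image[OF g(1)] \<open>k = m\<close> .
    moreover have "s i = 0" if "s \<in> swapped_point n m ` affine_apply g ` V0" "n \<le> i" for s i
      using that by (auto simp: swapped_point_def)
    ultimately have "noether_position_degree (swapped_point n m ` affine_apply g ` V0) n m d"
      using degree_fibre[OF g(1) m V0_carrier f(1) g(3) deg]
      unfolding noether_position_degree_def noether_position_degree_axioms_def by (intro conjI allI impI)
    moreover have "affine_apply g ` V0 \<subseteq> carrier_vec n"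
      using affine_apply_carrier[of g n n] g(1) by (auto simp: affine_group_def)
    ultimately show ?thesis
      unfolding Let_def by (intro fibre_sums_affine[OF assms(1) m, unfolded Let_def])
  qed
  ultimately show ?thesis by (intro exI[of _ G] conjI ballI)
qed

end
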